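(* Let $p$ be a prime, let $k$ be a field of characteristic $p$, and let $d\ge 2$ be an integer. Then the Krull dimension of the Witt–Burnside ring $\mathbf W_{\mathbf Z_p^d}(k)$ is infinite.
   Context: Witt–Burnside rings. For a profinite group $G$, let $\mathcal F(G)$ be the set of isomorphism classes of finite discrete transitive $G$-sets (each is $G/H$, $H$ open). Write $U\le T$ if there is a $G$-map $T\to U$, and let $\varphi_T(U)$ be the number of $G$-maps $T\to U$ (for $G$ abelian, $\varphi_T(U)=\#U$ when $U\le T$). The $T$-th Witt polynomial is $W_T(\underline X)=\sum_{U\le T}\varphi_T(U)X_U^{\#T/\#U}$. By Dress–Siebeneicher there are unique polynomials $S_T,M_T\in\mathbf Z[\underline X,\underline Y]$ with $W_T(\underline X)+W_T(\underline Y)=W_T(\underline S)$ and $W_T(\underline X)W_T(\underline Y)=W_T(\underline M)$ for all $T$. For a commutative ring $A$, $\mathbf W_G(A)$ is the set $\prod_{T\in\mathcal F(G)}A$ with $\mathbf a+\mathbf b=(S_T(\mathbf a,\mathbf b))_T$ and $\mathbf a\mathbf b=(M_T(\mathbf a,\mathbf b))_T$; it is a commutative ring. Here $G=\mathbf Z_p^d$ is the additive profinite group. *)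

theory Defs
  imports
    "HOL-Algebra.Algebra"
    "HOL-Analysis.Analysis"
    "HOL-Library.Poly_Mapping"
    "HOL-Library.Extended_Nat"
begin

text \<open>
  A topological group is given by a HOL-Algebra group \<open>G\<close> together with a topology \<open>\<Omega>\<close> on
  \<open>carrier G\<close>.  The definitions up to \<open>witt_burnside_ring\<close> are meant for profinite \<open>(G, \<Omega>)\<close>;
  open subgroups then have finite index, so all cardinalities and sums below are finite.
\<close>

definition open_subgroups :: "('a, 'm) monoid_scheme \<Rightarrow> 'a topology \<Rightarrow> 'a set set"
  where "open_subgroups G \<Omega> = {H. subgroup H G \<and> openin \<Omega> H}"

definition coset_maps :: "('a, 'm) monoid_scheme \<Rightarrow> 'a set \<Rightarrow> 'a set \<Rightarrow> ('a set \<Rightarrow> 'a set) set"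
  where
  "coset_maps G H K =
     {f \<in> (lcosets\<^bsub>G\<^esub> H) \<rightarrow>\<^sub>E (lcosets\<^bsub>G\<^esub> K).
        \<forall>g\<in>carrier G. \<forall>C\<in>lcosets\<^bsub>G\<^esub> H. f (g <#\<^bsub>G\<^esub> C) = g <#\<^bsub>G\<^esub> f C}"

definition coset_iso :: "('a, 'm) monoid_scheme \<Rightarrow> 'a topology \<Rightarrow> ('a set \<times> 'a set) set"
  where
  "coset_iso G \<Omega> =
     {(H, K). H \<in> open_subgroups G \<Omega> \<and> K \<in> open_subgroups G \<Omega> \<and>
        (\<exists>f\<in>coset_maps G H K. bij_betw f (lcosets\<^bsub>G\<^esub> H) (lcosets\<^bsub>G\<^esub> K))}"

text \<open>
  The isomorphism class of a finite discrete transitive \<open>G\<close>-set \<open>T\<close> is encoded as the set of all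
  open subgroups \<open>H\<close> such that \<open>T\<close> is isomorphic to \<open>G/H\<close>.
\<close>

definition frame :: "('a, 'm) monoid_scheme \<Rightarrow> 'a topology \<Rightarrow> 'a set set set"
  where "frame G \<Omega> = open_subgroups G \<Omega> // coset_iso G \<Omega>"

text \<open>
  The quantities \<open>#T\<close> and \<open>\<phi>\<^sub>T(U)\<close> depend only on isomorphism classes, so they are computed on an
  arbitrarily chosen representative \<open>G/H\<close>.
\<close>

definition class_rep :: "'a set set \<Rightarrow> 'a set"
  where "class_rep T = (SOME H. H \<in> T)"

definition class_size :: "('a, 'm) monoid_scheme \<Rightarrow> 'a set set \<Rightarrow> nat"
  where "class_size G T = card (lcosets\<^bsub>G\<^esub> (class_rep T))"

definition class_le :: "('a, 'm) monoid_scheme \<Rightarrow> 'a set set \<Rightarrow> 'a set set \<Rightarrow> bool"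
  where "class_le G U T \<longleftrightarrow> coset_maps G (class_rep T) (class_rep U) \<noteq> {}"

definition num_maps :: "('a, 'm) monoid_scheme \<Rightarrow> 'a set set \<Rightarrow> 'a set set \<Rightarrow> nat"
  where "num_maps G T U = card (coset_maps G (class_rep T) (class_rep U))"

text \<open>
  The Witt polynomial \<open>W\<^sub>T\<close>, evaluated at a family \<open>x\<close> of elements of any commutative ring; taking
  for \<open>x\<close> the indeterminates of a polynomial ring gives the polynomial itself.
\<close>

definition witt ::
  "('a, 'm) monoid_scheme \<Rightarrow> 'a topology \<Rightarrow> 'a set set \<Rightarrow> ('a set set \<Rightarrow> 'r) \<Rightarrow> 'r::comm_ring_1"
  where
  "witt G \<Omega> T x =
     (\<Sum>U \<in> {U \<in> frame G \<Omega>. class_le G U T}.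
        of_nat (num_maps G T U) * x U ^ (class_size G T div class_size G U))"

type_synonym 'v intpoly = "('v \<Rightarrow>\<^sub>0 nat) \<Rightarrow>\<^sub>0 int"

definition indet :: "'v \<Rightarrow> 'v intpoly"
  where "indet v = Poly_Mapping.single (Poly_Mapping.single v 1) 1"

definition poly_eval :: "('v \<Rightarrow> 'r) \<Rightarrow> 'v intpoly \<Rightarrow> 'r::comm_ring_1"
  where
  "poly_eval x P =
     (\<Sum>m \<in> Poly_Mapping.keys P. of_int (Poly_Mapping.lookup P m) *
        (\<Prod>v \<in> Poly_Mapping.keys m. x v ^ Poly_Mapping.lookup m v))"

text \<open>
  The Dress--Siebeneicher polynomials.  The indeterminate \<open>X\<^sub>U\<close> is \<open>indet (Inl U)\<close> and \<open>Y\<^sub>U\<close> is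
  \<open>indet (Inr U)\<close>.  The family is extensional, which only fixes its irrelevant values outside
  \<open>frame G \<Omega>\<close>; the identities determine it uniquely within it.
\<close>

definition witt_sum ::
  "('a, 'm) monoid_scheme \<Rightarrow> 'a topology \<Rightarrow> 'a set set \<Rightarrow> ('a set set + 'a set set) intpoly"
  where
  "witt_sum G \<Omega> =
     (THE S. S \<in> extensional (frame G \<Omega>) \<and>
        (\<forall>T\<in>frame G \<Omega>.
           witt G \<Omega> T (\<lambda>U. indet (Inl U)) + witt G \<Omega> T (\<lambda>U. indet (Inr U)) = witt G \<Omega> T S))"

definition witt_prod ::
  "('a, 'm) monoid_scheme \<Rightarrow> 'a topology \<Rightarrow> 'a set set \<Rightarrow> ('a set set + 'a set set) intpoly"
  where
  "witt_prod G \<Omega> =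
     (THE M. M \<in> extensional (frame G \<Omega>) \<and>
        (\<forall>T\<in>frame G \<Omega>.
           witt G \<Omega> T (\<lambda>U. indet (Inl U)) * witt G \<Omega> T (\<lambda>U. indet (Inr U)) = witt G \<Omega> T M))"

text \<open>
  The coefficient ring \<open>A\<close> is the type \<open>'c\<close>.  The zero is the zero family; the one is the
  family with entry \<open>1\<close> at the one-point \<open>G\<close>-set and \<open>0\<close> elsewhere.
\<close>

definition witt_burnside_ring ::
  "('a, 'm) monoid_scheme \<Rightarrow> 'a topology \<Rightarrow> ('a set set \<Rightarrow> 'c::comm_ring_1) ring"
  where
  "witt_burnside_ring G \<Omega> =
     \<lparr>carrier = frame G \<Omega> \<rightarrow>\<^sub>E UNIV,
      monoid.mult = (\<lambda>a b. \<lambda>T\<in>frame G \<Omega>. poly_eval (case_sum a b) (witt_prod G \<Omega> T)),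
      one = (\<lambda>T\<in>frame G \<Omega>. if class_size G T = 1 then 1 else 0),
      ring.zero = (\<lambda>T\<in>frame G \<Omega>. 0),
      ring.add = (\<lambda>a b. \<lambda>T\<in>frame G \<Omega>. poly_eval (case_sum a b) (witt_sum G \<Omega> T))\<rparr>"

text \<open>The \<open>p\<close>-adic integers as the inverse limit of the groups of integers modulo \<open>p ^ n\<close>.\<close>

definition Zp :: "nat \<Rightarrow> (nat \<Rightarrow> int) monoid"
  where
  "Zp p = (product_group UNIV (\<lambda>n. integer_mod_group (p ^ n)))
     \<lparr>carrier := {x \<in> \<Pi>\<^sub>E n\<in>UNIV. carrier (integer_mod_group (p ^ n)).
                   \<forall>n. x (Suc n) mod int (p ^ n) = x n}\<rparr>"

definition Zp_topology :: "nat \<Rightarrow> (nat \<Rightarrow> int) topology"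
  where
  "Zp_topology p =
     subtopology
       (product_topology (\<lambda>n. discrete_topology (carrier (integer_mod_group (p ^ n)))) UNIV)
       (carrier (Zp p))"

definition Zp_power :: "nat \<Rightarrow> nat \<Rightarrow> (nat \<Rightarrow> nat \<Rightarrow> int) monoid"
  where "Zp_power p d = product_group {..<d} (\<lambda>_. Zp p)"

definition Zp_power_topology :: "nat \<Rightarrow> nat \<Rightarrow> (nat \<Rightarrow> nat \<Rightarrow> int) topology"
  where "Zp_power_topology p d = product_topology (\<lambda>_. Zp_topology p) {..<d}"

text \<open>
  The Krull dimension as the supremum of the lengths \<open>n\<close> of strict chains
  \<open>P 0 \<subset> \<dots> \<subset> P n\<close> of prime ideals.  It is \<open>0\<close> by convention if there is no prime ideal.
\<close>

definition krull_dim :: "('a, 'm) ring_scheme \<Rightarrow> enat"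
  where
  "krull_dim R =
     (SUP n \<in> {n. \<exists>P. (\<forall>i\<le>n. primeideal (P i) R) \<and> (\<forall>i<n. P i \<subset> P (Suc i))}. enat n)"

end

theory Submission
  imports Defs
begin

text \<open>
  The open subgroups of \<open>G = \<int>\<^sub>p\<^sup>d\<close> are the points of its frame, and a quotient map of \<open>G\<close> onto
  \<open>\<int>\<^sub>p\<close> selects a chain of them on which the Witt polynomials are the \<open>p\<close>-typical ones. So each
  such quotient, or line, gives a ring map from the Witt--Burnside ring to the ring of \<open>p\<close>-typical
  Witt vectors over \<open>k\<close>, which forgets all coordinates outside of the chain. Over a field of
  characteristic \<open>p\<close> the position of the first nonzero coordinate of a \<open>p\<close>-typical Witt vector is
  additive under multiplication (\<open>chain_mult_leading\<close>). Hence a Witt--Burnside vector has an order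
  of vanishing along each line, and this order behaves like a valuation.

  For \<open>d \<ge> 2\<close> there are infinitely many lines, and far out in their chains they share no subgroup
  (\<open>line_subgroup_separated\<close>). As the coordinates of a Witt--Burnside vector are arbitrary, the
  orders along the \<open>n\<close>-th line can be prescribed independently, as soon as they are larger than
  \<open>n\<close>. Fix a free ultrafilter on the indices of the lines. For a function \<open>g\<close>, the vectors whose
  order along the \<open>n\<close>-th line eventually exceeds every multiple of \<open>g n\<close> form a prime ideal
  (\<open>growth_ideal_prime\<close>): if two factors fail to lie in it, with the multiples \<open>C\<close> and \<open>C'\<close>, then
  the order of the product is less than \<open>(C + C') * g n\<close>. The functions \<open>(n + 1)\<^sup>j\<close> give a strictly
  descending sequence of such ideals (\<open>growth_ideal_strict\<close>), so there are chains of primes of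
  every length.

  The other half of the work is to see that the ring exists, that is, that the polynomials which
  define its operations have integral coefficients. This follows from congruences in the manner of
  Dwork. With the lift \<open>\<phi>\<close> of Frobenius that raises each indeterminate to its \<open>p\<close>-th power, a
  family \<open>b\<close> of integral polynomials indexed by the open subgroups is the vector of ghost
  components of a Witt vector if and only if for every open subgroup \<open>H\<close> the sum over
  \<open>g \<in> G/H\<close> of the \<open>b\<close> at \<open>\<langle>H, g\<rangle>\<close>, twisted by the power of \<open>\<phi>\<close> given by the order of \<open>g\<close>, is
  divisible by the index of \<open>H\<close> (\<open>frobenius_sum_ghost\<close>, \<open>ghost_exists_if_congruences\<close>). These
  conditions are additive, which settles sums and negatives. Products follow since a product of
  two ghost vectors with a single nonzero coordinate is a multiple of a third one
  (\<open>single_ghost_mult\<close>). The ring axioms then hold because they hold for ghost components.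
\<close>

section \<open>Integral polynomials in arbitrarily many indeterminates\<close>

locale unital_ring_map =
  fixes h :: "'r::comm_ring_1 \<Rightarrow> 's::comm_ring_1"
  assumes map_one: "h 1 = 1"
    and map_add: "h (a + b) = h a + h b"
    and map_mult: "h (a * b) = h a * h b"
begin

lemma map_zero: "h 0 = 0"
  using map_add[of 0 0] by simp

lemma map_sum: "h (sum f A) = (\<Sum>a\<in>A. h (f a))"
  by (induction A rule: infinite_finite_induct) (auto simp: map_zero map_add)

lemma map_prod: "h (prod f A) = (\<Prod>a\<in>A. h (f a))"
  by (induction A rule: infinite_finite_induct) (auto simp: map_one map_mult)

lemma map_power: "h (a ^ n) = h a ^ n"
  by (induction n) (auto simp: map_one map_mult)

lemma map_uminus: "h (- a) = - h a"
  using map_add[of a "- a"] by (simp add: map_zero minus_unique)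

lemma map_diff: "h (a - b) = h a - h b"
  using map_add[of a "- b"] by (simp add: map_uminus)

lemma map_of_nat: "h (of_nat n) = of_nat n"
  by (induction n) (auto simp: map_zero map_one map_add)

lemma map_of_int: "h (of_int k) = of_int k"
  by (cases k rule: int_cases2) (auto simp: map_uminus map_of_nat)

lemma map_dvd: "a dvd b \<Longrightarrow> h a dvd h b"
  by (metis dvd_def map_mult)

end

definition monomial_eval :: "('v \<Rightarrow> 'r) \<Rightarrow> ('v \<Rightarrow>\<^sub>0 nat) \<Rightarrow> 'r::comm_ring_1"
  where "monomial_eval x m = (\<Prod>v \<in> Poly_Mapping.keys m. x v ^ Poly_Mapping.lookup m v)"

lemma monomial_eval_superset:
  assumes "finite S" "Poly_Mapping.keys m \<subseteq> S"
  shows "monomial_eval x m = (\<Prod>v\<in>S. x v ^ Poly_Mapping.lookup m v)"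
  unfolding monomial_eval_def using assms
  by (intro prod.mono_neutral_left) (auto simp: in_keys_iff)

lemma monomial_eval_zero [simp]: "monomial_eval x 0 = 1"
  by (simp add: monomial_eval_def)

lemma monomial_eval_add: "monomial_eval x (m + n) = monomial_eval x m * monomial_eval x n"
proof -
  let ?S = "Poly_Mapping.keys m \<union> Poly_Mapping.keys n"
  have "monomial_eval x (m + n) = (\<Prod>v\<in>?S. x v ^ Poly_Mapping.lookup (m + n) v)"
    by (intro monomial_eval_superset) (auto simp: Poly_Mapping.keys_add)
  also have "\<dots> = monomial_eval x m * monomial_eval x n"
    by (simp add: lookup_add power_add prod.distrib
        monomial_eval_superset[where S="?S" and m=m] monomial_eval_superset[where S="?S" and m=n])
  finally show ?thesis .
qed

lemma poly_eval_superset: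
  assumes "finite S" "Poly_Mapping.keys P \<subseteq> S"
  shows "poly_eval x P = (\<Sum>m\<in>S. of_int (Poly_Mapping.lookup P m) * monomial_eval x m)"
  unfolding poly_eval_def monomial_eval_def using assms
  by (intro sum.mono_neutral_left) (auto simp: in_keys_iff)

lemma poly_eval_add: "poly_eval x (P + Q) = poly_eval x P + poly_eval x Q"
proof -
  let ?S = "Poly_Mapping.keys P \<union> Poly_Mapping.keys Q"
  have "poly_eval x (P + Q) =
      (\<Sum>m\<in>?S. of_int (Poly_Mapping.lookup (P + Q) m) * monomial_eval x m)"
    by (intro poly_eval_superset) (auto simp: Poly_Mapping.keys_add)
  also have "\<dots> = poly_eval x P + poly_eval x Q"
    by (simp add: lookup_add algebra_simps sum.distrib
        poly_eval_superset[where S="?S" and P=P] poly_eval_superset[where S="?S" and P=Q])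
  finally show ?thesis .
qed

lemma poly_eval_zero [simp]: "poly_eval x 0 = 0"
  by (simp add: poly_eval_def)

lemma poly_eval_sum: "poly_eval x (sum f A) = (\<Sum>a\<in>A. poly_eval x (f a))"
  by (induction A rule: infinite_finite_induct) (auto simp: poly_eval_add)

lemma poly_eval_single: "poly_eval x (Poly_Mapping.single m c) = of_int c * monomial_eval x m"
  by (subst poly_eval_superset[of "{m}"]) (auto split: if_splits)

lemma intpoly_as_sum_of_monomials:
  fixes P :: "'v intpoly"
  shows "P = (\<Sum>m\<in>Poly_Mapping.keys P. Poly_Mapping.single m (Poly_Mapping.lookup P m))"
  by (rule poly_mapping_eqI) (auto simp: lookup_sum lookup_single when_def in_keys_iff)

lemma poly_eval_mult: "poly_eval x (P * Q) = poly_eval x P * poly_eval x Q"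
proof -
  have "P * Q = (\<Sum>m\<in>Poly_Mapping.keys P. \<Sum>n\<in>Poly_Mapping.keys Q.
      Poly_Mapping.single (m + n) (Poly_Mapping.lookup P m * Poly_Mapping.lookup Q n))"
    by (subst (1) intpoly_as_sum_of_monomials[of P], subst (1) intpoly_as_sum_of_monomials[of Q])
      (simp add: sum_product mult_single)
  then show ?thesis
    by (simp add: poly_eval_sum poly_eval_single monomial_eval_add)
      (simp add: poly_eval_superset[OF finite_keys order_refl] sum_product algebra_simps)
qed

lemma poly_eval_one [simp]: "poly_eval x 1 = 1"
  using poly_eval_single[of x 0 1] by simp

interpretation poly_eval: unital_ring_map "poly_eval x" for x
  by unfold_locales (auto simp: poly_eval_add poly_eval_mult)

lemma poly_eval_indet [simp]: "poly_eval x (indet v) = x v"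
  by (simp add: indet_def poly_eval_single monomial_eval_def)

text \<open>
  Applied to evaluations, this is the composition law of polynomial substitution; it lets every
  identity between integral polynomials specialize to all commutative rings.
\<close>

lemma (in unital_ring_map) map_poly_eval: "h (poly_eval x P) = poly_eval (\<lambda>v. h (x v)) P"
  by (simp add: poly_eval_def map_sum map_mult map_of_int map_prod map_power)

lemma monomial_eval_indet: "monomial_eval indet m = Poly_Mapping.single m 1"
proof (induction m rule: update_induct)
  case const
  then show ?case by simp
next
  case (update f a b)
  have eq: "Poly_Mapping.update a b f = f + Poly_Mapping.single a b"
    using update by (intro poly_mapping_eqI)
      (auto simp: lookup_update lookup_add lookup_single when_def in_keys_iff)
  have pw: "indet a ^ n = Poly_Mapping.single (Poly_Mapping.single a n) 1" for n
    by (induction n) (auto simp: indet_def mult_single simp flip: single_add)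
  have "monomial_eval indet (Poly_Mapping.single a b) = (indet a :: 'a intpoly) ^ b"
    by (subst monomial_eval_superset[of "{a}"]) auto
  then show ?case
    by (simp add: eq monomial_eval_add update pw mult_single)
qed

lemma of_int_intpoly: "(of_int c :: 'v intpoly) = Poly_Mapping.single 0 c"
proof -
  have "(of_nat n :: 'v intpoly) = Poly_Mapping.single 0 (int n)" for n
    using single_of_nat[of n, where ?'b=int] by simp
  then show ?thesis
    by (cases c rule: int_cases2) (auto simp: single_uminus)
qed

lemma poly_eval_indet_id: "poly_eval indet P = P"
  by (subst (2) intpoly_as_sum_of_monomials[of P])
    (simp add: poly_eval_superset[OF finite_keys order_refl] monomial_eval_indet of_int_intpoly
      mult_single)

lemma intpoly_induct [case_names one indet add mult uminus]:
  fixes P :: "'v intpoly"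
  assumes one: "R 1" and indet: "\<And>v. R (indet v)"
    and add: "\<And>a b. R a \<Longrightarrow> R b \<Longrightarrow> R (a + b)"
    and mult: "\<And>a b. R a \<Longrightarrow> R b \<Longrightarrow> R (a * b)"
    and uminus: "\<And>a. R a \<Longrightarrow> R (- a)"
  shows "R P"
proof -
  have zero: "R 0"
    using add[OF one uminus[OF one]] by simp
  have sum: "R (sum f A)" if "\<And>a. a \<in> A \<Longrightarrow> R (f a)" for f :: "'b \<Rightarrow> _" and A
    using that by (induction A rule: infinite_finite_induct) (auto intro: zero add)
  have prod: "R (prod f A)" if "\<And>a. a \<in> A \<Longrightarrow> R (f a)" for f :: "'b \<Rightarrow> _" and A
    using that by (induction A rule: infinite_finite_induct) (auto intro: one mult)
  have pow: "R (a ^ n)" if "R a" for a n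
    using that by (induction n) (auto intro: one mult)
  have nat: "R (of_nat n)" for n
    by (induction n) (auto intro: zero one add)
  have int: "R (of_int c)" for c
    by (cases c rule: int_cases2) (auto intro: nat uminus)
  have "R (poly_eval indet P)"
    unfolding poly_eval_def by (intro sum mult int prod pow indet)
  then show ?thesis
    by (simp add: poly_eval_indet_id)
qed

lemma lookup_of_nat_mult:
  fixes P :: "'v intpoly"
  shows "Poly_Mapping.lookup (of_nat n * P) m = int n * Poly_Mapping.lookup P m"
proof (induction n)
  case (Suc n)
  then show ?case by (simp add: algebra_simps lookup_add)
qed simp

lemma intpoly_of_nat_cancel:
  fixes P Q :: "'v intpoly"
  assumes "of_nat n * P = of_nat n * Q" "n > 0"
  shows "P = Q"
proof (rule poly_mapping_eqI)
  fix m
  have "int n * Poly_Mapping.lookup P m = int n * Poly_Mapping.lookup Q m"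
    using assms(1) by (metis lookup_of_nat_mult)
  then show "Poly_Mapping.lookup P m = Poly_Mapping.lookup Q m"
    using assms(2) by simp
qed

lemma intpoly_of_nat_dvd_cancel:
  fixes P :: "'v intpoly"
  assumes "of_nat (n * k) dvd of_nat n * P" "n > 0"
  shows "of_nat k dvd P"
proof -
  obtain Q where "of_nat n * P = of_nat n * (of_nat k * Q)"
    using assms(1) by (auto simp: dvd_def algebra_simps)
  then show ?thesis
    using intpoly_of_nat_cancel assms(2) by (metis dvd_triv_left)
qed

section \<open>The Frobenius lift\<close>

text \<open>
  One more factor \<open>p\<close> is gained at each step: in the factorization of \<open>a\<^sup>p - b\<^sup>p\<close> with the
  factor \<open>a - b\<close>, the cofactor is congruent to \<open>p b\<^bsup>p-1\<^esup>\<close> modulo \<open>p\<close>.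
\<close>

lemma of_nat_dvd_power_diff:
  fixes u v :: "'r::comm_ring_1"
  assumes "of_nat p dvd u - v"
  shows "of_nat (p ^ Suc n) dvd u ^ (p ^ n) - v ^ (p ^ n)"
proof (induction n)
  case 0
  then show ?case using assms by simp
next
  case (Suc n)
  define a b where "a = u ^ (p ^ n)" and "b = v ^ (p ^ n)"
  show ?case
  proof (cases "p = 0")
    case True
    then show ?thesis using assms by simp
  next
    case False
    have ab: "of_nat p dvd a - b"
      using Suc unfolding a_def b_def by (simp add: dvd_mult_left)
    have pow: "of_nat p dvd a ^ i - b ^ i" for i
      using ab by (metis dvd_mult2 dvd_mult_left dvd_trans dvd_triv_left power_diff_sumr2)
    have "of_nat p dvd (\<Sum>i<p. b ^ (p - Suc i) * a ^ i)"
    proof -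
      have "(\<Sum>i<p. b ^ (p - Suc i) * a ^ i) =
          (\<Sum>i<p. b ^ (p - Suc i) * (a ^ i - b ^ i)) + (\<Sum>i<p. b ^ (p - 1))"
        by (subst sum.distrib[symmetric], intro sum.cong refl)
          (auto simp: algebra_simps simp flip: power_add)
      then show ?thesis
        using pow by (auto intro!: dvd_add dvd_sum intro: dvd_mult)
    qed
    then have "of_nat (p ^ Suc n) * of_nat p dvd (a - b) * (\<Sum>i<p. b ^ (p - Suc i) * a ^ i)"
      using Suc unfolding a_def b_def by (intro mult_dvd_mono) auto
    also have "(a - b) * (\<Sum>i<p. b ^ (p - Suc i) * a ^ i) = a ^ p - b ^ p"
      by (simp add: power_diff_sumr2)
    finally show ?thesis
      by (simp add: a_def b_def mult.commute flip: power_mult)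
  qed
qed

lemma prime_dvd_freshman:
  fixes a b :: "'r::comm_ring_1"
  assumes "Factorial_Ring.prime p"
  shows "of_nat p dvd (a + b) ^ p - (a ^ p + b ^ p)"
proof -
  have "p > 0" using assms by (simp add: prime_gt_0_nat)
  have "(a + b) ^ p = (\<Sum>k\<le>p. of_nat (p choose k) * a ^ k * b ^ (p - k))"
    by (rule binomial_ring)
  also have "{..p} = insert 0 (insert p {0<..<p})"
    using \<open>p > 0\<close> by auto
  also have "(\<Sum>k\<in>\<dots>. of_nat (p choose k) * a ^ k * b ^ (p - k)) =
      b ^ p + a ^ p + (\<Sum>k\<in>{0<..<p}. of_nat (p choose k) * a ^ k * b ^ (p - k))"
    using \<open>p > 0\<close> by (simp add: algebra_simps)
  finally have "(a + b) ^ p - (a ^ p + b ^ p) =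
      (\<Sum>k\<in>{0<..<p}. of_nat (p choose k) * a ^ k * b ^ (p - k))"
    by simp
  also have "of_nat p dvd \<dots>"
  proof (intro dvd_sum dvd_mult2)
    fix k assume "k \<in> {0<..<p}"
    then have "p dvd (p choose k)"
      using assms by (intro dvd_choose_prime) auto
    then show "of_nat p dvd (of_nat (p choose k) :: 'r)"
      by (auto simp: dvd_def)
  qed
  finally show ?thesis .
qed

definition frobenius_lift :: "nat \<Rightarrow> 'v intpoly \<Rightarrow> 'v intpoly"
  where "frobenius_lift p = poly_eval (\<lambda>v. indet v ^ p)"

lemma frobenius_lift_cong_power:
  assumes p: "Factorial_Ring.prime p"
  shows "of_nat p dvd frobenius_lift p P - P ^ p"
proof (induction P rule: intpoly_induct)
  case (add a b)
  have "frobenius_lift p (a + b) - (a + b) ^ p = (frobenius_lift p a - a ^ p)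
      + (frobenius_lift p b - b ^ p) - ((a + b) ^ p - (a ^ p + b ^ p))"
    by (simp add: frobenius_lift_def poly_eval_add)
  with add prime_dvd_freshman[OF p, of a b] show ?case
    by (metis dvd_add dvd_diff)
next
  case (mult a b)
  have "frobenius_lift p (a * b) - (a * b) ^ p = (frobenius_lift p a - a ^ p) * frobenius_lift p b
      + a ^ p * (frobenius_lift p b - b ^ p)"
    by (simp add: frobenius_lift_def poly_eval_mult algebra_simps)
  with mult show ?case
    by (simp add: dvd_add)
next
  case (uminus a)
  have "of_nat p dvd (0::'a intpoly) ^ p - (a ^ p + (- a) ^ p)"
    using prime_dvd_freshman[OF p, of a "- a"] by simp
  then have "of_nat p dvd a ^ p + (- a) ^ p"
    using prime_gt_0_nat[OF p] by (simp add: power_0_left flip: dvd_minus_iff[of _ "a ^ p + (- a) ^ p"])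
  moreover have "frobenius_lift p (- a) - (- a) ^ p =
      - (frobenius_lift p a - a ^ p) - (a ^ p + (- a) ^ p)"
    by (simp add: frobenius_lift_def poly_eval.map_uminus)
  ultimately show ?case
    using uminus by (metis dvd_diff dvd_minus_iff)
qed (auto simp: frobenius_lift_def)

section \<open>Cosets and indices\<close>

context group
begin

lemma rcoset_of_member:
  assumes "subgroup H G" "C \<in> rcosets H" "x \<in> C"
  shows "x \<in> carrier G" "C = H #> x"
proof -
  obtain a where a: "a \<in> carrier G" "C = H #> a"
    using assms(2) by (auto simp: RCOSETS_def)
  with assms show "C = H #> x"
    using repr_independence by metis
  show "x \<in> carrier G"
    using a assms(1,3) subgroup.elemrcos_carrier is_group by metis
qed

lemma rcoset_subset_iff:
  assumes "subgroup H G" "subgroup K G" "H \<subseteq> K" "x \<in> carrier G"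
  shows "H #> x \<subseteq> K \<longleftrightarrow> x \<in> K"
proof
  assume "H #> x \<subseteq> K"
  then show "x \<in> K" using rcos_self assms by blast
next
  assume "x \<in> K"
  then show "H #> x \<subseteq> K"
    using assms subgroup.m_closed[OF assms(2)] by (auto simp: r_coset_def)
qed

text \<open>
  Multiplying a coset of \<open>H\<close> inside \<open>K\<close> by a chosen representative of a coset of \<open>K\<close> gives
  every coset of \<open>H\<close> exactly once. Infinite indices are covered by the convention that the
  cardinality is then \<open>0\<close>.
\<close>

lemma card_rcosets_tower:
  assumes H: "subgroup H G" and K: "subgroup K G" and HK: "H \<subseteq> K"
  shows "card (rcosets H) = card {C \<in> rcosets H. C \<subseteq> K} * card (rcosets K)"
proof -
  define r where "r D = (SOME x. x \<in> D)" for D :: "'a set"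
  have r: "r D \<in> D" "r D \<in> carrier G" "D = K #> r D" if D: "D \<in> rcosets K" for D
  proof -
    obtain a where "a \<in> carrier G" "D = K #> a"
      using D by (auto simp: RCOSETS_def)
    then have "a \<in> D" using rcos_self K by simp
    then show "r D \<in> D" unfolding r_def by (rule someI)
    with K D show "r D \<in> carrier G" "D = K #> r D"
      using rcoset_of_member by auto
  qed
  have Hc: "H \<subseteq> carrier G" and Kc: "K \<subseteq> carrier G"
    using H K subgroup.subset by auto
  have rep: "\<exists>a\<in>K. C = H #> a" if "C \<in> rcosets H" "C \<subseteq> K" for C
    using that HK rcoset_subset_iff[OF H K HK] by (auto simp: RCOSETS_def)
  have "bij_betw (\<lambda>(C, D). C #> r D) ({C \<in> rcosets H. C \<subseteq> K} \<times> rcosets K) (rcosets H)"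
    unfolding bij_betw_def
  proof
    show "inj_on (\<lambda>(C, D). C #> r D) ({C \<in> rcosets H. C \<subseteq> K} \<times> rcosets K)"
    proof (rule inj_onI, clarify)
      fix C D C' D'
      assume C: "C \<in> rcosets H" "C \<subseteq> K" and D: "D \<in> rcosets K"
        and C': "C' \<in> rcosets H" "C' \<subseteq> K" and D': "D' \<in> rcosets K"
        and eq: "C #> r D = C' #> r D'"
      obtain a where a: "a \<in> K" "C = H #> a" using rep[OF C] by auto
      obtain a' where a': "a' \<in> K" "C' = H #> a'" using rep[OF C'] by auto
      note [simp] = r(2)[OF D] r(2)[OF D']
      have [simp]: "a \<in> carrier G" "a' \<in> carrier G" using a a' Kc by auto
      have eq': "H #> (a \<otimes> r D) = H #> (a' \<otimes> r D')"
        using eq Hc by (simp add: a a' coset_mult_assoc)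
      have "a \<otimes> r D \<in> H #> (a' \<otimes> r D')"
        using eq' H rcos_self[of "a \<otimes> r D" H] by simp
      then have "a \<otimes> r D \<in> K #> (a' \<otimes> r D')"
        using HK by (auto simp: r_coset_def)
      also have "K #> (a' \<otimes> r D') = K #> a' #> r D'"
        using Kc by (simp add: coset_mult_assoc)
      also have "\<dots> = D'"
        using r(3)[OF D'] a' K by (simp add: coset_join2)
      finally have 1: "a \<otimes> r D \<in> D'" .
      have 2: "a \<otimes> r D \<in> D"
        using r(3)[OF D] a by (auto simp: r_coset_def)
      have DD: "D = D'"
        using rcoset_of_member(2)[OF K D 2] rcoset_of_member(2)[OF K D' 1] by simp
      have "C = H #> (a \<otimes> r D) #> inv r D"
        using Hc by (simp add: a coset_mult_assoc m_assoc)
      also have "\<dots> = H #> (a' \<otimes> r D) #> inv r D"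
        using eq' DD by simp
      also have "\<dots> = C'"
        using Hc by (simp add: a' coset_mult_assoc m_assoc)
      finally show "C = C' \<and> D = D'" using DD by simp
    qed
    show "(\<lambda>(C, D). C #> r D) ` ({C \<in> rcosets H. C \<subseteq> K} \<times> rcosets K) = rcosets H"
    proof (intro equalityI subsetI)
      fix E assume "E \<in> (\<lambda>(C, D). C #> r D) ` ({C \<in> rcosets H. C \<subseteq> K} \<times> rcosets K)"
      then obtain C D where CD: "C \<in> rcosets H" "D \<in> rcosets K" "E = C #> r D" by auto
      obtain a where "a \<in> carrier G" "C = H #> a" using CD by (auto simp: RCOSETS_def)
      then show "E \<in> rcosets H"
        using CD r(2) Hc by (simp add: coset_mult_assoc rcosetsI)
    next
      fix E assume "E \<in> rcosets H"
      then obtain x where x: "x \<in> carrier G" "E = H #> x" by (auto simp: RCOSETS_def)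
      define D where "D = K #> x"
      have D: "D \<in> rcosets K" unfolding D_def using x Kc by (simp add: rcosetsI)
      have xD: "x \<in> K #> r D" using r(3)[OF D] rcos_self x K unfolding D_def by auto
      then obtain k where k: "k \<in> K" "x = k \<otimes> r D" by (auto simp: r_coset_def)
      then have "E = (H #> k) #> r D"
        using x Hc Kc r(2)[OF D] by (auto simp: coset_mult_assoc)
      moreover have "H #> k \<in> rcosets H" "H #> k \<subseteq> K"
        using k Kc Hc rcosetsI rcoset_subset_iff[OF H K HK, of k] by (blast, blast)
      ultimately show "E \<in> (\<lambda>(C, D). C #> r D) ` ({C \<in> rcosets H. C \<subseteq> K} \<times> rcosets K)"
        using D by force
    qed
  qed
  from bij_betw_same_card[OF this] show ?thesis
    by (simp add: card_cartesian_product)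
qed

text \<open>
  A coset of \<open>H \<inter> K\<close> is determined by the coset of \<open>H\<close> and the coset of \<open>K\<close> that contain it.
\<close>

lemma card_rcosets_Int_le:
  assumes H: "subgroup H G" and K: "subgroup K G"
    and fin: "finite (rcosets H)" "finite (rcosets K)"
  shows "card (rcosets (H \<inter> K)) \<le> card (rcosets H) * card (rcosets K)"
proof -
  have HK: "subgroup (H \<inter> K) G" using H K subgroups_Inter_pair by blast
  let ?f = "\<lambda>C. (H <#> C, K <#> C)"
  have f: "H <#> ((H \<inter> K) #> x) = H #> x" "K <#> ((H \<inter> K) #> x) = K #> x"
    if "x \<in> carrier G" for x
  proof -
    have *: "L <#> (M #> x) = L #> x" if "subgroup L G" "subgroup M G" "M \<subseteq> L" for L M
    proof -
      have "L <#> M = L"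
      proof
        show "L <#> M \<subseteq> L"
          using that subgroup.m_closed[OF that(1)] by (auto simp: set_mult_def)
        show "L \<subseteq> L <#> M"
        proof
          fix l assume "l \<in> L"
          then have "l = l \<otimes> \<one>" using subgroup.mem_carrier[OF that(1)] by simp
          then show "l \<in> L <#> M"
            using \<open>l \<in> L\<close> subgroup.one_closed[OF that(2)] unfolding set_mult_def by blast
        qed
      qed
      then show ?thesis
        using that subgroup.subset \<open>x \<in> carrier G\<close> by (metis setmult_rcos_assoc)
    qed
    show "H <#> ((H \<inter> K) #> x) = H #> x" "K <#> ((H \<inter> K) #> x) = K #> x"
      using * HK H K by auto
  qed
  have "inj_on ?f (rcosets (H \<inter> K))"
  proof (rule inj_onI)
    fix C D assume CD: "C \<in> rcosets (H \<inter> K)" "D \<in> rcosets (H \<inter> K)" and eq: "?f C = ?f D"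
    obtain x y where x: "x \<in> carrier G" "C = (H \<inter> K) #> x" and y: "y \<in> carrier G" "D = (H \<inter> K) #> y"
      using CD by (auto simp: RCOSETS_def)
    have "H #> x = H #> y" "K #> x = K #> y"
      using eq x y f by auto
    then have "x \<in> H #> y" "x \<in> K #> y"
      using rcos_self x H K by metis+
    then obtain h k where "h \<in> H" "k \<in> K" "x = h \<otimes> y" "x = k \<otimes> y"
      by (auto simp: r_coset_def)
    moreover from this have "h = k"
      using y H K subgroup.mem_carrier r_cancel by metis
    ultimately have "x \<in> (H \<inter> K) #> y"
      by (auto simp: r_coset_def)
    then show "C = D"
      using repr_independence x y HK by metis
  qed
  moreover have "?f ` (rcosets (H \<inter> K)) \<subseteq> (rcosets H) \<times> (rcosets K)"
    using f H K subgroup.subset by (auto simp: RCOSETS_def)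
  ultimately have "card (rcosets (H \<inter> K)) \<le> card ((rcosets H) \<times> (rcosets K))"
    using fin by (intro card_inj_on_le) auto
  then show ?thesis
    by (simp add: card_cartesian_product)
qed

end

text \<open>
  In an abelian group the solutions of \<open>d\<^sup>m = 1\<close> in a subgroup form a group; when an element of
  larger order \<open>p\<^sup>i\<close> is present, that group contains an element of order exactly \<open>p\<^sup>j\<close>.
\<close>

lemma (in comm_group) prime_power_dvd_card_torsion:
  assumes L: "subgroup L G" and c: "c \<in> L" "ord c = p ^ i" and "j \<le> i" "p > 0"
  shows "p ^ j dvd card {d \<in> L. d [^] (p ^ j) = \<one>}"
proof -
  let ?T = "{d \<in> L. d [^] (p ^ j) = \<one>}"
  have Lc: "L \<subseteq> carrier G" using L subgroup.subset by auto
  have T: "subgroup ?T G"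
  proof
    show "?T \<subseteq> carrier G" using Lc by auto
    show "\<one> \<in> ?T" using L by (auto simp: subgroup.one_closed)
    fix x y assume x: "x \<in> ?T"
    with Lc have xc: "x \<in> carrier G" by auto
    show "inv x \<in> ?T"
      using x xc L nat_pow_inv[OF xc, of "p ^ j"] by (auto simp: subgroup.m_inv_closed)
    assume y: "y \<in> ?T"
    with Lc have yc: "y \<in> carrier G" by auto
    show "x \<otimes> y \<in> ?T"
      using x y xc yc L by (auto simp: subgroup.m_closed nat_pow_distrib)
  qed
  define c' where "c' = c [^] (p ^ (i - j))"
  have cc: "c \<in> carrier G" using c Lc by auto
  have dv: "p ^ (i - j) dvd ord c" using c by (simp add: le_imp_power_dvd)
  have ord: "ord c' = p ^ j"
    unfolding c'_def using cc dv c \<open>j \<le> i\<close> \<open>p > 0\<close>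
    by (simp add: ord_pow power_diff flip: power_diff)
  have powL: "c [^] (n::nat) \<in> L" for n
    using c L by (induction n) (auto simp: subgroup.one_closed subgroup.m_closed)
  have c'T: "c' \<in> ?T"
    using powL ord cc pow_ord_eq_1[of c'] unfolding c'_def by simp
  interpret T: group "G\<lparr>carrier := ?T\<rparr>"
    using subgroup.subgroup_is_group[OF T is_group] .
  have "subgroup (generate G {c'}) (G\<lparr>carrier := ?T\<rparr>)"
    using c'T T Lc by (intro subgroup_incl generate_is_subgroup generate_subgroup_incl) auto
  from T.lagrange[OF this] have "Coset.order (G\<lparr>carrier := ?T\<rparr>) =
      card (rcosets\<^bsub>G\<lparr>carrier := ?T\<rparr>\<^esub> generate G {c'}) * card (generate G {c'})"
    by (rule sym)
  then have "card (generate G {c'}) dvd Coset.order (G\<lparr>carrier := ?T\<rparr>)"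
    by (rule dvdI[OF trans[OF _ mult.commute]])
  moreover have "Coset.order (G\<lparr>carrier := ?T\<rparr>) = card ?T"
    by (simp add: Coset.order_def)
  moreover have "card (generate G {c'}) = p ^ j"
    using ord generate_pow_card[of c'] cc unfolding c'_def by simp
  ultimately show ?thesis by simp
qed

section \<open>Abelian pro-p groups\<close>

locale abelian_pro_p = comm_group G for G (structure) +
  fixes \<Omega> :: "'a topology" and p :: nat
  assumes prime_p: "Factorial_Ring.prime p"
    and carrier_open: "carrier G \<in> open_subgroups G \<Omega>"
    and Int_open: "\<lbrakk>H \<in> open_subgroups G \<Omega>; K \<in> open_subgroups G \<Omega>\<rbrakk>
      \<Longrightarrow> H \<inter> K \<in> open_subgroups G \<Omega>"
    and open_upward: "\<lbrakk>H \<in> open_subgroups G \<Omega>; subgroup K G; H \<subseteq> K\<rbrakk>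
      \<Longrightarrow> K \<in> open_subgroups G \<Omega>"
    and index_prime_power: "H \<in> open_subgroups G \<Omega> \<Longrightarrow> \<exists>n. card (rcosets H) = p ^ n"
begin

abbreviation opens :: "'a set set"
  where "opens \<equiv> open_subgroups G \<Omega>"

definition index_exp :: "'a set \<Rightarrow> nat"
  where "index_exp H = (THE n. card (rcosets H) = p ^ n)"

definition overgroups :: "'a set \<Rightarrow> 'a set set"
  where "overgroups H = {K \<in> opens. H \<subseteq> K}"

lemma p_gt_1: "p > 1" and p_gt_0: "p > 0"
  using prime_p prime_gt_1_nat prime_gt_0_nat by auto

lemma opens_subgroup: "H \<in> opens \<Longrightarrow> subgroup H G"
  by (simp add: open_subgroups_def)

lemma card_rcosets:
  assumes "H \<in> opens"
  shows "card (rcosets H) = p ^ index_exp H"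
proof -
  obtain n where n: "card (rcosets H) = p ^ n" using index_prime_power[OF assms] by auto
  have "index_exp H = n"
    unfolding index_exp_def n by (rule the_equality) (simp_all add: power_inject_exp[OF p_gt_1])
  with n show ?thesis by simp
qed

lemma finite_rcosets: "H \<in> opens \<Longrightarrow> finite (rcosets H)"
  using card_rcosets[of H] p_gt_0 by (intro card_ge_0_finite) simp

lemma rcoset_in_rcosets: "H \<in> opens \<Longrightarrow> x \<in> carrier G \<Longrightarrow> H #> x \<in> rcosets H"
  using rcosetsI[OF subgroup.subset[OF opens_subgroup]] .

lemma rcosetE:
  assumes "H \<in> opens" "C \<in> rcosets H"
  obtains x where "x \<in> carrier G" "x \<in> C" "C = H #> x"
proof -
  obtain x where x: "x \<in> carrier G" "C = H #> x" using assms by (auto simp: RCOSETS_def)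
  then have "x \<in> C" using rcos_self opens_subgroup assms(1) by simp
  with x that show thesis by simp
qed

lemma rcoset_subset_open_iff:
  assumes "H \<in> opens" "subgroup K G" "H \<subseteq> K" "x \<in> carrier G"
  shows "H #> x \<subseteq> K \<longleftrightarrow> x \<in> K"
  using rcoset_subset_iff[OF opens_subgroup] assms by simp

lemma card_rcosets_tower_exp:
  assumes "H \<in> opens" "K \<in> opens" "H \<subseteq> K"
  shows "index_exp K \<le> index_exp H"
    and "card {C \<in> rcosets H. C \<subseteq> K} = p ^ (index_exp H - index_exp K)"
proof -
  have eq: "p ^ index_exp H = card {C \<in> rcosets H. C \<subseteq> K} * p ^ index_exp K"
    using card_rcosets_tower[of H K] assms opens_subgroup card_rcosets by simp
  then have "p ^ index_exp K dvd p ^ index_exp H" by simp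
  then show le: "index_exp K \<le> index_exp H"
    using p_gt_1 by (simp add: dvd_power_iff_le)
  have "p ^ index_exp H = p ^ (index_exp H - index_exp K) * p ^ index_exp K"
    using le by (simp flip: power_add)
  with eq show "card {C \<in> rcosets H. C \<subseteq> K} = p ^ (index_exp H - index_exp K)"
    using p_gt_0 by simp
qed

lemma index_exp_strict:
  assumes "H \<in> opens" "K \<in> opens" "H \<subset> K"
  shows "index_exp K < index_exp H"
proof -
  obtain x where x: "x \<in> K" "x \<notin> H" using assms(3) by auto
  have H: "subgroup H G" and K: "subgroup K G" using assms opens_subgroup by auto
  have xc: "x \<in> carrier G" using subgroup.mem_carrier[OF K x(1)] .
  have "H #> x \<noteq> H" using x rcos_self[OF xc H] by auto
  moreover have "H \<in> rcosets H"
    using subgroup.subgroup_in_rcosets[OF H is_group] .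
  moreover have "H #> x \<in> rcosets H" "H #> x \<subseteq> K"
    using x xc K assms rcoset_in_rcosets rcoset_subset_open_iff[of H K x] by auto
  ultimately have "{H, H #> x} \<subseteq> {C \<in> rcosets H. C \<subseteq> K}" "card {H, H #> x} = 2"
    using assms by auto
  then have "2 \<le> card {C \<in> rcosets H. C \<subseteq> K}"
    using finite_rcosets[OF assms(1)] card_mono[of "{C \<in> rcosets H. C \<subseteq> K}" "{H, H #> x}"]
    by simp
  then have "index_exp H - index_exp K \<noteq> 0"
    using card_rcosets_tower_exp[of H K] assms by (cases "index_exp H - index_exp K = 0") auto
  then show ?thesis by simp
qed

lemma index_exp_inj:
  assumes "H \<in> opens" "K \<in> opens" "H \<subseteq> K" "index_exp H \<le> index_exp K"
  shows "H = K"
proof (rule ccontr)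
  assume "H \<noteq> K"
  with assms(3) have "H \<subset> K" by (rule psubsetI)
  from index_exp_strict[OF assms(1,2) this] assms(4) show False by simp
qed

lemma index_exp_carrier [simp]: "index_exp (carrier G) = 0"
proof -
  have "rcosets (carrier G) = {carrier G}"
    using coset_join2[OF _ subgroup_self] one_closed by (auto simp: RCOSETS_def)
  then have "p ^ index_exp (carrier G) = p ^ 0"
    using card_rcosets[OF carrier_open] by simp
  then show ?thesis by (simp only: power_inject_exp[OF p_gt_1])
qed

lemma index_exp_eq_0_iff:
  assumes "H \<in> opens"
  shows "index_exp H = 0 \<longleftrightarrow> H = carrier G"
proof
  show "H = carrier G" if "index_exp H = 0"
    by (rule index_exp_inj[OF assms carrier_open subgroup.subset[OF opens_subgroup[OF assms]]])
      (simp add: that)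
qed (simp only: index_exp_carrier)

lemma index_exp_Int_le:
  assumes "H \<in> opens" "K \<in> opens"
  shows "index_exp (H \<inter> K) \<le> index_exp H + index_exp K"
proof -
  have "p ^ index_exp (H \<inter> K) \<le> p ^ (index_exp H + index_exp K)"
    using card_rcosets_Int_le[of H K] assms opens_subgroup finite_rcosets card_rcosets Int_open
    by (simp add: power_add)
  then show ?thesis using p_gt_1 by simp
qed

lemma overgroupsD: "K \<in> overgroups H \<Longrightarrow> K \<in> opens" "K \<in> overgroups H \<Longrightarrow> H \<subseteq> K"
  by (auto simp: overgroups_def)

lemma overgroups_refl: "H \<in> opens \<Longrightarrow> H \<in> overgroups H"
  by (simp add: overgroups_def)

lemma overgroups_trans: "K \<in> overgroups H \<Longrightarrow> overgroups K = {L \<in> overgroups H. K \<subseteq> L}"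
  by (auto simp: overgroups_def)

lemma finite_overgroups:
  assumes "H \<in> opens"
  shows "finite (overgroups H)"
proof -
  have H: "subgroup H G" using assms opens_subgroup by auto
  let ?f = "\<lambda>K. {C \<in> rcosets H. C \<subseteq> K}"
  have "K = \<Union> (?f K)" if K: "K \<in> overgroups H" for K
  proof
    have Ks: "subgroup K G" using opens_subgroup[OF overgroupsD(1)[OF K]] .
    show "K \<subseteq> \<Union> (?f K)"
    proof
      fix x assume x: "x \<in> K"
      then have xc: "x \<in> carrier G" using subgroup.mem_carrier[OF Ks] by simp
      have "H #> x \<in> ?f K"
        using x xc assms Ks overgroupsD[OF K] rcoset_in_rcosets rcoset_subset_open_iff[of H K x] by auto
      then show "x \<in> \<Union> (?f K)" using rcos_self[OF xc H] by auto
    qed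
  qed auto
  then have "inj_on ?f (overgroups H)"
    by (intro inj_on_inverseI[of _ Union]) simp
  moreover have "?f ` overgroups H \<subseteq> Pow (rcosets H)" by auto
  ultimately show ?thesis
    using finite_rcosets[OF assms] inj_on_finite[of ?f "overgroups H" "Pow (rcosets H)"] by simp
qed

lemma coset_le_generate: "H \<in> opens \<Longrightarrow> C \<in> rcosets H \<Longrightarrow> C \<subseteq> generate G C"
  by (rule subsetI) (rule generate.incl)

lemma rcoset_carrier: "H \<in> opens \<Longrightarrow> C \<in> rcosets H \<Longrightarrow> C \<subseteq> carrier G"
  using Union_upper[of C "rcosets H"] rcosets_part_G[OF opens_subgroup, of H] by simp

text \<open>
  The subgroup generated by a coset \<open>H x\<close> is the smallest open subgroup that contains both \<open>H\<close>
  and \<open>x\<close>; it corresponds to the cyclic subgroup of \<open>G/H\<close> generated by the coset.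
\<close>

lemma generate_coset_overgroup:
  assumes H: "H \<in> opens" and C: "C \<in> rcosets H"
  shows "generate G C \<in> overgroups H"
proof -
  have Hs: "subgroup H G" using H opens_subgroup by auto
  have g: "subgroup (generate G C) G"
    using rcoset_carrier[OF H C] by (rule generate_is_subgroup)
  obtain x where x: "x \<in> carrier G" "C = H #> x" using C by (auto simp: RCOSETS_def)
  have "H \<subseteq> generate G C"
  proof
    fix h assume h: "h \<in> H"
    then have hc: "h \<in> carrier G" using subgroup.mem_carrier[OF Hs] by simp
    have "h \<otimes> x \<in> C" "x \<in> C"
      using h x Hs rcos_self by (auto simp: r_coset_def)
    then have "(h \<otimes> x) \<otimes> inv x \<in> generate G C"
      using g by (meson generate.incl subgroup.m_closed subgroup.m_inv_closed)
    then show "h \<in> generate G C" using hc x by (simp add: m_assoc)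
  qed
  then show ?thesis
    using open_upward[OF H g] by (simp add: overgroups_def)
qed

lemma generate_coset_subset_iff:
  assumes "H \<in> opens" "C \<in> rcosets H" "subgroup K G"
  shows "generate G C \<subseteq> K \<longleftrightarrow> C \<subseteq> K"
  using generate_subgroup_incl[OF _ assms(3), of C] coset_le_generate[OF assms(1,2)]
  by (meson subset_trans)

lemma generate_coset_eq_iff:
  assumes H: "H \<in> opens" and C: "C \<in> rcosets H"
  shows "generate G C = H \<longleftrightarrow> C = H"
proof
  have Hs: "subgroup H G" using H opens_subgroup by auto
  obtain x where x: "x \<in> carrier G" "x \<in> C" "C = H #> x" using rcosetE[OF H C] .
  show "C = H" if "generate G C = H"
    using coset_le_generate[OF H C] coset_join2[OF x(1) Hs] x that by auto
  show "generate G C = H" if "C = H"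
    using generate_subgroup_incl[OF _ Hs, of C] coset_le_generate[OF H C] that by auto
qed

definition coset_exp :: "'a set \<Rightarrow> 'a set \<Rightarrow> nat"
  where "coset_exp H C = index_exp H - index_exp (generate G C)"

lemma index_exp_generate:
  assumes "H \<in> opens" "C \<in> rcosets H"
  shows "index_exp (generate G C) + coset_exp H C = index_exp H"
proof -
  have "generate G C \<in> opens" "H \<subseteq> generate G C"
    using generate_coset_overgroup[OF assms] by (auto simp: overgroups_def)
  from card_rcosets_tower_exp(1)[OF assms(1) this] show ?thesis
    by (simp add: coset_exp_def)
qed

lemma coset_exp_le:
  assumes "H \<in> opens" "K \<in> overgroups H" "C \<in> rcosets H" "C \<subseteq> K"
  shows "coset_exp H C \<le> index_exp H - index_exp K"
proof -
  have "generate G C \<subseteq> K"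
    using generate_coset_subset_iff[OF assms(1,3) opens_subgroup[OF overgroupsD(1)[OF assms(2)]]] assms
    by simp
  then have "index_exp K \<le> index_exp (generate G C)"
    using card_rcosets_tower_exp(1) overgroupsD(1)[OF generate_coset_overgroup[OF assms(1,3)]]
      overgroupsD(1)[OF assms(2)] by simp
  then show ?thesis by (simp add: coset_exp_def)
qed

lemma rcosets_subgroup:
  assumes H: "H \<in> opens" and K: "subgroup K G" and HK: "H \<subseteq> K"
  shows "subgroup {C \<in> rcosets H. C \<subseteq> K} (G Mod H)"
proof -
  have Hs: "subgroup H G" using H opens_subgroup by auto
  interpret N: normal H G using subgroup_imp_normal[OF Hs] .
  have car: "carrier (G Mod H) = rcosets H" by (simp add: FactGroup_def)
  have mem: "H #> x \<in> {C \<in> rcosets H. C \<subseteq> K} \<longleftrightarrow> x \<in> K" if "x \<in> carrier G" for x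
    using that rcoset_subset_open_iff[OF H K HK] rcoset_in_rcosets[OF H] by auto
  have rep: "\<exists>x\<in>K. x \<in> carrier G \<and> C = H #> x" if C: "C \<in> {C \<in> rcosets H. C \<subseteq> K}" for C
  proof -
    obtain x where "x \<in> carrier G" "x \<in> C" "C = H #> x" using rcosetE[OF H, of C] C by auto
    then show ?thesis using C by auto
  qed
  show ?thesis
  proof
    show "{C \<in> rcosets H. C \<subseteq> K} \<subseteq> carrier (G Mod H)"
      by (auto simp: FactGroup_def)
    fix C assume C: "C \<in> {C \<in> rcosets H. C \<subseteq> K}"
    then obtain x where x: "x \<in> K" "x \<in> carrier G" "C = H #> x" using rep by blast
    have "inv\<^bsub>G Mod H\<^esub> C = H #> inv x"
      using N.inv_FactGroup[of C] N.rcos_inv[OF x(2)] x rcoset_in_rcosets[OF H x(2)] car by simp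
    then show "inv\<^bsub>G Mod H\<^esub> C \<in> {C \<in> rcosets H. C \<subseteq> K}"
      using mem[of "inv x"] x subgroup.m_inv_closed[OF K x(1)] by simp
    fix D assume D: "D \<in> {C \<in> rcosets H. C \<subseteq> K}"
    then obtain y where y: "y \<in> K" "y \<in> carrier G" "D = H #> y" using rep by blast
    have "C \<otimes>\<^bsub>G Mod H\<^esub> D = H #> (x \<otimes> y)"
      using x y by (simp add: N.rcos_sum)
    then show "C \<otimes>\<^bsub>G Mod H\<^esub> D \<in> {C \<in> rcosets H. C \<subseteq> K}"
      using mem[of "x \<otimes> y"] x y subgroup.m_closed[OF K x(1) y(1)] by simp
  next
    show "\<one>\<^bsub>G Mod H\<^esub> \<in> {C \<in> rcosets H. C \<subseteq> K}"
      using HK subgroup.subgroup_in_rcosets[OF Hs is_group] by simp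
  qed
qed

lemma ord_coset:
  assumes H: "H \<in> opens" and C: "C \<in> rcosets H"
  shows "group.ord (G Mod H) C = p ^ coset_exp H C"
proof -
  have Hs: "subgroup H G" using H opens_subgroup by auto
  interpret N: normal H G using subgroup_imp_normal[OF Hs] .
  interpret Q: group "G Mod H" by (rule N.factorgroup_is_group)
  let ?L = "{D \<in> rcosets H. D \<subseteq> generate G C}"
  let ?Z = "generate (G Mod H) {C}"
  have car: "carrier (G Mod H) = rcosets H" by (simp add: FactGroup_def)
  have gs: "subgroup (generate G C) G"
    using rcoset_carrier[OF H C] by (rule generate_is_subgroup)
  have Zs: "subgroup ?Z (G Mod H)"
    using C car by (intro Q.generate_is_subgroup) auto
  have CZ: "C \<in> ?Z" by (rule generate.incl) simp
  have "?Z = ?L"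
  proof
    show "?Z \<subseteq> ?L"
      using generate_coset_overgroup[OF H C] C coset_le_generate[OF H C]
      by (intro Q.generate_subgroup_incl rcosets_subgroup[OF H gs]) (auto simp: overgroups_def)
    have "subgroup (\<Union>?Z) G"
      using N.factgroup_subgroup_union_subgroup[OF Zs] .
    then have gZ: "generate G C \<subseteq> \<Union>?Z"
      using CZ by (intro generate_subgroup_incl) auto
    show "?L \<subseteq> ?Z"
    proof
      fix D assume D: "D \<in> ?L"
      then obtain x where x: "x \<in> D" using rcosetE[OF H, of D] by auto
      with D gZ obtain E where E: "E \<in> ?Z" "x \<in> E" by auto
      then have "E \<in> rcosets H"
        using subgroup.subset[OF Zs] car by auto
      then have "D = E"
        using rcoset_of_member(2)[OF Hs _ x] rcoset_of_member(2)[OF Hs _ E(2)] D by auto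
      then show "D \<in> ?Z" using E by simp
    qed
  qed
  then show ?thesis
    using Q.generate_pow_card[of C] C car H generate_coset_overgroup[OF H C]
    by (simp add: overgroups_def card_rcosets_tower_exp(2) coset_exp_def)
qed

text \<open>
  As \<open>coset_exp\<close> is the exponent of the order in \<open>K/H\<close>, the cosets that are counted here are
  the \<open>p\<^sup>j\<close>-torsion of this group.
\<close>

lemma card_coset_exp_le_dvd:
  assumes H: "H \<in> opens" and K: "K \<in> overgroups H"
    and C: "C \<in> rcosets H" "C \<subseteq> K" "j \<le> coset_exp H C"
  shows "p ^ j dvd card {D \<in> rcosets H. D \<subseteq> K \<and> coset_exp H D \<le> j}"
proof -
  have Hs: "subgroup H G" using H opens_subgroup by auto
  interpret N: normal H G using subgroup_imp_normal[OF Hs] .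
  interpret Q: comm_group "G Mod H" by (rule abelian_FactGroup[OF Hs])
  have car: "carrier (G Mod H) = rcosets H" by (simp add: FactGroup_def)
  let ?L = "{D \<in> rcosets H. D \<subseteq> K}"
  have "p ^ j dvd card {D \<in> ?L. D [^]\<^bsub>G Mod H\<^esub> (p ^ j) = \<one>\<^bsub>G Mod H\<^esub>}"
    using C ord_coset[OF H C(1)] K p_gt_0 opens_subgroup
    by (intro Q.prime_power_dvd_card_torsion[of _ C _ "coset_exp H C"] rcosets_subgroup H)
      (auto simp: overgroups_def)
  also have "D [^]\<^bsub>G Mod H\<^esub> (p ^ j) = \<one>\<^bsub>G Mod H\<^esub> \<longleftrightarrow> coset_exp H D \<le> j"
    if "D \<in> rcosets H" for D
    using Q.pow_eq_id[of D "p ^ j"] that ord_coset[OF H that] dvd_power_iff_le[of p] p_gt_1 car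
    by simp
  then have "{D \<in> ?L. D [^]\<^bsub>G Mod H\<^esub> (p ^ j) = \<one>\<^bsub>G Mod H\<^esub>} =
      {D \<in> rcosets H. D \<subseteq> K \<and> coset_exp H D \<le> j}"
    by (intro Collect_cong) auto
  finally show ?thesis .
qed

end

section \<open>Dwork's congruences\<close>

lemma frobenius_lift_iterate_hom: "unital_ring_map (frobenius_lift p ^^ r :: 'v intpoly \<Rightarrow> _)"
proof (induction r)
  case 0
  then show ?case by unfold_locales auto
next
  case (Suc r)
  interpret f: unital_ring_map "frobenius_lift p ^^ r :: 'v intpoly \<Rightarrow> _" by (rule Suc)
  show ?case
    by unfold_locales
      (simp_all add: f.map_one f.map_add f.map_mult, simp_all add: frobenius_lift_def
        poly_eval_add poly_eval_mult)
qed

interpretation frob: unital_ring_map "frobenius_lift p ^^ r" for p r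
  by (rule frobenius_lift_iterate_hom)

lemma frobenius_lift_power_step:
  assumes p: "Factorial_Ring.prime p" and "j < n"
  shows "of_nat (p ^ (n - j)) dvd
    (frobenius_lift p ^^ Suc j) P ^ (p ^ (n - Suc j)) - (frobenius_lift p ^^ j) P ^ (p ^ (n - j))"
proof -
  let ?Q = "(frobenius_lift p ^^ j) P"
  have "of_nat (p ^ Suc (n - Suc j)) dvd
      frobenius_lift p ?Q ^ (p ^ (n - Suc j)) - (?Q ^ p) ^ (p ^ (n - Suc j))"
    by (intro of_nat_dvd_power_diff frobenius_lift_cong_power p)
  moreover have "Suc (n - Suc j) = n - j" using assms(2) by simp
  moreover from this have "p ^ (n - j) = p * p ^ (n - Suc j)" by (metis power_Suc)
  ultimately show ?thesis by (simp flip: power_mult)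
qed

text \<open>
  A sum over a finite set weighted by the values of a function \<open>r \<le> n\<close> is regrouped by the
  level sets \<open>{r \<le> j}\<close> (summation by parts).
\<close>

lemma dvd_sum_by_levels:
  fixes y :: "nat \<Rightarrow> 'r::comm_ring_1"
  assumes fin: "finite L" and card: "card L = p ^ n" and r: "\<And>C. C \<in> L \<Longrightarrow> r C \<le> n"
    and level: "\<And>j C. C \<in> L \<Longrightarrow> j \<le> r C \<Longrightarrow> p ^ j dvd card {D \<in> L. r D \<le> j}"
    and step: "\<And>j. j < n \<Longrightarrow> of_nat (p ^ (n - j)) dvd y (Suc j) - y j"
  shows "of_nat (p ^ n) dvd (\<Sum>C\<in>L. y (r C))"
proof -
  have telescope: "y k = y 0 + (\<Sum>j<n. if j < k then y (Suc j) - y j else 0)" if "k \<le> n" for k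
  proof -
    have "(\<Sum>j<n. if j < k then y (Suc j) - y j else 0) = (\<Sum>j<k. y (Suc j) - y j)"
      using that by (intro sum.mono_neutral_cong_right) auto
    also have "\<dots> = y k - y 0" by (rule sum_lessThan_telescope)
    finally show ?thesis by simp
  qed
  have "(\<Sum>C\<in>L. y (r C)) =
      (\<Sum>C\<in>L. y 0 + (\<Sum>j<n. if j < r C then y (Suc j) - y j else 0))"
    by (intro sum.cong refl telescope r)
  also have "\<dots> = of_nat (card L) * y 0 +
      (\<Sum>j<n. \<Sum>C\<in>L. if j < r C then y (Suc j) - y j else 0)"
    by (simp add: sum.distrib) (rule sum.swap)
  also have "(\<Sum>j<n. \<Sum>C\<in>L. if j < r C then y (Suc j) - y j else 0) =
      (\<Sum>j<n. of_nat (card {C \<in> L. j < r C}) * (y (Suc j) - y j))"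
    using fin by (intro sum.cong refl) (simp add: sum.If_cases Int_def conj_commute)
  also have "of_nat (p ^ n) dvd of_nat (card L) * y 0 + \<dots>"
  proof (intro dvd_add dvd_sum)
    fix j assume "j \<in> {..<n}"
    then have j: "j < n" by simp
    have "p ^ j dvd card {C \<in> L. j < r C}"
    proof (cases "\<exists>C\<in>L. j < r C")
      case True
      then have "p ^ j dvd card {D \<in> L. r D \<le> j}" using level by (meson less_imp_le)
      moreover have "p ^ j dvd card L" using card j by (simp add: le_imp_power_dvd)
      moreover have "card L = card {D \<in> L. r D \<le> j} + card {C \<in> L. j < r C}"
      proof -
        have "card L = card ({D \<in> L. r D \<le> j} \<union> {C \<in> L. j < r C})"
          by (rule arg_cong[where f = card]) auto
        moreover have "{D \<in> L. r D \<le> j} \<inter> {C \<in> L. j < r C} = {}" by auto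
        ultimately show ?thesis
          using card_Un_disjoint[of "{D \<in> L. r D \<le> j}" "{C \<in> L. j < r C}"] fin by simp
      qed
      ultimately show ?thesis
        using dvd_add_right_iff[of "p ^ j" "card {D \<in> L. r D \<le> j}" "card {C \<in> L. j < r C}"]
        by simp
    next
      case False
      then have "{C \<in> L. j < r C} = {}" by blast
      then show ?thesis by (simp only: card.empty dvd_0_right)
    qed
    then have "(of_nat (p ^ j) :: 'r) dvd of_nat (card {C \<in> L. j < r C})"
      by (auto simp: dvd_def)
    then have "of_nat (p ^ j) * of_nat (p ^ (n - j)) dvd
        of_nat (card {C \<in> L. j < r C}) * (y (Suc j) - y j)"
      using step[OF j] by (rule mult_dvd_mono)
    moreover have "(of_nat (p ^ j) * of_nat (p ^ (n - j)) :: 'r) = of_nat (p ^ n)"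
      using j by (simp flip: of_nat_mult power_add)
    ultimately show "of_nat (p ^ n) dvd of_nat (card {C \<in> L. j < r C}) * (y (Suc j) - y j)"
      by simp
  qed (simp add: card)
  finally show ?thesis .
qed

context abelian_pro_p
begin

text \<open>
  Ghost vectors are indexed by open subgroups rather than by points of the frame. The definition
  is the Witt polynomial with all indices expressed as powers of \<open>p\<close>.
\<close>

definition ghost :: "('a set \<Rightarrow> 'r) \<Rightarrow> 'a set \<Rightarrow> 'r::comm_ring_1"
  where "ghost x H =
    (\<Sum>K\<in>overgroups H. of_nat (p ^ index_exp K) * x K ^ (p ^ (index_exp H - index_exp K)))"

text \<open>
  For the ghost vector of a single coordinate \<open>P\<close> at the whole group, this sum is \<open>[G : H]\<close> times
  the generating function that counts necklaces, that is, orbits of \<open>G\<close> on maps from \<open>G/H\<close> to the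
  monomials of \<open>P\<close>, if the coefficients of \<open>P\<close> are not negative.
\<close>

definition frobenius_sum :: "('a set \<Rightarrow> 'v intpoly) \<Rightarrow> 'a set \<Rightarrow> 'v intpoly"
  where "frobenius_sum b H = (\<Sum>C\<in>rcosets H. (frobenius_lift p ^^ coset_exp H C) (b (generate G C)))"

text \<open>The ghost vector of the family with the entry \<open>P\<close> at \<open>K\<close> and zero elsewhere.\<close>

definition single_ghost :: "'a set \<Rightarrow> 'r \<Rightarrow> 'a set \<Rightarrow> 'r::comm_ring_1"
  where "single_ghost K P H =
    (if H \<subseteq> K then of_nat (p ^ index_exp K) * P ^ (p ^ (index_exp H - index_exp K)) else 0)"

lemma frobenius_sum_cong:
  assumes "H \<in> opens" "\<And>K. K \<in> overgroups H \<Longrightarrow> b K = b' K"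
  shows "frobenius_sum b H = frobenius_sum b' H"
  unfolding frobenius_sum_def using assms generate_coset_overgroup by (intro sum.cong) auto

lemma frobenius_sum_add: "frobenius_sum (\<lambda>K. b K + b' K) H = frobenius_sum b H + frobenius_sum b' H"
  by (simp add: frobenius_sum_def frob.map_add sum.distrib)

lemma frobenius_sum_diff: "frobenius_sum (\<lambda>K. b K - b' K) H = frobenius_sum b H - frobenius_sum b' H"
  by (simp add: frobenius_sum_def frob.map_diff sum_subtractf)

lemma frobenius_sum_uminus: "frobenius_sum (\<lambda>K. - b K) H = - frobenius_sum b H"
  by (simp add: frobenius_sum_def frob.map_uminus sum_negf)

lemma frobenius_sum_sum:
  "frobenius_sum (\<lambda>K. \<Sum>i\<in>I. b i K) H = (\<Sum>i\<in>I. frobenius_sum (b i) H)"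
  unfolding frobenius_sum_def frob.map_sum by (rule sum.swap)

lemma frobenius_sum_of_nat_mult:
  "frobenius_sum (\<lambda>K. of_nat n * b K) H = of_nat n * frobenius_sum b H"
  by (simp add: frobenius_sum_def frob.map_mult frob.map_of_nat sum_distrib_left)

text \<open>
  Only cosets inside \<open>K\<close> contribute, and they form the finite group \<open>K/H\<close>. Successive terms
  \<open>\<phi>\<^sup>j(P)\<close>, raised to the matching powers, are congruent modulo powers of \<open>p\<close>, and these
  supply what the number of elements of order at most \<open>p\<^sup>j\<close> lacks for being divisible by the order
  of \<open>K/H\<close>.
\<close>

lemma frobenius_sum_single_ghost:
  assumes H: "H \<in> opens" and K: "K \<in> opens"
  shows "of_nat (p ^ index_exp H) dvd frobenius_sum (single_ghost K P) H"
proof (cases "H \<subseteq> K")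
  case False
  have "\<not> generate G C \<subseteq> K" if "C \<in> rcosets H" for C
    using generate_coset_overgroup[OF H that] False by (auto simp: overgroups_def)
  then show ?thesis
    by (simp add: frobenius_sum_def single_ghost_def frob.map_zero)
next
  case True
  let ?L = "{C \<in> rcosets H. C \<subseteq> K}" and ?n = "index_exp H - index_exp K"
  define y where "y j = (frobenius_lift p ^^ j) P ^ (p ^ (?n - j))" for j
  have KH: "K \<in> overgroups H" using K True by (simp add: overgroups_def)
  have "frobenius_sum (single_ghost K P) H =
      (\<Sum>C\<in>rcosets H. if C \<subseteq> K then of_nat (p ^ index_exp K) * y (coset_exp H C) else 0)"
    unfolding frobenius_sum_def
  proof (intro sum.cong refl)
    fix C assume C: "C \<in> rcosets H"
    have *: "index_exp (generate G C) - index_exp K = ?n - coset_exp H C"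
      using index_exp_generate[OF H C] by simp
    show "(frobenius_lift p ^^ coset_exp H C) (single_ghost K P (generate G C)) =
        (if C \<subseteq> K then of_nat (p ^ index_exp K) * y (coset_exp H C) else 0)"
      using generate_coset_subset_iff[OF H C opens_subgroup[OF K]]
      by (simp add: single_ghost_def y_def frob.map_zero frob.map_mult frob.map_of_nat
          frob.map_power * del: of_nat_power)
  qed
  also have "\<dots> = of_nat (p ^ index_exp K) * (\<Sum>C\<in>?L. y (coset_exp H C))"
    using finite_rcosets[OF H]
    by (simp add: sum.If_cases Int_def sum_distrib_left conj_commute)
  finally have eq: "frobenius_sum (single_ghost K P) H =
      of_nat (p ^ index_exp K) * (\<Sum>C\<in>?L. y (coset_exp H C))" .
  have "of_nat (p ^ ?n) dvd (\<Sum>C\<in>?L. y (coset_exp H C))"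
  proof (rule dvd_sum_by_levels)
    show "finite ?L" using finite_rcosets[OF H] by simp
    show "card ?L = p ^ ?n" by (rule card_rcosets_tower_exp(2)[OF H K True])
    show "coset_exp H C \<le> ?n" if "C \<in> ?L" for C
      using coset_exp_le[OF H KH] that by simp
    show "p ^ j dvd card {D \<in> ?L. coset_exp H D \<le> j}" if "C \<in> ?L" "j \<le> coset_exp H C" for j C
      using card_coset_exp_le_dvd[OF H KH, of C j] that by (simp add: conj_assoc)
    show "of_nat (p ^ (?n - j)) dvd y (Suc j) - y j" if "j < ?n" for j
      unfolding y_def using that by (rule frobenius_lift_power_step[OF prime_p])
  qed
  then have "of_nat (p ^ index_exp K) * of_nat (p ^ ?n) dvd frobenius_sum (single_ghost K P) H"
    unfolding eq by (intro mult_dvd_mono) auto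
  moreover have "index_exp K + ?n = index_exp H"
    using card_rcosets_tower_exp(1)[OF H K True] by simp
  ultimately show ?thesis
    by (metis of_nat_mult power_add)
qed

lemma ghost_eq_sum_single_ghost:
  assumes "H \<in> opens" "H' \<in> overgroups H"
  shows "ghost x H' = (\<Sum>K\<in>overgroups H. single_ghost K (x K) H')"
  unfolding ghost_def single_ghost_def overgroups_trans[OF assms(2)]
  using finite_overgroups[OF assms(1)] by (intro sum.mono_neutral_cong_left) auto

lemma frobenius_sum_ghost:
  assumes H: "H \<in> opens"
  shows "of_nat (p ^ index_exp H) dvd frobenius_sum (ghost x) H"
proof -
  have "frobenius_sum (ghost x) H =
      frobenius_sum (\<lambda>H'. \<Sum>K\<in>overgroups H. single_ghost K (x K) H') H"
    by (intro frobenius_sum_cong ghost_eq_sum_single_ghost H)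
  also have "\<dots> = (\<Sum>K\<in>overgroups H. frobenius_sum (single_ghost K (x K)) H)"
    by (rule frobenius_sum_sum)
  finally show ?thesis
    using H by (simp only:) (intro dvd_sum frobenius_sum_single_ghost, auto simp: overgroupsD)
qed

text \<open>
  The product of the orbits \<open>G/K\<close> and \<open>G/L\<close> is a disjoint union of copies of \<open>G/(K \<inter> L)\<close>. The
  multiplier is their number, an integer because \<open>[G : K \<inter> L]\<close> is at most \<open>[G : K] [G : L]\<close> and
  all three indices are powers of \<open>p\<close>.
\<close>

lemma single_ghost_mult:
  fixes P Q :: "'r::comm_ring_1"
  assumes K: "K \<in> opens" and L: "L \<in> opens" and H: "H \<in> opens"
  shows "single_ghost K P H * single_ghost L Q H =
    of_nat (p ^ (index_exp K + index_exp L - index_exp (K \<inter> L))) *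
    single_ghost (K \<inter> L) (P ^ (p ^ (index_exp (K \<inter> L) - index_exp K)) *
      Q ^ (p ^ (index_exp (K \<inter> L) - index_exp L))) H"
proof (cases "H \<subseteq> K \<inter> L")
  case False
  then show ?thesis by (auto simp: single_ghost_def)
next
  case True
  define h k l m where "h = index_exp H" and "k = index_exp K" and "l = index_exp L"
    and "m = index_exp (K \<inter> L)"
  have KL: "K \<inter> L \<in> opens" using K L by (rule Int_open)
  have le: "m \<le> k + l" "k \<le> m" "l \<le> m" "m \<le> h"
    using index_exp_Int_le[OF K L] card_rcosets_tower_exp(1)[OF KL K]
      card_rcosets_tower_exp(1)[OF KL L] card_rcosets_tower_exp(1)[OF H KL] True
    by (auto simp: h_def k_def l_def m_def)
  have "p ^ k * p ^ l = p ^ (k + l - m) * p ^ m"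
    using le by (simp flip: power_add)
  then have c: "(of_nat (p ^ k) * of_nat (p ^ l) :: 'r) = of_nat (p ^ (k + l - m)) * of_nat (p ^ m)"
    by (metis of_nat_mult)
  have e: "p ^ (h - k) = p ^ (m - k) * p ^ (h - m)" "p ^ (h - l) = p ^ (m - l) * p ^ (h - m)"
    using le by (simp_all flip: power_add)
  have "single_ghost K P H * single_ghost L Q H =
      (of_nat (p ^ k) * of_nat (p ^ l)) * (P ^ (p ^ (h - k)) * Q ^ (p ^ (h - l)))"
    using True by (simp add: single_ghost_def h_def k_def l_def algebra_simps)
  also have "\<dots> = of_nat (p ^ (k + l - m)) *
      (of_nat (p ^ m) * (P ^ (p ^ (m - k)) * Q ^ (p ^ (m - l))) ^ (p ^ (h - m)))"
    unfolding c e power_mult power_mult_distrib by (simp only: mult.assoc)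
  finally show ?thesis
    using True by (simp add: single_ghost_def h_def k_def l_def m_def)
qed

lemma frobenius_sum_ghost_mult:
  assumes H: "H \<in> opens"
  shows "of_nat (p ^ index_exp H) dvd frobenius_sum (\<lambda>K. ghost x K * ghost y K) H"
proof -
  let ?z = "\<lambda>K L. x K ^ (p ^ (index_exp (K \<inter> L) - index_exp K)) *
      y L ^ (p ^ (index_exp (K \<inter> L) - index_exp L))"
  let ?c = "\<lambda>K L. p ^ (index_exp K + index_exp L - index_exp (K \<inter> L))"
  have "frobenius_sum (\<lambda>K. ghost x K * ghost y K) H =
      frobenius_sum (\<lambda>H'. \<Sum>K\<in>overgroups H. \<Sum>L\<in>overgroups H.
        of_nat (?c K L) * single_ghost (K \<inter> L) (?z K L) H') H"
  proof (intro frobenius_sum_cong H)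
    fix H' assume H': "H' \<in> overgroups H"
    show "ghost x H' * ghost y H' = (\<Sum>K\<in>overgroups H. \<Sum>L\<in>overgroups H.
        of_nat (?c K L) * single_ghost (K \<inter> L) (?z K L) H')"
      unfolding ghost_eq_sum_single_ghost[OF H H'] sum_product
      by (intro sum.cong refl single_ghost_mult) (use H' in \<open>auto simp: overgroups_def\<close>)
  qed
  also have "\<dots> = (\<Sum>K\<in>overgroups H. \<Sum>L\<in>overgroups H.
      of_nat (?c K L) * frobenius_sum (single_ghost (K \<inter> L) (?z K L)) H)"
    by (simp only: frobenius_sum_sum frobenius_sum_of_nat_mult)
  also have "of_nat (p ^ index_exp H) dvd \<dots>"
    by (intro dvd_sum dvd_mult frobenius_sum_single_ghost H Int_open) (auto simp: overgroups_def)
  finally show ?thesis .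
qed

lemma ghost_split:
  assumes H: "H \<in> opens"
  shows "ghost x H = (\<Sum>K\<in>overgroups H - {H}.
      of_nat (p ^ index_exp K) * x K ^ (p ^ (index_exp H - index_exp K))) +
    of_nat (p ^ index_exp H) * x H"
  unfolding ghost_def
  by (subst sum.remove[OF finite_overgroups[OF H] overgroups_refl[OF H]]) simp

lemma index_exp_overgroup_less:
  assumes "H \<in> opens" "K \<in> overgroups H - {H}"
  shows "index_exp K < index_exp H"
  using assms by (intro index_exp_strict) (auto simp: overgroups_def)

text \<open>
  Once the coordinates at larger subgroups are known, the component at \<open>H\<close> determines the
  coordinate at \<open>H\<close> up to the factor \<open>p\<^sup>e\<close>, which can be cancelled in a ring without torsion.
\<close>

lemma ghost_inj:
  fixes x y :: "'a set \<Rightarrow> 'v intpoly"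
  assumes "H \<in> opens" "\<And>K. K \<in> overgroups H \<Longrightarrow> ghost x K = ghost y K"
  shows "x H = y H"
  using assms
proof (induction "index_exp H" arbitrary: H rule: less_induct)
  case less
  have "x K = y K" if "K \<in> overgroups H - {H}" for K
    using that less index_exp_overgroup_less[OF less.prems(1) that]
    by (intro less.hyps) (auto simp: overgroups_def)
  then have "(\<Sum>K\<in>overgroups H - {H}.
      of_nat (p ^ index_exp K) * x K ^ (p ^ (index_exp H - index_exp K))) =
    (\<Sum>K\<in>overgroups H - {H}.
      of_nat (p ^ index_exp K) * y K ^ (p ^ (index_exp H - index_exp K)))"
    by (intro sum.cong) auto
  then have "of_nat (p ^ index_exp H) * x H = of_nat (p ^ index_exp H) * y H"
    using less.prems(2)[OF overgroups_refl[OF less.prems(1)]] ghost_split[OF less.prems(1), of x]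
      ghost_split[OF less.prems(1), of y] by simp
  then show ?case
    by (rule intpoly_of_nat_cancel) (simp add: p_gt_0)
qed

text \<open>
  If \<open>b\<close> satisfies the congruence at \<open>H\<close> and agrees above \<open>H\<close> with the ghost vector of \<open>x\<close>,
  then the two congruences at \<open>H\<close> differ only in the term of the trivial coset, where the
  Frobenius lift is applied \<open>0\<close> times.
\<close>

lemma ghost_congruence_step:
  assumes H: "H \<in> opens" and b: "of_nat (p ^ index_exp H) dvd frobenius_sum b H"
    and eq: "\<And>K. K \<in> overgroups H - {H} \<Longrightarrow> ghost x K = b K"
  shows "of_nat (p ^ index_exp H) dvd b H - ghost x H"
proof -
  have Hr: "H \<in> rcosets H"
    using subgroup.subgroup_in_rcosets[OF opens_subgroup[OF H] is_group] .
  have gH: "generate G H = H" using generate_coset_eq_iff[OF H Hr] by simp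
  have "frobenius_sum (\<lambda>K. b K - ghost x K) H =
      (frobenius_lift p ^^ coset_exp H H) (b (generate G H) - ghost x (generate G H))"
    unfolding frobenius_sum_def
  proof (subst sum.remove[OF finite_rcosets[OF H] Hr], rule trans[OF arg_cong2[where f="(+)"]])
    show "(\<Sum>C\<in>rcosets H - {H}. (frobenius_lift p ^^ coset_exp H C)
        (b (generate G C) - ghost x (generate G C))) = 0"
    proof (rule sum.neutral, rule ballI)
      fix C assume C: "C \<in> rcosets H - {H}"
      then have "generate G C \<in> overgroups H - {H}"
        using generate_coset_overgroup[OF H] generate_coset_eq_iff[OF H] by auto
      then show "(frobenius_lift p ^^ coset_exp H C) (b (generate G C) - ghost x (generate G C)) = 0"
        using eq by (simp add: frob.map_zero)
    qed
  qed auto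
  also have "\<dots> = b H - ghost x H"
    by (simp add: gH coset_exp_def)
  finally show ?thesis
    using dvd_diff[OF b frobenius_sum_ghost[OF H, of x]] by (simp add: frobenius_sum_diff)
qed

text \<open>
  The congruences make the divisions possible by which the coordinates are computed recursively,
  from larger to smaller subgroups.
\<close>

lemma ghost_exists_if_congruences:
  fixes b :: "'a set \<Rightarrow> 'v intpoly"
  assumes b: "\<And>H. H \<in> opens \<Longrightarrow> of_nat (p ^ index_exp H) dvd frobenius_sum b H"
  shows "\<exists>x. \<forall>H\<in>opens. ghost x H = b H"
proof -
  let ?R = "inv_image less_than index_exp"
  let ?S = "\<lambda>x H. (\<Sum>K\<in>overgroups H - {H}.
      of_nat (p ^ index_exp K) * x K ^ (p ^ (index_exp H - index_exp K)))"
  define F :: "('a set \<Rightarrow> 'v intpoly) \<Rightarrow> 'a set \<Rightarrow> 'v intpoly"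
    where "F x H = (SOME q. b H = ?S x H + of_nat (p ^ index_exp H) * q)" for x H
  \<comment> \<open>The quotient is chosen by Hilbert's operator; that it exists is known only afterwards, once
    the components at larger subgroups are seen to be correct.\<close>
  define x where "x = wfrec ?R F"
  have wf: "wf ?R" by (rule wf_inv_image) (rule wf_less_than)
  have S_cong: "?S x H = ?S y H" if "\<And>K. K \<in> overgroups H - {H} \<Longrightarrow> x K = y K"
    for x y :: "'a set \<Rightarrow> 'v intpoly" and H
    using that by (intro sum.cong) auto
  have x_eq: "x H = F x H" if "H \<in> opens" for H
  proof -
    have "x H = F (cut x ?R H) H" unfolding x_def by (rule wfrec[OF wf])
    also have "?S (cut x ?R H) H = ?S x H"
      by (rule S_cong) (use index_exp_overgroup_less[OF that] in \<open>auto simp: cut_def\<close>)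
    then have "F (cut x ?R H) H = F x H" unfolding F_def by simp
    finally show ?thesis .
  qed
  have "ghost x H = b H" if "H \<in> opens" for H
    using that
  proof (induction "index_exp H" arbitrary: H rule: less_induct)
    case less
    note H = less.prems
    have "ghost x K = b K" if "K \<in> overgroups H - {H}" for K
      using that less.hyps[OF index_exp_overgroup_less[OF H that]] by (simp add: overgroups_def)
    then have "of_nat (p ^ index_exp H) dvd b H - ghost x H"
      using ghost_congruence_step[OF H b[OF H]] by blast
    then obtain q where "b H - ghost x H = of_nat (p ^ index_exp H) * q" by (rule dvdE)
    then have "b H = ?S x H + of_nat (p ^ index_exp H) * (x H + q)"
      using ghost_split[OF H, of x] by (simp add: algebra_simps)
    then have "b H = ?S x H + of_nat (p ^ index_exp H) * F x H"
      unfolding F_def by (rule someI)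
    then show ?case
      using ghost_split[OF H, of x] x_eq[OF H] by simp
  qed
  then show ?thesis by blast
qed

lemma ghost_add_exists:
  fixes x y :: "'a set \<Rightarrow> 'v intpoly"
  shows "\<exists>s. \<forall>H\<in>opens. ghost s H = ghost x H + ghost y H"
  by (rule ghost_exists_if_congruences) (auto simp only: frobenius_sum_add intro: dvd_add frobenius_sum_ghost)

lemma ghost_uminus_exists:
  fixes x :: "'a set \<Rightarrow> 'v intpoly"
  shows "\<exists>s. \<forall>H\<in>opens. ghost s H = - ghost x H"
  by (rule ghost_exists_if_congruences) (auto simp only: frobenius_sum_uminus dvd_minus_iff intro: frobenius_sum_ghost)

lemma ghost_mult_exists:
  fixes x y :: "'a set \<Rightarrow> 'v intpoly"
  shows "\<exists>s. \<forall>H\<in>opens. ghost s H = ghost x H * ghost y H"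
  by (rule ghost_exists_if_congruences) (rule frobenius_sum_ghost_mult)

end

section \<open>The Witt--Burnside ring of an abelian pro-p group\<close>

context abelian_pro_p
begin

lemma lcosets_eq_rcosets: "subgroup K G \<Longrightarrow> lcosets K = rcosets K"
  using subgroup_imp_normal[of K] by (auto simp: LCOSETS_def RCOSETS_def normal_axioms_def normal_def)

lemma lcoset_invariant:
  assumes H: "subgroup H G" and f: "f \<in> coset_maps G H K" and h: "h \<in> H"
  shows "h <# f H = f H"
proof -
  have "h \<in> carrier G" "h <# H = H"
    using subgroup.mem_carrier[OF H h] coset_join3[OF _ H h] by auto
  moreover have "H \<in> lcosets H"
    using subgroup.subgroup_in_rcosets[OF H is_group] lcosets_eq_rcosets[OF H] by simp
  moreover from this have "f (h <# H) = h <# f H"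
    using f \<open>h \<in> carrier G\<close> by (simp add: coset_maps_def)
  ultimately show ?thesis by simp
qed

lemma coset_maps_imp_subset:
  assumes H: "subgroup H G" and K: "subgroup K G" and f: "f \<in> coset_maps G H K"
  shows "H \<subseteq> K"
proof
  fix h assume h: "h \<in> H"
  have hc: "h \<in> carrier G" using subgroup.mem_carrier[OF H h] .
  have "H \<in> lcosets H"
    using subgroup.subgroup_in_rcosets[OF H is_group] lcosets_eq_rcosets[OF H] by simp
  then have "f H \<in> lcosets K"
    using f by (auto simp: coset_maps_def)
  then obtain y where y: "y \<in> carrier G" "f H = y <# K" by (auto simp: LCOSETS_def)
  have "h \<otimes> y \<in> h <# f H"
    using y subgroup.one_closed[OF K] by (force simp: l_coset_def)
  then have "h \<otimes> y \<in> y <# K"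
    using lcoset_invariant[OF H f h] y by simp
  then obtain k where "k \<in> K" "h \<otimes> y = y \<otimes> k" by (auto simp: l_coset_def)
  moreover from this have "h = k"
    using hc y subgroup.mem_carrier[OF K] by (metis m_comm r_cancel)
  ultimately show "h \<in> K" by simp
qed

text \<open>
  A map of \<open>G\<close>-sets from \<open>G/H\<close> is determined by the image of the base point. Conversely every coset
  of \<open>K\<close> can be this image, since in an abelian group \<open>H\<close>, being contained in \<open>K\<close>, fixes it.
\<close>

lemma bij_betw_coset_maps:
  assumes H: "subgroup H G" and K: "subgroup K G" and HK: "H \<subseteq> K"
  shows "bij_betw (\<lambda>f. f H) (coset_maps G H K) (lcosets K)"
  unfolding bij_betw_def
proof
  have HH: "H \<in> lcosets H"
    using subgroup.subgroup_in_rcosets[OF H is_group] lcosets_eq_rcosets[OF H] by simp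
  have Hc: "H \<subseteq> carrier G" and Kc: "K \<subseteq> carrier G" using H K subgroup.subset by auto
  show "inj_on (\<lambda>f. f H) (coset_maps G H K)"
  proof (rule inj_onI)
    fix f f' assume f: "f \<in> coset_maps G H K" "f' \<in> coset_maps G H K" and eq: "f H = f' H"
    show "f = f'"
    proof (rule PiE_ext)
      show "f \<in> (lcosets H) \<rightarrow>\<^sub>E (lcosets K)" "f' \<in> (lcosets H) \<rightarrow>\<^sub>E (lcosets K)"
        using f by (auto simp: coset_maps_def)
      fix C assume "C \<in> lcosets H"
      then obtain g where "g \<in> carrier G" "C = g <# H" by (auto simp: LCOSETS_def)
      then show "f C = f' C" using f HH eq by (auto simp: coset_maps_def)
    qed
  qed
  show "(\<lambda>f. f H) ` coset_maps G H K = lcosets K"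
  proof (intro equalityI subsetI)
    fix D assume "D \<in> (\<lambda>f. f H) ` coset_maps G H K"
    then show "D \<in> lcosets K" using HH by (auto simp: coset_maps_def)
  next
    fix D assume D: "D \<in> lcosets K"
    then obtain y where y: "y \<in> carrier G" "D = y <# K" by (auto simp: LCOSETS_def)
    have Dc: "D \<subseteq> carrier G" using y Kc by (simp add: l_coset_subset_G)
    define f where "f = (\<lambda>C\<in>lcosets H. (SOME x. x \<in> C) <# D)"
    have f: "f (x <# H) = x <# D" if x: "x \<in> carrier G" for x
    proof -
      have C: "x <# H \<in> lcosets H" using x by (auto simp: LCOSETS_def)
      have "x \<otimes> \<one> \<in> x <# H" using subgroup.one_closed[OF H] by (auto simp: l_coset_def)
      then have "(SOME x'. x' \<in> x <# H) \<in> x <# H" by (rule someI)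
      then obtain h where h: "h \<in> H" "(SOME x'. x' \<in> x <# H) = x \<otimes> h"
        by (auto simp: l_coset_def)
      have hc: "h \<in> carrier G" "h \<in> K" using h Hc HK by auto
      have "h <# D = (h \<otimes> y) <# K" using hc y Kc by (simp add: lcos_m_assoc)
      also have "\<dots> = y <# (h <# K)" using hc y Kc by (simp add: lcos_m_assoc m_comm)
      also have "\<dots> = D" using hc y K by (simp add: coset_join3)
      finally have "h <# D = D" .
      then have "(x \<otimes> h) <# D = x <# D"
        using lcos_m_assoc[OF Dc x hc(1)] by simp
      then show ?thesis using C h by (simp add: f_def)
    qed
    have "f \<in> coset_maps G H K"
      unfolding coset_maps_def
    proof (intro CollectI conjI ballI PiE_I)
      fix C assume "C \<in> lcosets H"
      then obtain x where x: "x \<in> carrier G" "C = x <# H" by (auto simp: LCOSETS_def)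
      have "f C = (x \<otimes> y) <# K" using f x y Kc by (simp add: lcos_m_assoc)
      then show "f C \<in> lcosets K" using x y by (auto simp: LCOSETS_def)
    next
      fix C assume "C \<notin> lcosets H"
      then show "f C = undefined" by (simp add: f_def)
    next
      fix g C assume g: "g \<in> carrier G" and "C \<in> lcosets H"
      then obtain x where x: "x \<in> carrier G" "C = x <# H" by (auto simp: LCOSETS_def)
      have "g <# C = (g \<otimes> x) <# H" using x g Hc by (simp add: lcos_m_assoc)
      then have "f (g <# C) = (g \<otimes> x) <# D" using f g x by simp
      also have "\<dots> = g <# f C" using f g x Dc by (simp add: lcos_m_assoc)
      finally show "f (g <# C) = g <# f C" .
    qed
    moreover have "f H = D"
      using f[OF one_closed] lcos_mult_one[OF Hc] lcos_mult_one[OF Dc] by simp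
    ultimately show "D \<in> (\<lambda>f. f H) ` coset_maps G H K" by (metis image_eqI)
  qed
qed

lemma card_lcosets: "H \<in> opens \<Longrightarrow> card (lcosets H) = p ^ index_exp H"
  using card_rcosets lcosets_eq_rcosets[OF opens_subgroup] by simp

lemma card_coset_maps:
  assumes "H \<in> opens" "K \<in> opens" "H \<subseteq> K"
  shows "card (coset_maps G H K) = p ^ index_exp K"
  using bij_betw_same_card[OF bij_betw_coset_maps[OF opens_subgroup[OF assms(1)]
    opens_subgroup[OF assms(2)] assms(3)]] card_lcosets[OF assms(2)] by simp

lemma coset_maps_nonempty_iff:
  assumes "H \<in> opens" "K \<in> opens"
  shows "coset_maps G H K \<noteq> {} \<longleftrightarrow> H \<subseteq> K"
proof
  assume "coset_maps G H K \<noteq> {}"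
  then obtain f where "f \<in> coset_maps G H K" by auto
  then show "H \<subseteq> K" using coset_maps_imp_subset[OF opens_subgroup opens_subgroup] assms by simp
next
  assume "H \<subseteq> K"
  then have "card (coset_maps G H K) > 0" using card_coset_maps[OF assms] p_gt_0 by simp
  then show "coset_maps G H K \<noteq> {}" by (auto simp: card_gt_0_iff)
qed

lemma coset_iso_eq: "coset_iso G \<Omega> = Id_on opens"
proof (intro equalityI subrelI)
  fix H K assume "(H, K) \<in> coset_iso G \<Omega>"
  then obtain f where HK: "H \<in> opens" "K \<in> opens"
    and f: "f \<in> coset_maps G H K" "bij_betw f (lcosets H) (lcosets K)"
    by (auto simp: coset_iso_def)
  have "H \<subseteq> K" using coset_maps_imp_subset[OF opens_subgroup opens_subgroup f(1)] HK by simp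
  moreover have "p ^ index_exp H = p ^ index_exp K"
    using bij_betw_same_card[OF f(2)] card_lcosets HK by simp
  then have "index_exp H = index_exp K" by (simp only: power_inject_exp[OF p_gt_1])
  ultimately have "H = K" using index_exp_inj[OF HK] by simp
  then show "(H, K) \<in> Id_on opens" using HK by auto
next
  fix H K assume "(H, K) \<in> Id_on opens"
  then have H: "H \<in> opens" "K = H" by auto
  define f where "f = (\<lambda>C\<in>lcosets H. C)"
  have Hc: "H \<subseteq> carrier G" using H opens_subgroup subgroup.subset by auto
  have mem: "g <# C \<in> lcosets H" if "g \<in> carrier G" "C \<in> lcosets H" for g C
    using that Hc by (auto simp: LCOSETS_def lcos_m_assoc)
  have "f \<in> coset_maps G H H"
    by (auto simp: coset_maps_def f_def mem)
  moreover have "bij_betw f (lcosets H) (lcosets H)"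
    by (auto simp: f_def bij_betw_def inj_on_def)
  ultimately show "(H, K) \<in> coset_iso G \<Omega>"
    using H by (auto simp: coset_iso_def)
qed

text \<open>As \<open>G\<close> is abelian, transitive \<open>G\<close>-sets are isomorphic only if they have the same stabilizer.\<close>

lemma frame_eq: "frame G \<Omega> = (\<lambda>H. {H}) ` opens"
  by (auto simp: frame_def coset_iso_eq quotient_def)

lemma frameE:
  assumes "T \<in> frame G \<Omega>"
  obtains H where "H \<in> opens" "T = {H}"
  using assms frame_eq by auto

lemma class_rep_singleton [simp]: "class_rep {H} = H"
  by (simp add: class_rep_def)

lemma class_size_singleton: "H \<in> opens \<Longrightarrow> class_size G {H} = p ^ index_exp H"
  by (simp add: class_size_def card_lcosets)

lemma witt_eq_ghost:
  assumes H: "H \<in> opens"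
  shows "witt G \<Omega> {H} x = ghost (\<lambda>K. x {K}) H"
proof -
  have "class_le G {K} {H} \<longleftrightarrow> H \<subseteq> K" if "K \<in> opens" for K
    using coset_maps_nonempty_iff[OF H that] by (simp add: class_le_def)
  then have "{U \<in> frame G \<Omega>. class_le G U {H}} = (\<lambda>K. {K}) ` overgroups H"
    by (auto simp: frame_eq overgroups_def)
  then have "witt G \<Omega> {H} x = (\<Sum>K\<in>overgroups H.
      of_nat (num_maps G {H} {K}) * x {K} ^ (class_size G {H} div class_size G {K}))"
    by (simp add: witt_def sum.reindex)
  also have "\<dots> = ghost (\<lambda>K. x {K}) H"
    unfolding ghost_def
  proof (intro sum.cong refl)
    fix K assume "K \<in> overgroups H"
    then have K: "K \<in> opens" "H \<subseteq> K" by (auto simp: overgroups_def)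
    have "p ^ index_exp H = p ^ (index_exp H - index_exp K) * p ^ index_exp K"
      using card_rcosets_tower_exp(1)[OF H K] by (simp flip: power_add)
    then have "class_size G {H} div class_size G {K} = p ^ (index_exp H - index_exp K)"
      using p_gt_0 H K by (simp add: class_size_singleton)
    then show "of_nat (num_maps G {H} {K}) * x {K} ^ (class_size G {H} div class_size G {K}) =
        of_nat (p ^ index_exp K) * x {K} ^ (p ^ (index_exp H - index_exp K))"
      using card_coset_maps[OF H K] by (simp add: num_maps_def)
  qed
  finally show ?thesis .
qed

lemma ghost_cong:
  assumes "\<And>K. K \<in> overgroups H \<Longrightarrow> x K = y K"
  shows "ghost x H = ghost y H"
  using assms by (simp add: ghost_def cong: sum.cong)

lemma witt_cong:
  assumes "T \<in> frame G \<Omega>" "\<And>U. U \<in> frame G \<Omega> \<Longrightarrow> x U = y U"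
  shows "witt G \<Omega> T x = witt G \<Omega> T y"
  using assms by (auto simp: witt_def intro!: sum.cong)

lemma (in unital_ring_map) map_witt: "h (witt G \<Omega> T x) = witt G \<Omega> T (\<lambda>U. h (x U))"
  by (simp add: witt_def map_sum map_mult map_of_nat map_power)

lemma witt_inj:
  fixes x y :: "'a set set \<Rightarrow> 'v intpoly"
  assumes "x \<in> extensional (frame G \<Omega>)" "y \<in> extensional (frame G \<Omega>)"
    and "\<And>T. T \<in> frame G \<Omega> \<Longrightarrow> witt G \<Omega> T x = witt G \<Omega> T y"
  shows "x = y"
proof (rule extensionalityI[OF assms(1,2)])
  fix T assume "T \<in> frame G \<Omega>"
  then obtain H where H: "H \<in> opens" "T = {H}" by (rule frameE)
  have "x {H} = y {H}"
  proof (rule ghost_inj[OF H(1)])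
    fix K assume "K \<in> overgroups H"
    then have K: "K \<in> opens" "{K} \<in> frame G \<Omega>" by (simp_all add: overgroups_def frame_eq)
    then show "ghost (\<lambda>K. x {K}) K = ghost (\<lambda>K. y {K}) K"
      using assms(3)[OF K(2)] by (simp add: witt_eq_ghost)
  qed
  then show "x T = y T" using H by simp
qed

lemma witt_solution_unique:
  fixes b :: "'a set set \<Rightarrow> 'v intpoly"
  assumes "\<exists>s. \<forall>H\<in>opens. ghost s H = b {H}"
  shows "\<exists>!S. S \<in> extensional (frame G \<Omega>) \<and> (\<forall>T\<in>frame G \<Omega>. b T = witt G \<Omega> T S)"
proof (rule ex_ex1I)
  obtain s where s: "\<And>H. H \<in> opens \<Longrightarrow> ghost s H = b {H}" using assms by auto
  define S where "S = (\<lambda>T\<in>frame G \<Omega>. s (the_elem T))"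
  have "b T = witt G \<Omega> T S" if T: "T \<in> frame G \<Omega>" for T
  proof -
    obtain H where H: "H \<in> opens" "T = {H}" using T by (rule frameE)
    have "ghost (\<lambda>K. S {K}) H = ghost s H"
      by (rule ghost_cong) (auto simp: S_def frame_eq overgroups_def)
    then show ?thesis using s[OF H(1)] H witt_eq_ghost[OF H(1), of S] by simp
  qed
  moreover have "S \<in> extensional (frame G \<Omega>)" by (simp add: S_def)
  ultimately show "\<exists>S. S \<in> extensional (frame G \<Omega>) \<and> (\<forall>T\<in>frame G \<Omega>. b T = witt G \<Omega> T S)"
    by blast
next
  fix S S'
  assume "S \<in> extensional (frame G \<Omega>) \<and> (\<forall>T\<in>frame G \<Omega>. b T = witt G \<Omega> T S)"
    "S' \<in> extensional (frame G \<Omega>) \<and> (\<forall>T\<in>frame G \<Omega>. b T = witt G \<Omega> T S')"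
  then show "S = S'" by (intro witt_inj) auto
qed

lemma witt_sum:
  "T \<in> frame G \<Omega> \<Longrightarrow> witt G \<Omega> T (\<lambda>U. indet (Inl U)) + witt G \<Omega> T (\<lambda>U. indet (Inr U)) =
     witt G \<Omega> T (witt_sum G \<Omega>)"
proof -
  have "\<exists>!S. S \<in> extensional (frame G \<Omega>) \<and> (\<forall>T\<in>frame G \<Omega>.
      witt G \<Omega> T (\<lambda>U. indet (Inl U)) + witt G \<Omega> T (\<lambda>U. indet (Inr U)) =
      (witt G \<Omega> T S :: ('a set set + 'a set set) intpoly))"
    using ghost_add_exists[of "\<lambda>K. indet (Inl {K})" "\<lambda>K. indet (Inr {K})"]
    by (intro witt_solution_unique) (simp add: witt_eq_ghost)
  from theI'[OF this]
  show "T \<in> frame G \<Omega> \<Longrightarrow> witt G \<Omega> T (\<lambda>U. indet (Inl U)) + witt G \<Omega> T (\<lambda>U. indet (Inr U)) =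
       witt G \<Omega> T (witt_sum G \<Omega>)"
    unfolding witt_sum_def by auto
qed

lemma witt_prod:
  "T \<in> frame G \<Omega> \<Longrightarrow> witt G \<Omega> T (\<lambda>U. indet (Inl U)) * witt G \<Omega> T (\<lambda>U. indet (Inr U)) =
     witt G \<Omega> T (witt_prod G \<Omega>)"
proof -
  have "\<exists>!S. S \<in> extensional (frame G \<Omega>) \<and> (\<forall>T\<in>frame G \<Omega>.
      witt G \<Omega> T (\<lambda>U. indet (Inl U)) * witt G \<Omega> T (\<lambda>U. indet (Inr U)) =
      (witt G \<Omega> T S :: ('a set set + 'a set set) intpoly))"
    using ghost_mult_exists[of "\<lambda>K. indet (Inl {K})" "\<lambda>K. indet (Inr {K})"]
    by (intro witt_solution_unique) (simp add: witt_eq_ghost)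
  from theI'[OF this]
  show "T \<in> frame G \<Omega> \<Longrightarrow> witt G \<Omega> T (\<lambda>U. indet (Inl U)) * witt G \<Omega> T (\<lambda>U. indet (Inr U)) =
       witt G \<Omega> T (witt_prod G \<Omega>)"
    unfolding witt_prod_def by auto
qed

lemma witt_poly_eval_sum:
  assumes "T \<in> frame G \<Omega>"
  shows "witt G \<Omega> T (\<lambda>U. poly_eval (case_sum a b) (witt_sum G \<Omega> U)) = witt G \<Omega> T a + witt G \<Omega> T b"
  using arg_cong[OF witt_sum[OF assms], of "poly_eval (case_sum a b)"]
  by (simp add: poly_eval_add poly_eval.map_witt)

lemma witt_poly_eval_prod:
  assumes "T \<in> frame G \<Omega>"
  shows "witt G \<Omega> T (\<lambda>U. poly_eval (case_sum a b) (witt_prod G \<Omega> U)) = witt G \<Omega> T a * witt G \<Omega> T b"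
  using arg_cong[OF witt_prod[OF assms], of "poly_eval (case_sum a b)"]
  by (simp add: poly_eval_mult poly_eval.map_witt)

text \<open>
  The polynomials \<open>S\<^sub>H\<close> and \<open>M\<^sub>H\<close> involve only indeterminates that belong to overgroups of \<open>H\<close>:
  annihilating all others does not change the ghost components at these overgroups, which
  determine the polynomial.
\<close>

lemma witt_op_local:
  fixes P :: "'a set set \<Rightarrow> ('a set set + 'a set set) intpoly" and a b a' b' :: "_ \<Rightarrow> 'r::comm_ring_1"
  assumes P: "\<And>(x :: _ \<Rightarrow> ('a set set + 'a set set) intpoly) y T. T \<in> frame G \<Omega> \<Longrightarrow>
      witt G \<Omega> T (\<lambda>U. poly_eval (case_sum x y) (P U)) = f (witt G \<Omega> T x) (witt G \<Omega> T y)"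
    and H: "H \<in> opens"
    and eq: "\<And>K. K \<in> overgroups H \<Longrightarrow> a {K} = a' {K}" "\<And>K. K \<in> overgroups H \<Longrightarrow> b {K} = b' {K}"
  shows "poly_eval (case_sum a b) (P {H}) = poly_eval (case_sum a' b') (P {H})"
proof -
  define c :: "('a set set \<Rightarrow> ('a set set + 'a set set) intpoly) \<Rightarrow> _"
    where "c = (\<lambda>x U. if U \<in> (\<lambda>K. {K}) ` overgroups H then x U else 0)"
  let ?X = "\<lambda>U. indet (Inl U) :: ('a set set + 'a set set) intpoly"
  let ?Y = "\<lambda>U. indet (Inr U) :: ('a set set + 'a set set) intpoly"
  have c: "ghost (\<lambda>L. c x {L}) K = ghost (\<lambda>L. x {L}) K" if "K \<in> overgroups H" for x K
    by (rule ghost_cong) (use that in \<open>auto simp: c_def overgroups_def\<close>)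
  have "poly_eval (case_sum ?X ?Y) (P {H}) = poly_eval (case_sum (c ?X) (c ?Y)) (P {H})"
  proof (rule ghost_inj[OF H])
    fix K assume K: "K \<in> overgroups H"
    then have T: "{K} \<in> frame G \<Omega>" and K': "K \<in> opens" by (auto simp: frame_eq overgroups_def)
    show "ghost (\<lambda>L. poly_eval (case_sum ?X ?Y) (P {L})) K =
        ghost (\<lambda>L. poly_eval (case_sum (c ?X) (c ?Y)) (P {L})) K"
      using P[OF T, of ?X ?Y] P[OF T, of "c ?X" "c ?Y"] c[OF K] K'
      by (simp add: witt_eq_ghost)
  qed
  moreover have "case_sum ?X ?Y = indet"
    by (auto simp: fun_eq_iff split: sum.splits)
  ultimately have P_eq: "P {H} = poly_eval (case_sum (c ?X) (c ?Y)) (P {H})"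
    by (simp only: poly_eval_indet_id)
  have "poly_eval (case_sum a b) (case_sum (c ?X) (c ?Y) v) =
      poly_eval (case_sum a' b') (case_sum (c ?X) (c ?Y) v)" for v
    using eq by (auto simp: c_def split: sum.splits)
  then show ?thesis
    by (subst (1 2) P_eq) (simp add: poly_eval.map_poly_eval)
qed

lemmas witt_sum_local = witt_op_local[of "witt_sum G \<Omega>" "(+)", OF witt_poly_eval_sum]
lemmas witt_prod_local = witt_op_local[of "witt_prod G \<Omega>" "(*)", OF witt_poly_eval_prod]

lemma witt_ring_carrier [simp]: "carrier (witt_burnside_ring G \<Omega>) = frame G \<Omega> \<rightarrow>\<^sub>E UNIV"
  by (simp add: witt_burnside_ring_def)

lemma witt_ring_zero: "\<zero>\<^bsub>witt_burnside_ring G \<Omega>\<^esub> = (\<lambda>T\<in>frame G \<Omega>. 0)"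
  by (simp add: witt_burnside_ring_def)

lemma witt_ring_one: "\<one>\<^bsub>witt_burnside_ring G \<Omega>\<^esub> = (\<lambda>T\<in>frame G \<Omega>. if class_size G T = 1 then 1 else 0)"
  by (simp add: witt_burnside_ring_def)

lemma witt_ring_add: "a \<oplus>\<^bsub>witt_burnside_ring G \<Omega>\<^esub> b =
    (\<lambda>T\<in>frame G \<Omega>. poly_eval (case_sum a b) (witt_sum G \<Omega> T))"
  by (simp add: witt_burnside_ring_def)

lemma witt_ring_mult: "a \<otimes>\<^bsub>witt_burnside_ring G \<Omega>\<^esub> b =
    (\<lambda>T\<in>frame G \<Omega>. poly_eval (case_sum a b) (witt_prod G \<Omega> T))"
  by (simp add: witt_burnside_ring_def)

lemma witt_restrict: "T \<in> frame G \<Omega> \<Longrightarrow> witt G \<Omega> T (\<lambda>U\<in>frame G \<Omega>. f U) = witt G \<Omega> T f"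
  by (rule witt_cong) auto

lemma witt_of_add: "T \<in> frame G \<Omega> \<Longrightarrow>
    witt G \<Omega> T (a \<oplus>\<^bsub>witt_burnside_ring G \<Omega>\<^esub> b) = witt G \<Omega> T a + witt G \<Omega> T b"
  by (simp add: witt_ring_add witt_restrict witt_poly_eval_sum)

lemma witt_of_mult: "T \<in> frame G \<Omega> \<Longrightarrow>
    witt G \<Omega> T (a \<otimes>\<^bsub>witt_burnside_ring G \<Omega>\<^esub> b) = witt G \<Omega> T a * witt G \<Omega> T b"
  by (simp add: witt_ring_mult witt_restrict witt_poly_eval_prod)

lemma witt_of_zero: "T \<in> frame G \<Omega> \<Longrightarrow> witt G \<Omega> T (\<zero>\<^bsub>witt_burnside_ring G \<Omega>\<^esub>) = 0"
  by (auto simp: witt_ring_zero witt_restrict witt_eq_ghost ghost_def p_gt_0 zero_power elim!: frameE)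

lemma witt_of_one:
  assumes T: "T \<in> frame G \<Omega>"
  shows "witt G \<Omega> T (\<one>\<^bsub>witt_burnside_ring G \<Omega>\<^esub>) = 1"
proof -
  obtain H where H: "H \<in> opens" "T = {H}" using T by (rule frameE)
  have size: "class_size G {K} = 1 \<longleftrightarrow> K = carrier G" if "K \<in> opens" for K
    using index_exp_eq_0_iff[OF that] p_gt_1 by (simp add: class_size_singleton that)
  have GH: "carrier G \<in> overgroups H"
    using carrier_open subgroup.subset[OF opens_subgroup[OF H(1)]] by (simp add: overgroups_def)
  have "witt G \<Omega> T (\<one>\<^bsub>witt_burnside_ring G \<Omega>\<^esub>) =
      ghost (\<lambda>K. if class_size G {K} = 1 then 1 else 0) H"
    using T H by (simp add: witt_ring_one witt_restrict witt_eq_ghost)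
  also have "\<dots> = (\<Sum>K\<in>overgroups H. if K = carrier G then 1 else 0)"
    unfolding ghost_def using size p_gt_0
    by (intro sum.cong) (auto simp: overgroups_def zero_power)
  also have "\<dots> = 1"
    using GH finite_overgroups[OF H(1)] by simp
  finally show ?thesis .
qed

definition map_coords :: "('r \<Rightarrow> 's) \<Rightarrow> ('a set set \<Rightarrow> 'r) \<Rightarrow> 'a set set \<Rightarrow> 's"
  where "map_coords h x = (\<lambda>T\<in>frame G \<Omega>. h (x T))"

lemma map_coords_add:
  assumes "unital_ring_map h"
  shows "map_coords h (x \<oplus>\<^bsub>witt_burnside_ring G \<Omega>\<^esub> y) =
    map_coords h x \<oplus>\<^bsub>witt_burnside_ring G \<Omega>\<^esub> map_coords h y"
proof -
  interpret h: unital_ring_map h by fact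
  have "h (poly_eval (case_sum x y) (witt_sum G \<Omega> T)) =
      poly_eval (case_sum (map_coords h x) (map_coords h y)) (witt_sum G \<Omega> T)"
    if T: "T \<in> frame G \<Omega>" for T
  proof -
    obtain H where H: "H \<in> opens" "T = {H}" using T by (rule frameE)
    have "(\<lambda>v. h (case_sum x y v)) = case_sum (\<lambda>U. h (x U)) (\<lambda>U. h (y U))"
      by (auto simp: fun_eq_iff split: sum.splits)
    then have "h (poly_eval (case_sum x y) (witt_sum G \<Omega> T)) =
        poly_eval (case_sum (\<lambda>U. h (x U)) (\<lambda>U. h (y U))) (witt_sum G \<Omega> T)"
      by (simp add: h.map_poly_eval)
    also have "\<dots> = poly_eval (case_sum (map_coords h x) (map_coords h y)) (witt_sum G \<Omega> T)"
      unfolding H(2) by (rule witt_sum_local[OF _ H(1)])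
        (auto simp: map_coords_def overgroups_def frame_eq)
    finally show ?thesis .
  qed
  then show ?thesis
    by (auto simp: witt_ring_add map_coords_def fun_eq_iff restrict_def)
qed

lemma map_coords_mult:
  assumes "unital_ring_map h"
  shows "map_coords h (x \<otimes>\<^bsub>witt_burnside_ring G \<Omega>\<^esub> y) =
    map_coords h x \<otimes>\<^bsub>witt_burnside_ring G \<Omega>\<^esub> map_coords h y"
proof -
  interpret h: unital_ring_map h by fact
  have "h (poly_eval (case_sum x y) (witt_prod G \<Omega> T)) =
      poly_eval (case_sum (map_coords h x) (map_coords h y)) (witt_prod G \<Omega> T)"
    if T: "T \<in> frame G \<Omega>" for T
  proof -
    obtain H where H: "H \<in> opens" "T = {H}" using T by (rule frameE)
    have "(\<lambda>v. h (case_sum x y v)) = case_sum (\<lambda>U. h (x U)) (\<lambda>U. h (y U))"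
      by (auto simp: fun_eq_iff split: sum.splits)
    then have "h (poly_eval (case_sum x y) (witt_prod G \<Omega> T)) =
        poly_eval (case_sum (\<lambda>U. h (x U)) (\<lambda>U. h (y U))) (witt_prod G \<Omega> T)"
      by (simp add: h.map_poly_eval)
    also have "\<dots> = poly_eval (case_sum (map_coords h x) (map_coords h y)) (witt_prod G \<Omega> T)"
      unfolding H(2) by (rule witt_prod_local[OF _ H(1)])
        (auto simp: map_coords_def overgroups_def frame_eq)
    finally show ?thesis .
  qed
  then show ?thesis
    by (auto simp: witt_ring_mult map_coords_def fun_eq_iff restrict_def)
qed

lemma map_coords_zero:
  assumes "unital_ring_map h"
  shows "map_coords h (\<zero>\<^bsub>witt_burnside_ring G \<Omega>\<^esub>) = \<zero>\<^bsub>witt_burnside_ring G \<Omega>\<^esub>"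
  using unital_ring_map.map_zero[OF assms]
  by (simp add: map_coords_def witt_ring_zero cong: restrict_cong)

lemma map_coords_one:
  assumes "unital_ring_map h"
  shows "map_coords h (\<one>\<^bsub>witt_burnside_ring G \<Omega>\<^esub>) = \<one>\<^bsub>witt_burnside_ring G \<Omega>\<^esub>"
  using unital_ring_map.map_zero[OF assms] unital_ring_map.map_one[OF assms]
  by (auto simp: map_coords_def witt_ring_one fun_eq_iff)

text \<open>
  Any three Witt vectors are the image of three vectors of indeterminates, so that an identity
  between ring operations need only be checked for the latter, by means of ghost components.
\<close>

lemma universal_witt_vectors:
  fixes a b c :: "'a set set \<Rightarrow> 'r::comm_ring_1"
  assumes "a \<in> frame G \<Omega> \<rightarrow>\<^sub>E UNIV" "b \<in> frame G \<Omega> \<rightarrow>\<^sub>E UNIV" "c \<in> frame G \<Omega> \<rightarrow>\<^sub>E UNIV"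
  obtains h :: "(nat \<times> 'a set set) intpoly \<Rightarrow> 'r" and x y z
  where "unital_ring_map h" "map_coords h x = a" "map_coords h y = b" "map_coords h z = c"
    "x \<in> extensional (frame G \<Omega>)" "y \<in> extensional (frame G \<Omega>)" "z \<in> extensional (frame G \<Omega>)"
proof -
  define h where "h = poly_eval (\<lambda>(i, U). if i = (0::nat) then a U else if i = 1 then b U else c U)"
  define u where "u i = (\<lambda>U\<in>frame G \<Omega>. indet (i, U))" for i :: nat
  have "unital_ring_map h" unfolding h_def by (rule poly_eval.unital_ring_map_axioms)
  moreover have "map_coords h (u 0) = a" "map_coords h (u 1) = b" "map_coords h (u 2) = c"
    using assms by (auto simp: map_coords_def h_def u_def fun_eq_iff PiE_def extensional_def)
  moreover have "u i \<in> extensional (frame G \<Omega>)" for i by (simp add: u_def)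
  ultimately show thesis using that by blast
qed

lemma add_extensional: "x \<oplus>\<^bsub>witt_burnside_ring G \<Omega>\<^esub> y \<in> extensional (frame G \<Omega>)"
  by (simp add: witt_ring_add)

lemma mult_extensional: "x \<otimes>\<^bsub>witt_burnside_ring G \<Omega>\<^esub> y \<in> extensional (frame G \<Omega>)"
  by (simp add: witt_ring_mult)

lemma zero_extensional: "\<zero>\<^bsub>witt_burnside_ring G \<Omega>\<^esub> \<in> extensional (frame G \<Omega>)"
  by (simp add: witt_ring_zero)

lemmas op_extensional = add_extensional mult_extensional zero_extensional

lemmas witt_of_op = witt_of_add witt_of_mult witt_of_zero witt_of_one

lemmas map_coords_op = map_coords_add map_coords_mult map_coords_zero map_coords_one

theorem witt_burnside_cring: "cring (witt_burnside_ring G \<Omega> :: ('a set set \<Rightarrow> 'r::comm_ring_1) ring)"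
proof -
  let ?W = "witt_burnside_ring G \<Omega> :: ('a set set \<Rightarrow> 'r) ring"
  let ?V = "witt_burnside_ring G \<Omega> :: ('a set set \<Rightarrow> (nat \<times> 'a set set) intpoly) ring"
  note [simp] = witt_of_op
  have closed: "x \<in> extensional (frame G \<Omega>) \<Longrightarrow> x \<in> carrier ?W" for x
    by (simp add: PiE_def)
  have ops_closed: "x \<oplus>\<^bsub>?W\<^esub> y \<in> carrier ?W" "x \<otimes>\<^bsub>?W\<^esub> y \<in> carrier ?W"
    "\<zero>\<^bsub>?W\<^esub> \<in> carrier ?W" "\<one>\<^bsub>?W\<^esub> \<in> carrier ?W" for x y
    by (simp_all add: witt_ring_add witt_ring_mult witt_ring_zero witt_ring_one)
  have laws: "(a \<oplus>\<^bsub>?W\<^esub> b) \<oplus>\<^bsub>?W\<^esub> c = a \<oplus>\<^bsub>?W\<^esub> (b \<oplus>\<^bsub>?W\<^esub> c)"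
    "a \<oplus>\<^bsub>?W\<^esub> b = b \<oplus>\<^bsub>?W\<^esub> a"
    "\<zero>\<^bsub>?W\<^esub> \<oplus>\<^bsub>?W\<^esub> a = a"
    "(a \<otimes>\<^bsub>?W\<^esub> b) \<otimes>\<^bsub>?W\<^esub> c = a \<otimes>\<^bsub>?W\<^esub> (b \<otimes>\<^bsub>?W\<^esub> c)"
    "a \<otimes>\<^bsub>?W\<^esub> b = b \<otimes>\<^bsub>?W\<^esub> a"
    "\<one>\<^bsub>?W\<^esub> \<otimes>\<^bsub>?W\<^esub> a = a"
    "(a \<oplus>\<^bsub>?W\<^esub> b) \<otimes>\<^bsub>?W\<^esub> c = (a \<otimes>\<^bsub>?W\<^esub> c) \<oplus>\<^bsub>?W\<^esub> (b \<otimes>\<^bsub>?W\<^esub> c)"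
    "\<exists>n\<in>carrier ?W. n \<oplus>\<^bsub>?W\<^esub> a = \<zero>\<^bsub>?W\<^esub>"
    if abc: "a \<in> carrier ?W" "b \<in> carrier ?W" "c \<in> carrier ?W" for a b c
  proof -
    obtain h and x y z :: "'a set set \<Rightarrow> (nat \<times> 'a set set) intpoly"
      where h: "unital_ring_map h" and m: "map_coords h x = a" "map_coords h y = b" "map_coords h z = c"
        and ext: "x \<in> extensional (frame G \<Omega>)" "y \<in> extensional (frame G \<Omega>)"
          "z \<in> extensional (frame G \<Omega>)"
      using abc by (auto intro: universal_witt_vectors[of a b c])
    note apply_h = arg_cong[of _ _ "map_coords h"]
    have "(x \<oplus>\<^bsub>?V\<^esub> y) \<oplus>\<^bsub>?V\<^esub> z = x \<oplus>\<^bsub>?V\<^esub> (y \<oplus>\<^bsub>?V\<^esub> z)"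
      by (rule witt_inj) (simp_all add: ext op_extensional add.assoc)
    from apply_h[OF this] show "(a \<oplus>\<^bsub>?W\<^esub> b) \<oplus>\<^bsub>?W\<^esub> c = a \<oplus>\<^bsub>?W\<^esub> (b \<oplus>\<^bsub>?W\<^esub> c)"
      by (simp only: map_coords_op[OF h] m)
    have "x \<oplus>\<^bsub>?V\<^esub> y = y \<oplus>\<^bsub>?V\<^esub> x"
      by (rule witt_inj) (simp_all add: ext op_extensional add.commute)
    from apply_h[OF this] show "a \<oplus>\<^bsub>?W\<^esub> b = b \<oplus>\<^bsub>?W\<^esub> a"
      by (simp only: map_coords_op[OF h] m)
    have "\<zero>\<^bsub>?V\<^esub> \<oplus>\<^bsub>?V\<^esub> x = x"
      by (rule witt_inj) (simp_all add: ext op_extensional)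
    from apply_h[OF this] show "\<zero>\<^bsub>?W\<^esub> \<oplus>\<^bsub>?W\<^esub> a = a"
      by (simp only: map_coords_op[OF h] m)
    have "(x \<otimes>\<^bsub>?V\<^esub> y) \<otimes>\<^bsub>?V\<^esub> z = x \<otimes>\<^bsub>?V\<^esub> (y \<otimes>\<^bsub>?V\<^esub> z)"
      by (rule witt_inj) (simp_all add: ext op_extensional mult.assoc)
    from apply_h[OF this] show "(a \<otimes>\<^bsub>?W\<^esub> b) \<otimes>\<^bsub>?W\<^esub> c = a \<otimes>\<^bsub>?W\<^esub> (b \<otimes>\<^bsub>?W\<^esub> c)"
      by (simp only: map_coords_op[OF h] m)
    have "x \<otimes>\<^bsub>?V\<^esub> y = y \<otimes>\<^bsub>?V\<^esub> x"
      by (rule witt_inj) (simp_all add: ext op_extensional mult.commute)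
    from apply_h[OF this] show "a \<otimes>\<^bsub>?W\<^esub> b = b \<otimes>\<^bsub>?W\<^esub> a"
      by (simp only: map_coords_op[OF h] m)
    have "\<one>\<^bsub>?V\<^esub> \<otimes>\<^bsub>?V\<^esub> x = x"
      by (rule witt_inj) (simp_all add: ext op_extensional)
    from apply_h[OF this] show "\<one>\<^bsub>?W\<^esub> \<otimes>\<^bsub>?W\<^esub> a = a"
      by (simp only: map_coords_op[OF h] m)
    have "(x \<oplus>\<^bsub>?V\<^esub> y) \<otimes>\<^bsub>?V\<^esub> z = (x \<otimes>\<^bsub>?V\<^esub> z) \<oplus>\<^bsub>?V\<^esub> (y \<otimes>\<^bsub>?V\<^esub> z)"
      by (rule witt_inj) (simp_all add: ext op_extensional distrib_right)
    from apply_h[OF this] show "(a \<oplus>\<^bsub>?W\<^esub> b) \<otimes>\<^bsub>?W\<^esub> c = (a \<otimes>\<^bsub>?W\<^esub> c) \<oplus>\<^bsub>?W\<^esub> (b \<otimes>\<^bsub>?W\<^esub> c)"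
      by (simp only: map_coords_op[OF h] m)
    obtain s where s: "\<And>H. H \<in> opens \<Longrightarrow> ghost s H = - ghost (\<lambda>K. x {K}) H"
      using ghost_uminus_exists[of "\<lambda>K. x {K}"] by blast
    define n where "n = (\<lambda>T\<in>frame G \<Omega>. s (the_elem T))"
    have n: "witt G \<Omega> T n = - witt G \<Omega> T x" if T: "T \<in> frame G \<Omega>" for T
    proof -
      obtain H where H: "H \<in> opens" "T = {H}" using T by (rule frameE)
      have "ghost (\<lambda>K. n {K}) H = ghost s H"
        by (rule ghost_cong) (auto simp: n_def overgroups_def frame_eq)
      then show ?thesis using H s[OF H(1)] by (simp add: witt_eq_ghost)
    qed
    have "n \<oplus>\<^bsub>?V\<^esub> x = \<zero>\<^bsub>?V\<^esub>"
      by (rule witt_inj) (simp_all add: op_extensional n)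
    from apply_h[OF this] have "map_coords h n \<oplus>\<^bsub>?W\<^esub> a = \<zero>\<^bsub>?W\<^esub>"
      by (simp only: map_coords_op[OF h] m)
    moreover have "map_coords h n \<in> carrier ?W"
      by (intro closed) (simp add: map_coords_def)
    ultimately show "\<exists>n\<in>carrier ?W. n \<oplus>\<^bsub>?W\<^esub> a = \<zero>\<^bsub>?W\<^esub>" by blast
  qed
  show ?thesis
  proof (rule cringI)
    show "abelian_group ?W"
      by (rule abelian_groupI) (assumption | rule laws ops_closed)+
    show "comm_monoid ?W"
      by (rule comm_monoidI) (assumption | rule laws ops_closed)+
    show "(a \<oplus>\<^bsub>?W\<^esub> b) \<otimes>\<^bsub>?W\<^esub> c = (a \<otimes>\<^bsub>?W\<^esub> c) \<oplus>\<^bsub>?W\<^esub> (b \<otimes>\<^bsub>?W\<^esub> c)"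
      if "a \<in> carrier ?W" "b \<in> carrier ?W" "c \<in> carrier ?W" for a b c
      by (rule laws(7)[OF that])
  qed
qed

end

section \<open>Leading coordinates of products of p-typical Witt vectors\<close>

definition p_witt :: "nat \<Rightarrow> (nat \<Rightarrow> 'r) \<Rightarrow> nat \<Rightarrow> 'r::comm_ring_1"
  where "p_witt p x n = (\<Sum>s\<le>n. of_nat (p ^ s) * x s ^ (p ^ (n - s)))"

lemma of_nat_power_dvd_le: "a \<le> b \<Longrightarrow> (of_nat (p ^ a) :: 'r::comm_ring_1) dvd of_nat (p ^ b)"
  by (simp add: le_imp_power_dvd)

lemma p_witt_dvd:
  assumes "p > 0" and x: "\<And>s. s < i \<Longrightarrow> x s = 0"
  shows "of_nat (p ^ i) dvd p_witt p x n"
  unfolding p_witt_def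
proof (rule dvd_sum)
  fix s
  show "of_nat (p ^ i) dvd of_nat (p ^ s) * x s ^ (p ^ (n - s))"
  proof (cases "s < i")
    case True
    then show ?thesis using x \<open>p > 0\<close> by (simp add: zero_power)
  next
    case False
    then show ?thesis by (intro dvd_mult2 of_nat_power_dvd_le) simp
  qed
qed

lemma p_witt_leading_term:
  assumes "p > 0" and x: "\<And>s. s < i \<Longrightarrow> x s = 0"
  shows "of_nat (p ^ Suc i) dvd p_witt p x (i + m) - of_nat (p ^ i) * x i ^ (p ^ m)"
proof -
  have "p_witt p x (i + m) - of_nat (p ^ i) * x i ^ (p ^ m) =
      (\<Sum>s\<in>{..i + m} - {i}. of_nat (p ^ s) * x s ^ (p ^ (i + m - s)))"
    unfolding p_witt_def by (subst sum.remove[of _ i]) auto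
  also have "of_nat (p ^ Suc i) dvd \<dots>"
  proof (rule dvd_sum)
    fix s assume s: "s \<in> {..i + m} - {i}"
    show "of_nat (p ^ Suc i) dvd of_nat (p ^ s) * x s ^ (p ^ (i + m - s))"
    proof (cases "s < i")
      case True
      then show ?thesis using x \<open>p > 0\<close> by (simp add: zero_power)
    next
      case False
      with s show ?thesis by (intro dvd_mult2 of_nat_power_dvd_le) simp
    qed
  qed
  finally show ?thesis .
qed

lemma of_nat_power_dvd_term:
  fixes a :: "'r::comm_ring_1"
  assumes "of_nat (p ^ k) dvd a" "c \<le> m + k * p ^ n"
  shows "of_nat (p ^ c) dvd of_nat (p ^ m) * a ^ (p ^ n)"
proof -
  have "of_nat (p ^ k) ^ (p ^ n) dvd a ^ (p ^ n)"
    using assms(1) by (rule dvd_power_same)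
  then have "of_nat (p ^ m) * of_nat (p ^ k) ^ (p ^ n) dvd of_nat (p ^ m) * a ^ (p ^ n)"
    by (rule mult_dvd_mono[OF dvd_refl])
  moreover have "(of_nat (p ^ m) * of_nat (p ^ k) ^ (p ^ n) :: 'r) = of_nat (p ^ (m + k * p ^ n))"
    by (simp add: power_add power_mult)
  ultimately show ?thesis
    using of_nat_power_dvd_le[OF assms(2), of p] by (metis dvd_trans)
qed

text \<open>
  If the coordinates of \<open>x\<close> before \<open>i\<close> and those of \<open>y\<close> before \<open>j\<close> vanish, then the product of
  the ghost components is divisible by \<open>p\<^bsup>i+j\<^esup>\<close>. This forces the \<open>n\<close>-th coordinate of the product
  to be divisible by \<open>p\<^bsup>i+j-n\<^esup>\<close>, and modulo \<open>p\<close> its coordinate \<open>i + j\<close> is the product of the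
  leading coordinates, raised to powers of \<open>p\<close>. In characteristic \<open>p\<close> this is the leading term of
  the identity \<open>V\<^sup>i a * V\<^sup>j b = V\<^bsup>i+j\<^esup> (F\<^sup>j a * F\<^sup>i b)\<close>.
\<close>

lemma p_witt_mult_leading:
  fixes x y M :: "nat \<Rightarrow> 'v intpoly"
  assumes p: "p > 1" and M: "\<And>n. p_witt p M n = p_witt p x n * p_witt p y n"
    and x: "\<And>s. s < i \<Longrightarrow> x s = 0" and y: "\<And>s. s < j \<Longrightarrow> y s = 0"
  shows "of_nat p dvd M (i + j) - x i ^ (p ^ j) * y j ^ (p ^ i)"
proof -
  have p0: "p > 0" using p by simp
  have last: "of_nat (p ^ n) * M n =
      p_witt p M n - (\<Sum>m<n. of_nat (p ^ m) * M m ^ (p ^ (n - m)))" for n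
    unfolding p_witt_def by (simp add: lessThan_Suc_atMost[symmetric])
  have dvd_witt: "of_nat (p ^ (i + j)) dvd p_witt p M n" for n
    using mult_dvd_mono[OF p_witt_dvd[OF p0 x, where n = n] p_witt_dvd[OF p0 y, where n = n]]
    unfolding M power_add of_nat_mult by simp
  have low: "of_nat (p ^ (i + j - n)) dvd M n" if "n \<le> i + j" for n
    using that
  proof (induction n rule: less_induct)
    case (less n)
    have "of_nat (p ^ (i + j)) dvd of_nat (p ^ m) * M m ^ (p ^ (n - m))" if "m < n" for m
    proof (rule of_nat_power_dvd_term)
      show "of_nat (p ^ (i + j - m)) dvd M m" using less that by simp
      have "i + j - m \<le> (i + j - m) * p ^ (n - m)" using p0 by simp
      then show "i + j \<le> m + (i + j - m) * p ^ (n - m)" using less.prems that by linarith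
    qed
    then have "of_nat (p ^ (i + j)) dvd of_nat (p ^ n) * M n"
      unfolding last by (intro dvd_diff dvd_witt dvd_sum) auto
    moreover have "p ^ (i + j) = p ^ n * p ^ (i + j - n)"
      using less.prems by (simp flip: power_add)
    ultimately show ?case
      using intpoly_of_nat_dvd_cancel[of "p ^ n" "p ^ (i + j - n)" "M n"] p0 by simp
  qed
  let ?N = "i + j"
  let ?lead = "x i ^ (p ^ j) * y j ^ (p ^ i)"
  have 1: "of_nat (p ^ Suc ?N) dvd of_nat (p ^ m) * M m ^ (p ^ (?N - m))" if m: "m < ?N" for m
  proof (rule of_nat_power_dvd_term[OF low])
    have "2 \<le> p ^ (?N - m)"
      using one_less_power[OF p, of "?N - m"] m by simp
    then have "(?N - m) * 2 \<le> (?N - m) * p ^ (?N - m)" by (rule mult_le_mono2)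
    then show "Suc ?N \<le> m + (?N - m) * p ^ (?N - m)" using m by linarith
  qed (use m in simp)
  have 2: "of_nat (p ^ Suc ?N) dvd p_witt p M ?N - of_nat (p ^ ?N) * ?lead"
  proof -
    define A B where "A = p_witt p x ?N" and "B = p_witt p y ?N"
    have A: "of_nat (p ^ Suc i) dvd A - of_nat (p ^ i) * x i ^ (p ^ j)"
      unfolding A_def by (rule p_witt_leading_term[OF p0 x])
    have B: "of_nat (p ^ Suc j) dvd B - of_nat (p ^ j) * y j ^ (p ^ i)"
      unfolding B_def add.commute[of i j] by (rule p_witt_leading_term[OF p0 y])
    have "of_nat (p ^ Suc i) * of_nat (p ^ j) dvd (A - of_nat (p ^ i) * x i ^ (p ^ j)) * B"
      unfolding B_def by (intro mult_dvd_mono A p_witt_dvd p0 y)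
    moreover have "of_nat (p ^ i) * of_nat (p ^ Suc j) dvd
        (of_nat (p ^ i) * x i ^ (p ^ j)) * (B - of_nat (p ^ j) * y j ^ (p ^ i))"
      by (intro mult_dvd_mono B dvd_triv_left)
    moreover have "(of_nat (p ^ Suc i) * of_nat (p ^ j) :: 'v intpoly) = of_nat (p ^ Suc ?N)"
      "(of_nat (p ^ i) * of_nat (p ^ Suc j) :: 'v intpoly) = of_nat (p ^ Suc ?N)"
      by (simp_all add: power_add algebra_simps)
    ultimately have "of_nat (p ^ Suc ?N) dvd (A - of_nat (p ^ i) * x i ^ (p ^ j)) * B +
        (of_nat (p ^ i) * x i ^ (p ^ j)) * (B - of_nat (p ^ j) * y j ^ (p ^ i))"
      by (simp only: dvd_add)
    also have "\<dots> = p_witt p M ?N - of_nat (p ^ ?N) * ?lead"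
      unfolding M A_def[symmetric] B_def[symmetric] by (simp add: algebra_simps power_add)
    finally show ?thesis .
  qed
  have "of_nat (p ^ Suc ?N) dvd (p_witt p M ?N - of_nat (p ^ ?N) * ?lead) -
      (\<Sum>m<?N. of_nat (p ^ m) * M m ^ (p ^ (?N - m)))"
    using 1 by (intro dvd_diff 2 dvd_sum) auto
  also have "\<dots> = of_nat (p ^ ?N) * (M ?N - ?lead)"
    using last[of ?N] by (simp add: right_diff_distrib)
  finally have "of_nat (p ^ ?N * p) dvd of_nat (p ^ ?N) * (M ?N - ?lead)"
    by (simp add: mult.commute)
  then show ?thesis
    by (rule intpoly_of_nat_dvd_cancel) (simp add: p0)
qed

context abelian_pro_p
begin

lemma add_vanish:
  assumes H: "H \<in> opens" and "\<And>K. K \<in> overgroups H \<Longrightarrow> a {K} = 0"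
    and "\<And>K. K \<in> overgroups H \<Longrightarrow> b {K} = 0"
  shows "(a \<oplus>\<^bsub>witt_burnside_ring G \<Omega>\<^esub> b) {H} = 0"
proof -
  let ?W = "witt_burnside_ring G \<Omega> :: ('a set set \<Rightarrow> 'c) ring"
  interpret W: cring ?W by (rule witt_burnside_cring)
  have T: "{H} \<in> frame G \<Omega>" using H by (simp add: frame_eq)
  have "(a \<oplus>\<^bsub>?W\<^esub> b) {H} = (\<zero>\<^bsub>?W\<^esub> \<oplus>\<^bsub>?W\<^esub> \<zero>\<^bsub>?W\<^esub>) {H}"
    using T assms by (auto simp: witt_ring_add witt_ring_zero overgroups_def frame_eq
        intro!: witt_sum_local)
  also have "\<dots> = \<zero>\<^bsub>?W\<^esub> {H}" by (simp only: W.l_zero[OF W.zero_closed])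
  also have "\<dots> = 0" using T by (simp add: witt_ring_zero)
  finally show ?thesis .
qed

lemma mult_vanish:
  assumes H: "H \<in> opens" and "\<And>K. K \<in> overgroups H \<Longrightarrow> a {K} = 0"
    and b: "b \<in> carrier (witt_burnside_ring G \<Omega>)"
  shows "(a \<otimes>\<^bsub>witt_burnside_ring G \<Omega>\<^esub> b) {H} = 0"
proof -
  let ?W = "witt_burnside_ring G \<Omega> :: ('a set set \<Rightarrow> 'c) ring"
  interpret W: cring ?W by (rule witt_burnside_cring)
  have T: "{H} \<in> frame G \<Omega>" using H by (simp add: frame_eq)
  have "(a \<otimes>\<^bsub>?W\<^esub> b) {H} = (\<zero>\<^bsub>?W\<^esub> \<otimes>\<^bsub>?W\<^esub> b) {H}"
    using T assms by (auto simp: witt_ring_mult witt_ring_zero overgroups_def frame_eq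
        intro!: witt_prod_local)
  also have "\<dots> = 0"
    using T W.l_null[OF b] by (simp add: witt_ring_zero)
  finally show ?thesis .
qed

text \<open>
  A chain of open subgroups that exhausts the overgroups of each of its members corresponds to a
  quotient \<open>\<int>\<^sub>p\<close> of the group, and restriction to the chain to the map onto its Witt vectors.
\<close>

definition cyclic_chain :: "(nat \<Rightarrow> 'a set) \<Rightarrow> bool"
  where "cyclic_chain h \<longleftrightarrow>
    (\<forall>n. h n \<in> opens \<and> index_exp (h n) = n \<and> overgroups (h n) = h ` {..n})"

lemma ghost_chain:
  assumes h: "cyclic_chain h"
  shows "ghost x (h n) = p_witt p (\<lambda>s. x (h s)) n"
proof -
  have "inj_on h {..n}"
    using h by (intro inj_on_inverseI[of _ index_exp]) (auto simp: cyclic_chain_def)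
  then show ?thesis
    using h by (simp add: ghost_def p_witt_def cyclic_chain_def sum.reindex)
qed

text \<open>
  It suffices to compare vectors of indeterminates in which the coordinates of the chain before
  \<open>i\<close> and \<open>j\<close> are replaced by zero, and to specialize the congruence modulo \<open>p\<close> between them.
\<close>

lemma chain_mult_leading:
  fixes a b :: "'a set set \<Rightarrow> 'c::comm_ring_1"
  assumes h: "cyclic_chain h" and char: "of_nat p = (0::'c)"
    and a: "\<And>s. s < i \<Longrightarrow> a {h s} = 0" and b: "\<And>s. s < j \<Longrightarrow> b {h s} = 0"
  shows "(a \<otimes>\<^bsub>witt_burnside_ring G \<Omega>\<^esub> b) {h (i + j)} = a {h i} ^ (p ^ j) * b {h j} ^ (p ^ i)"
proof -
  have h_open: "h n \<in> opens" and h_index: "index_exp (h n) = n" for n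
    using h by (auto simp: cyclic_chain_def)
  have T: "{h n} \<in> frame G \<Omega>" for n using h_open by (simp add: frame_eq)
  define x :: "'a set set \<Rightarrow> ('a set set + 'a set set) intpoly"
    where "x U = (if U \<in> (\<lambda>s. {h s}) ` {..<i} then 0 else indet (Inl U))" for U
  define y :: "'a set set \<Rightarrow> ('a set set + 'a set set) intpoly"
    where "y U = (if U \<in> (\<lambda>s. {h s}) ` {..<j} then 0 else indet (Inr U))" for U
  define M where "M n = poly_eval (case_sum x y) (witt_prod G \<Omega> {h n})" for n
  define e where "e = poly_eval (case_sum a b)"
  interpret e: unital_ring_map e unfolding e_def by (rule poly_eval.unital_ring_map_axioms)
  have ex: "e (x U) = a U" and ey: "e (y U) = b U" for U
    using a b by (auto simp: x_def y_def e_def)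
  have "of_nat p dvd M (i + j) - x {h i} ^ (p ^ j) * y {h j} ^ (p ^ i)"
  proof (rule p_witt_mult_leading[OF p_gt_1])
    fix n
    show "p_witt p M n = p_witt p (\<lambda>s. x {h s}) n * p_witt p (\<lambda>s. y {h s}) n"
      using witt_poly_eval_prod[OF T, of n x y]
      by (simp add: witt_eq_ghost[OF h_open] ghost_chain[OF h] M_def[abs_def])
  qed (auto simp: x_def y_def)
  from e.map_dvd[OF this] have "e (M (i + j)) = a {h i} ^ (p ^ j) * b {h j} ^ (p ^ i)"
    by (simp add: e.map_of_nat char e.map_diff e.map_mult e.map_power ex ey)
  moreover have "(\<lambda>v. e (case_sum x y v)) = case_sum a b"
    using ex ey by (auto simp: fun_eq_iff split: sum.splits)
  then have "e (M (i + j)) = poly_eval (case_sum a b) (witt_prod G \<Omega> {h (i + j)})"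
    by (simp add: M_def e.map_poly_eval)
  ultimately show ?thesis using T by (simp add: witt_ring_mult)
qed

end

section \<open>Prime ideals given by growth along an ultrafilter\<close>

text \<open>By Zorn's lemma there is a minimal proper filter below \<open>sequentially\<close>.\<close>

lemma free_ultrafilter_exists:
  "\<exists>F :: nat filter. F \<noteq> bot \<and> F \<le> sequentially \<and>
    (\<forall>P. eventually P F \<or> eventually (\<lambda>n. \<not> P n) F)"
proof -
  define A where "A = {F :: nat filter. F \<noteq> bot \<and> F \<le> sequentially}"
  have "\<exists>m\<in>A. \<forall>F\<in>A. F \<le> m \<longrightarrow> F = m"
  proof (rule predicate_Zorn[of A "\<lambda>F G. G \<le> F"])
    show "partial_order_on A (relation_of (\<lambda>F G. G \<le> F) A)"
      by (rule partial_order_on_relation_ofI) (rule order_refl, erule (1) order_trans, simp)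
    fix C assume C: "C \<in> Chains (relation_of (\<lambda>F G. G \<le> F) A)"
    then have CA: "C \<subseteq> A" and tot: "\<And>F G. F \<in> C \<Longrightarrow> G \<in> C \<Longrightarrow> F \<le> G \<or> G \<le> F"
      by (auto simp: Chains_def relation_of_def)
    show "\<exists>u\<in>A. \<forall>a\<in>C. u \<le> a"
    proof (cases "C = {}")
      case True
      moreover have "sequentially \<in> A" by (simp add: A_def)
      ultimately show ?thesis by blast
    next
      case False
      have ev: "eventually P (Inf C) \<longleftrightarrow> (\<exists>F\<in>C. eventually P F)" for P
      proof (rule eventually_Inf_base[OF False])
        fix F G assume FG: "F \<in> C" "G \<in> C"
        from tot[OF FG] show "\<exists>x\<in>C. x \<le> inf F G"
        proof
          assume "F \<le> G"
          with FG(1) show ?thesis by (intro bexI[of _ F]) simp_all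
        next
          assume "G \<le> F"
          with FG(2) show ?thesis by (intro bexI[of _ G]) simp_all
        qed
      qed
      have "Inf C \<noteq> bot"
        using CA ev[of "\<lambda>_. False"] by (auto simp: trivial_limit_def A_def)
      moreover have "Inf C \<le> sequentially"
        using False CA by (auto simp: A_def intro: Inf_lower2)
      ultimately show ?thesis by (auto simp: A_def intro: Inf_lower)
    qed
  qed
  then obtain F where F: "F \<in> A" and min: "\<And>F'. F' \<in> A \<Longrightarrow> F' \<le> F \<Longrightarrow> F' = F" by blast
  have "eventually P F" if "\<not> eventually (\<lambda>n. \<not> P n) F" for P
  proof -
    let ?F = "inf F (principal {n. P n})"
    have "?F \<noteq> bot"
      using that by (auto simp: trivial_limit_def eventually_inf_principal)
    moreover have "?F \<le> sequentially" using F by (simp add: A_def le_infI1)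
    ultimately have "?F = F" by (intro min) (simp_all add: A_def)
    moreover have "eventually P ?F" by (simp add: eventually_inf_principal)
    ultimately show ?thesis by simp
  qed
  then show ?thesis using F by (auto simp: A_def)
qed

context abelian_pro_p
begin

text \<open>
  Along the filter, the order of vanishing of \<open>f\<close> on the \<open>n\<close>-th chain exceeds every multiple of
  \<open>g n\<close>. The quantifier over \<open>C\<close> is outside of the filter, so that the bound from which it
  holds may depend on \<open>C\<close>.
\<close>

definition growth_ideal ::
  "nat filter \<Rightarrow> (nat \<Rightarrow> nat \<Rightarrow> 'a set) \<Rightarrow> (nat \<Rightarrow> nat) \<Rightarrow> ('a set set \<Rightarrow> 'c::comm_ring_1) set"
  where "growth_ideal F h g = {f \<in> carrier (witt_burnside_ring G \<Omega>).
    \<forall>C. eventually (\<lambda>n. \<forall>s < C * g n. f {h n s} = 0) F}"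

lemma chain_overgroups_vanish:
  assumes "cyclic_chain h" "\<And>s. s < m \<Longrightarrow> f {h s} = 0" "s < m" "K \<in> overgroups (h s)"
  shows "f {K} = 0"
  using assms by (auto simp: cyclic_chain_def)

text \<open>
  The order of vanishing on a chain is additive under multiplication, by \<open>chain_mult_leading\<close>.
  The ultrafilter turns ``not eventually large'' into ``eventually small'', which can be applied
  to both factors at once.
\<close>

lemma growth_ideal_prime:
  fixes h :: "nat \<Rightarrow> nat \<Rightarrow> 'a set"
  assumes char: "of_nat p = (0::'c::idom)" and h: "\<And>n. cyclic_chain (h n)"
    and g: "\<And>n. g n > 0" and F: "F \<noteq> bot"
    and ultra: "\<And>P. eventually P F \<or> eventually (\<lambda>n. \<not> P n) F"
  shows "primeideal (growth_ideal F h g :: ('a set set \<Rightarrow> 'c) set) (witt_burnside_ring G \<Omega>)"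
proof -
  let ?W = "witt_burnside_ring G \<Omega> :: ('a set set \<Rightarrow> 'c) ring"
  let ?P = "growth_ideal F h g :: ('a set set \<Rightarrow> 'c) set"
  interpret W: cring ?W by (rule witt_burnside_cring)
  have h_open: "h n s \<in> opens" for n s using h by (simp add: cyclic_chain_def)
  have PI: "f \<in> ?P" if "f \<in> carrier ?W"
    "\<And>C. eventually (\<lambda>n. \<forall>s < C * g n. f {h n s} = 0) F" for f
    using that by (simp add: growth_ideal_def)
  have PD: "f \<in> carrier ?W" "eventually (\<lambda>n. \<forall>s < C * g n. f {h n s} = 0) F" if "f \<in> ?P" for f C
    using that by (simp_all add: growth_ideal_def)
  have mult: "f \<otimes>\<^bsub>?W\<^esub> r \<in> ?P" if f: "f \<in> ?P" and r: "r \<in> carrier ?W" for f r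
  proof (rule PI)
    show "f \<otimes>\<^bsub>?W\<^esub> r \<in> carrier ?W" using PD(1)[OF f] r by (rule W.m_closed)
    fix C
    show "eventually (\<lambda>n. \<forall>s < C * g n. (f \<otimes>\<^bsub>?W\<^esub> r) {h n s} = 0) F"
      using PD(2)[OF f, of C]
    proof eventually_elim
      case (elim n)
      show ?case
      proof (intro allI impI mult_vanish h_open r)
        fix s K assume "s < C * g n" "K \<in> overgroups (h n s)"
        then show "f {K} = 0" using chain_overgroups_vanish[OF h, of "C * g n" f n] elim by blast
      qed
    qed
  qed
  have add: "f \<oplus>\<^bsub>?W\<^esub> f' \<in> ?P" if f: "f \<in> ?P" and f': "f' \<in> ?P" for f f'
  proof (rule PI)
    show "f \<oplus>\<^bsub>?W\<^esub> f' \<in> carrier ?W" using PD(1)[OF f] PD(1)[OF f'] by (rule W.a_closed)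
    fix C
    show "eventually (\<lambda>n. \<forall>s < C * g n. (f \<oplus>\<^bsub>?W\<^esub> f') {h n s} = 0) F"
      using PD(2)[OF f, of C] PD(2)[OF f', of C]
    proof eventually_elim
      case (elim n)
      show ?case
      proof (intro allI impI add_vanish h_open)
        fix s K assume sK: "s < C * g n" "K \<in> overgroups (h n s)"
        show "f {K} = 0" using chain_overgroups_vanish[OF h, of "C * g n" f n] elim sK by blast
        show "f' {K} = 0" using chain_overgroups_vanish[OF h, of "C * g n" f' n] elim sK by blast
      qed
    qed
  qed
  have one: "\<one>\<^bsub>?W\<^esub> \<notin> ?P"
  proof
    assume "\<one>\<^bsub>?W\<^esub> \<in> ?P"
    from PD(2)[OF this, of 1] have "eventually (\<lambda>n. False) F"
    proof eventually_elim
      case (elim n)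
      have "\<one>\<^bsub>?W\<^esub> {h n 0} = (0::'c)" using elim g[of n] by simp
      moreover have "index_exp (h n 0) = 0" using h by (simp add: cyclic_chain_def)
      ultimately show ?case
        using h_open[of n 0] by (simp add: witt_ring_one class_size_singleton frame_eq)
    qed
    then show False using F by (simp add: trivial_limit_def)
  qed
  have zero: "\<zero>\<^bsub>?W\<^esub> \<in> ?P"
    using h_open by (intro PI W.zero_closed) (simp add: witt_ring_zero frame_eq)
  have prime: "f \<in> ?P \<or> f' \<in> ?P"
    if f: "f \<in> carrier ?W" and f': "f' \<in> carrier ?W" and ff': "f \<otimes>\<^bsub>?W\<^esub> f' \<in> ?P" for f f'
  proof (rule ccontr)
    assume *: "\<not> (f \<in> ?P \<or> f' \<in> ?P)"
    obtain C where "\<not> eventually (\<lambda>n. \<forall>s < C * g n. f {h n s} = 0) F"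
      using * PI[OF f] by blast
    then have C: "eventually (\<lambda>n. \<not> (\<forall>s < C * g n. f {h n s} = 0)) F"
      using ultra by blast
    obtain C' where "\<not> eventually (\<lambda>n. \<forall>s < C' * g n. f' {h n s} = 0) F"
      using * PI[OF f'] by blast
    then have C': "eventually (\<lambda>n. \<not> (\<forall>s < C' * g n. f' {h n s} = 0)) F"
      using ultra by blast
    have "eventually (\<lambda>n. False) F"
      using C C' PD(2)[OF ff', of "C + C'"]
    proof eventually_elim
      case (elim n)
      define i where "i = (LEAST s. f {h n s} \<noteq> 0)"
      define j where "j = (LEAST s. f' {h n s} \<noteq> 0)"
      from elim(1) obtain s where s: "s < C * g n" "f {h n s} \<noteq> 0" by blast
      from elim(2) obtain s' where s': "s' < C' * g n" "f' {h n s'} \<noteq> 0" by blast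
      have i: "f {h n i} \<noteq> 0" "i \<le> s" "\<And>t. t < i \<Longrightarrow> f {h n t} = 0"
        unfolding i_def using s(2) by (rule LeastI, rule Least_le) (blast dest: not_less_Least)
      have j: "f' {h n j} \<noteq> 0" "j \<le> s'" "\<And>t. t < j \<Longrightarrow> f' {h n t} = 0"
        unfolding j_def using s'(2) by (rule LeastI, rule Least_le) (blast dest: not_less_Least)
      have "i + j < (C + C') * g n" using i(2) j(2) s(1) s'(1) by (simp add: distrib_right)
      then have "(f \<otimes>\<^bsub>?W\<^esub> f') {h n (i + j)} = 0" using elim(3) by blast
      then show False
        using chain_mult_leading[OF h char, of i f n j f'] i j by simp
    qed
    then show False using F by (simp add: trivial_limit_def)
  qed
  show ?thesis
  proof (rule primeidealI)
    show "ideal ?P ?W"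
    proof (rule idealI)
      show "ring ?W" by (rule W.ring_axioms)
      show "subgroup ?P (add_monoid ?W)"
      proof
        show "?P \<subseteq> carrier (add_monoid ?W)" using PD(1) by auto
        show "f \<otimes>\<^bsub>add_monoid ?W\<^esub> f' \<in> ?P" if "f \<in> ?P" "f' \<in> ?P" for f f'
          using add[OF that] by simp
        show "\<one>\<^bsub>add_monoid ?W\<^esub> \<in> ?P" using zero by simp
        show "inv\<^bsub>add_monoid ?W\<^esub> f \<in> ?P" if f: "f \<in> ?P" for f
        proof -
          note fc = PD(1)[OF f]
          have "f \<otimes>\<^bsub>?W\<^esub> (\<ominus>\<^bsub>?W\<^esub> \<one>\<^bsub>?W\<^esub>) = \<ominus>\<^bsub>?W\<^esub> f"
            using W.r_minus[OF fc W.one_closed] W.r_one[OF fc] by simp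
          then show ?thesis
            using mult[OF f W.a_inv_closed[OF W.one_closed]] by (simp add: a_inv_def)
        qed
      qed
      show "r \<otimes>\<^bsub>?W\<^esub> f \<in> ?P" if "f \<in> ?P" "r \<in> carrier ?W" for f r
        using mult[OF that] W.m_comm[OF PD(1)[OF that(1)] that(2)] by simp
      show "f \<otimes>\<^bsub>?W\<^esub> r \<in> ?P" if "f \<in> ?P" "r \<in> carrier ?W" for f r
        using mult[OF that] .
    qed
    show "cring ?W" by (rule W.cring_axioms)
    show "carrier ?W \<noteq> ?P" using one W.one_closed by blast
    show "f \<in> ?P \<or> f' \<in> ?P"
      if "f \<in> carrier ?W" "f' \<in> carrier ?W" "f \<otimes>\<^bsub>?W\<^esub> f' \<in> ?P" for f f'
      using prime[OF that] .
  qed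
qed

text \<open>
  A vector in the difference has order exactly \<open>(n + 1)\<^bsup>j+1\<^esup>\<close> on the \<open>n\<close>-th chain, which is
  eventually larger than any fixed multiple of \<open>(n + 1)\<^sup>j\<close>. It exists because the chains are
  disjoint at these positions.
\<close>

lemma growth_ideal_strict:
  fixes h :: "nat \<Rightarrow> nat \<Rightarrow> 'a set"
  assumes h: "\<And>n. cyclic_chain (h n)" and sep: "\<And>n m s. h n s = h m s \<Longrightarrow> n = m \<or> s \<le> m"
    and F: "F \<noteq> bot" "F \<le> sequentially"
  shows "(growth_ideal F h (\<lambda>n. Suc n ^ Suc j) :: ('a set set \<Rightarrow> 'c::comm_ring_1) set) \<subset>
    growth_ideal F h (\<lambda>n. Suc n ^ j)"
proof
  show "(growth_ideal F h (\<lambda>n. Suc n ^ Suc j) :: ('a set set \<Rightarrow> 'c) set) \<subseteq>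
      growth_ideal F h (\<lambda>n. Suc n ^ j)"
  proof
    fix f :: "'a set set \<Rightarrow> 'c" assume f: "f \<in> growth_ideal F h (\<lambda>n. Suc n ^ Suc j)"
    have "eventually (\<lambda>n. \<forall>s < C * Suc n ^ j. f {h n s} = 0) F" for C
    proof -
      have "eventually (\<lambda>n. \<forall>s < C * Suc n ^ Suc j. f {h n s} = 0) F"
        using f by (simp add: growth_ideal_def)
      then show ?thesis
      proof eventually_elim
        case (elim n)
        have "C * Suc n ^ j \<le> C * Suc n ^ Suc j" by simp
        with elim show ?case by (meson less_le_trans)
      qed
    qed
    with f show "f \<in> growth_ideal F h (\<lambda>n. Suc n ^ j)" by (simp add: growth_ideal_def)
  qed
  have h_open: "h n s \<in> opens" and h_index: "index_exp (h n s) = s" for n s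
    using h by (auto simp: cyclic_chain_def)
  \<comment> \<open>These positions exceed the index of the chain, beyond which it meets no other chain.\<close>
  define e where "e n = Suc n ^ Suc j" for n
  have e_gt: "n < e n" for n
    unfolding e_def by (metis Suc_le_eq one_le_power power_Suc le_add1 mult.right_neutral
        mult_le_mono2 plus_1_eq_Suc)
  define f :: "'a set set \<Rightarrow> 'c"
    where "f = (\<lambda>T\<in>frame G \<Omega>. if \<exists>m. T = {h m (e m)} then 1 else 0)"
  have f: "f {h n s} = (if s = e n then 1 else 0)" for n s
  proof -
    have "n = m \<and> s = e m" if eq: "h n s = h m (e m)" for m
    proof -
      have s: "s = e m" using h_index eq by metis
      then have "n = m \<or> s \<le> m" using sep[of n s m] eq by simp
      then show ?thesis using s e_gt[of m] by auto
    qed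
    then have "(\<exists>m. {h n s} = {h m (e m)}) \<longleftrightarrow> s = e n" by auto
    then show ?thesis using h_open by (simp add: f_def frame_eq)
  qed
  have "f \<in> growth_ideal F h (\<lambda>n. Suc n ^ j)"
  proof -
    have "eventually (\<lambda>n. \<forall>s < C * Suc n ^ j. f {h n s} = 0) F" for C
    proof -
      have "eventually (\<lambda>n. C \<le> n) sequentially" by (rule eventually_ge_at_top)
      then have "eventually (\<lambda>n. C \<le> n) F" using F(2) filter_leD by blast
      then show ?thesis
      proof eventually_elim
        case (elim n)
        then have "C * Suc n ^ j \<le> e n" unfolding e_def by (simp del: mult_Suc)
        then show ?case by (auto simp: f)
      qed
    qed
    then show ?thesis by (simp add: growth_ideal_def f_def)
  qed
  moreover have "f \<notin> growth_ideal F h (\<lambda>n. Suc n ^ Suc j)"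
  proof
    assume "f \<in> growth_ideal F h (\<lambda>n. Suc n ^ Suc j)"
    then have "eventually (\<lambda>n. \<forall>s < 2 * e n. f {h n s} = 0) F"
      unfolding growth_ideal_def e_def by blast
    then have "eventually (\<lambda>n. False) F"
    proof eventually_elim
      case (elim n)
      have "e n < 2 * e n" using e_gt[of n] by linarith
      then show ?case using elim f[of n "e n"] by auto
    qed
    then show False using F(1) by (simp add: trivial_limit_def)
  qed
  ultimately show "(growth_ideal F h (\<lambda>n. Suc n ^ Suc j) :: ('a set set \<Rightarrow> 'c) set) \<noteq>
      growth_ideal F h (\<lambda>n. Suc n ^ j)" by blast
qed

theorem krull_dim_infinite:
  fixes h :: "nat \<Rightarrow> nat \<Rightarrow> 'a set"
  assumes char: "of_nat p = (0::'c::idom)" and h: "\<And>n. cyclic_chain (h n)"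
    and sep: "\<And>n m s. h n s = h m s \<Longrightarrow> n = m \<or> s \<le> m"
  shows "krull_dim (witt_burnside_ring G \<Omega> :: ('a set set \<Rightarrow> 'c) ring) = \<infinity>"
proof -
  let ?W = "witt_burnside_ring G \<Omega> :: ('a set set \<Rightarrow> 'c) ring"
  obtain F :: "nat filter" where F: "F \<noteq> bot" "F \<le> sequentially"
    and ultra: "\<And>P. eventually P F \<or> eventually (\<lambda>n. \<not> P n) F"
    using free_ultrafilter_exists by blast
  define Q :: "nat \<Rightarrow> ('a set set \<Rightarrow> 'c) set" where "Q j = growth_ideal F h (\<lambda>n. Suc n ^ j)" for j
  have prime: "primeideal (Q j) ?W" for j
    unfolding Q_def by (rule growth_ideal_prime[OF char h _ F(1) ultra]) simp
  have strict: "Q (Suc j) \<subset> Q j" for j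
    unfolding Q_def by (rule growth_ideal_strict[OF h sep F])
  have "N \<in> {n. \<exists>P. (\<forall>i\<le>n. primeideal (P i) ?W) \<and> (\<forall>i<n. P i \<subset> P (Suc i))}" for N
  proof (intro CollectI exI conjI allI impI)
    show "primeideal (Q (N - i)) ?W" for i by (rule prime)
    show "Q (N - i) \<subset> Q (N - Suc i)" if "i < N" for i
      using strict[of "N - Suc i"] that by (simp add: Suc_diff_Suc)
  qed
  then have le: "enat N \<le> krull_dim ?W" for N
    unfolding krull_dim_def by (rule SUP_upper)
  show ?thesis
  proof (cases "krull_dim ?W")
    case (enat N)
    then show ?thesis using le[of "Suc N"] by simp
  qed
qed

end

section \<open>Open subgroups of the group of p-adic vectors\<close>

lemma (in group_hom) card_rcosets_kernel:
  assumes "h ` carrier G = carrier H"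
  shows "card (rcosets (kernel G H h)) = card (carrier H)"
  using FactGroup_iso_set[OF assms] bij_betw_same_card by (force simp: iso_def FactGroup_def)

locale padic_vectors =
  fixes p d :: nat
  assumes prime: "Factorial_Ring.prime p" and two_le_d: "2 \<le> d"
begin

abbreviation vectors :: "(nat \<Rightarrow> nat \<Rightarrow> int) monoid"
  where "vectors \<equiv> Zp_power p d"

lemma p_pos: "0 < p" and pow_pos: "0 < (int p) ^ n"
  using prime prime_gt_0_nat by auto

lemma Zp_carrier_iff:
  "x \<in> carrier (Zp p) \<longleftrightarrow>
    (\<forall>n. 0 \<le> x n \<and> x n < int p ^ n) \<and> (\<forall>n. x (Suc n) mod int p ^ n = x n)"
  using p_pos by (auto simp: Zp_def carrier_integer_mod_group PiE_iff)

lemma Zp_mult: "x \<otimes>\<^bsub>Zp p\<^esub> y = (\<lambda>n. (x n + y n) mod int p ^ n)"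
  by (simp add: Zp_def fun_eq_iff)

lemma Zp_one: "\<one>\<^bsub>Zp p\<^esub> = (\<lambda>n. 0)"
  by (simp add: Zp_def fun_eq_iff)

lemma Zp_mod:
  assumes "x \<in> carrier (Zp p)" "m \<le> n"
  shows "x n mod int p ^ m = x m"
  using assms(2)
proof (induction n rule: dec_induct)
  case base
  then show ?case using assms(1) by (simp add: Zp_carrier_iff)
next
  case (step n)
  have "x (Suc n) mod int p ^ m = (x (Suc n) mod int p ^ n) mod int p ^ m"
    using step by (simp add: mod_mod_cancel le_imp_power_dvd)
  then show ?case using step assms(1) by (simp add: Zp_carrier_iff)
qed

lemma mod_power_Suc_mod: "(a mod int p ^ Suc n) mod int p ^ n = a mod int p ^ n"
  by (rule mod_mod_cancel) (simp add: le_imp_power_dvd)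

lemma Zp_comm_group: "comm_group (Zp p)"
proof (rule comm_groupI)
  fix x y z assume x: "x \<in> carrier (Zp p)"
  show "\<one>\<^bsub>Zp p\<^esub> \<otimes>\<^bsub>Zp p\<^esub> x = x"
    using x by (simp add: Zp_mult Zp_one Zp_carrier_iff fun_eq_iff)
  show "\<exists>y\<in>carrier (Zp p). y \<otimes>\<^bsub>Zp p\<^esub> x = \<one>\<^bsub>Zp p\<^esub>"
  proof (intro bexI)
    let ?y = "\<lambda>n. (- x n) mod int p ^ n"
    show "?y \<otimes>\<^bsub>Zp p\<^esub> x = \<one>\<^bsub>Zp p\<^esub>"
      by (simp add: Zp_mult Zp_one mod_add_left_eq)
    have "(- x (Suc n)) mod int p ^ Suc n mod int p ^ n = (- x n) mod int p ^ n" for n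
      using x mod_minus_cong[of "x (Suc n)" "int p ^ n" "x n"]
      by (simp only: mod_power_Suc_mod) (simp add: Zp_carrier_iff)
    then show "?y \<in> carrier (Zp p)"
      using pow_pos by (simp add: Zp_carrier_iff)
  qed
  assume y: "y \<in> carrier (Zp p)"
  show "x \<otimes>\<^bsub>Zp p\<^esub> y = y \<otimes>\<^bsub>Zp p\<^esub> x"
    by (simp add: Zp_mult add.commute)
  have "(x (Suc n) + y (Suc n)) mod int p ^ Suc n mod int p ^ n = (x n + y n) mod int p ^ n" for n
    using x y mod_add_cong[of "x (Suc n)" "int p ^ n" "x n" "y (Suc n)" "y n"]
    by (simp only: mod_power_Suc_mod) (simp add: Zp_carrier_iff)
  then show "x \<otimes>\<^bsub>Zp p\<^esub> y \<in> carrier (Zp p)"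
    using pow_pos by (simp add: Zp_carrier_iff Zp_mult)
  assume z: "z \<in> carrier (Zp p)"
  show "x \<otimes>\<^bsub>Zp p\<^esub> y \<otimes>\<^bsub>Zp p\<^esub> z = x \<otimes>\<^bsub>Zp p\<^esub> (y \<otimes>\<^bsub>Zp p\<^esub> z)"
    by (simp add: Zp_mult mod_add_left_eq mod_add_right_eq add.assoc)
next
  show "\<one>\<^bsub>Zp p\<^esub> \<in> carrier (Zp p)"
    using pow_pos by (simp add: Zp_carrier_iff Zp_one)
qed

lemma vectors_carrier: "carrier vectors = {..<d} \<rightarrow>\<^sub>E carrier (Zp p)"
  by (simp add: Zp_power_def)

lemma vectors_mult: "x \<otimes>\<^bsub>vectors\<^esub> y = (\<lambda>i\<in>{..<d}. x i \<otimes>\<^bsub>Zp p\<^esub> y i)"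
  by (simp add: Zp_power_def)

lemma vectors_one: "\<one>\<^bsub>vectors\<^esub> = (\<lambda>i\<in>{..<d}. \<lambda>n. 0)"
  by (simp add: Zp_power_def Zp_one)

lemma vectors_mult_apply: "i < d \<Longrightarrow> (x \<otimes>\<^bsub>vectors\<^esub> y) i n = (x i n + y i n) mod int p ^ n"
  by (simp add: vectors_mult Zp_mult)

lemma vectors_comm_group: "comm_group vectors"
proof -
  interpret Z: comm_group "Zp p" by (rule Zp_comm_group)
  interpret L: group vectors unfolding Zp_power_def by (rule product_group) (rule Z.is_group)
  show ?thesis
  proof (rule L.group_comm_groupI)
    fix x y assume "x \<in> carrier vectors" "y \<in> carrier vectors"
    then show "x \<otimes>\<^bsub>vectors\<^esub> y = y \<otimes>\<^bsub>vectors\<^esub> x"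
      by (simp add: vectors_mult Zp_mult add.commute)
  qed
qed

sublocale L: comm_group vectors
  by (rule vectors_comm_group)

lemma vectors_mod:
  "x \<in> carrier vectors \<Longrightarrow> i < d \<Longrightarrow> m \<le> n \<Longrightarrow> x i n mod int p ^ m = x i m"
  using Zp_mod[of "x i" m n] by (auto simp: vectors_carrier)

lemma vectors_range: "x \<in> carrier vectors \<Longrightarrow> i < d \<Longrightarrow> 0 \<le> x i n \<and> x i n < int p ^ n"
  by (auto simp: vectors_carrier PiE_iff Zp_carrier_iff)

definition int_vector :: "(nat \<Rightarrow> int) \<Rightarrow> nat \<Rightarrow> nat \<Rightarrow> int"
  where "int_vector k = (\<lambda>i\<in>{..<d}. \<lambda>n. k i mod int p ^ n)"

lemma int_vector_carrier: "int_vector k \<in> carrier vectors"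
  using pow_pos by (auto simp: vectors_carrier int_vector_def Zp_carrier_iff mod_mod_cancel)

lemma int_vector_apply: "i < d \<Longrightarrow> int_vector k i n = k i mod int p ^ n"
  by (simp add: int_vector_def)

lemma int_vector_mult:
  "int_vector k \<otimes>\<^bsub>vectors\<^esub> int_vector l = int_vector (\<lambda>i. k i + l i)"
  by (auto simp: int_vector_def vectors_mult Zp_mult mod_add_eq fun_eq_iff)

lemma int_vector_pow: "int_vector k [^]\<^bsub>vectors\<^esub> (n::nat) = int_vector (\<lambda>i. int n * k i)"
proof (induction n)
  case 0
  then show ?case by (simp add: vectors_one int_vector_def cong: restrict_cong)
next
  case (Suc n)
  then show ?case by (simp add: int_vector_mult algebra_simps)
qed

definition congruence_subgroup :: "nat \<Rightarrow> (nat \<Rightarrow> nat \<Rightarrow> int) set"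
  where "congruence_subgroup m = {x \<in> carrier vectors. \<forall>i<d. x i m = 0}"

lemma congruence_subgroup_eq_kernel:
  defines "R m \<equiv> product_group {..<d} (\<lambda>_. integer_mod_group (p ^ m))"
  shows "group_hom vectors (R m) (\<lambda>x. \<lambda>i\<in>{..<d}. x i m)"
    and "congruence_subgroup m = kernel vectors (R m) (\<lambda>x. \<lambda>i\<in>{..<d}. x i m)"
    and "(\<lambda>x. \<lambda>i\<in>{..<d}. x i m) ` carrier vectors = carrier (R m)"
proof -
  have R: "group (R m)" unfolding R_def by (rule product_group) simp
  show "group_hom vectors (R m) (\<lambda>x. \<lambda>i\<in>{..<d}. x i m)"
  proof (intro group_hom.intro group_hom_axioms.intro L.is_group R homI)
    fix x y assume "x \<in> carrier vectors" "y \<in> carrier vectors"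
    then show "(\<lambda>i\<in>{..<d}. x i m) \<in> carrier (R m)"
      using vectors_range p_pos by (auto simp: R_def carrier_integer_mod_group)
    show "(\<lambda>i\<in>{..<d}. (x \<otimes>\<^bsub>vectors\<^esub> y) i m) =
        (\<lambda>i\<in>{..<d}. x i m) \<otimes>\<^bsub>R m\<^esub> (\<lambda>i\<in>{..<d}. y i m)"
      by (auto simp: R_def vectors_mult_apply fun_eq_iff)
  qed
  show "congruence_subgroup m = kernel vectors (R m) (\<lambda>x. \<lambda>i\<in>{..<d}. x i m)"
    by (auto simp: congruence_subgroup_def kernel_def R_def fun_eq_iff)
  show "(\<lambda>x. \<lambda>i\<in>{..<d}. x i m) ` carrier vectors = carrier (R m)"
  proof (intro equalityI subsetI)
    fix r assume "r \<in> (\<lambda>x. \<lambda>i\<in>{..<d}. x i m) ` carrier vectors"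
    then show "r \<in> carrier (R m)"
      using vectors_range p_pos by (auto simp: R_def carrier_integer_mod_group)
  next
    fix r assume r: "r \<in> carrier (R m)"
    have "r = (\<lambda>i\<in>{..<d}. int_vector r i m)"
      using r p_pos
      by (auto simp: R_def carrier_integer_mod_group PiE_iff extensional_def int_vector_apply fun_eq_iff)
    then show "r \<in> (\<lambda>x. \<lambda>i\<in>{..<d}. x i m) ` carrier vectors"
      using int_vector_carrier by (rule image_eqI)
  qed
qed

lemma congruence_subgroup_subgroup: "subgroup (congruence_subgroup m) vectors"
  unfolding congruence_subgroup_eq_kernel(2)
  by (rule group_hom.subgroup_kernel[OF congruence_subgroup_eq_kernel(1)])

lemma card_rcosets_congruence_subgroup:
  "card (rcosets\<^bsub>vectors\<^esub> congruence_subgroup m) = p ^ (m * d)"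
  unfolding congruence_subgroup_eq_kernel(2)
  using group_hom.card_rcosets_kernel[OF congruence_subgroup_eq_kernel(1,3)] p_pos
  by (simp add: card_PiE carrier_integer_mod_group power_mult nat_power_eq)

lemma Zp_ball_open: "openin (Zp_topology p) {z \<in> carrier (Zp p). z m = c}"
proof -
  let ?P = "product_topology (\<lambda>n. discrete_topology (carrier (integer_mod_group (p ^ n)))) UNIV"
  have "openin ?P {z \<in> topspace ?P. z m \<in> carrier (integer_mod_group (p ^ m)) \<inter> {c}}"
    by (rule openin_continuous_map_preimage[OF continuous_map_product_projection]) auto
  then have "openin (Zp_topology p)
      ({z \<in> topspace ?P. z m \<in> carrier (integer_mod_group (p ^ m)) \<inter> {c}} \<inter> carrier (Zp p))"
    unfolding Zp_topology_def by (rule openin_subtopology_Int)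
  moreover have "{z \<in> topspace ?P. z m \<in> carrier (integer_mod_group (p ^ m)) \<inter> {c}} \<inter>
      carrier (Zp p) = {z \<in> carrier (Zp p). z m = c}"
    by (auto simp: Zp_def)
  ultimately show ?thesis by simp
qed

lemma Zp_zero_neighbourhood:
  assumes V: "openin (Zp_topology p) V" and 0: "(\<lambda>n. 0) \<in> V"
  shows "\<exists>m. \<forall>y\<in>carrier (Zp p). y m = 0 \<longrightarrow> y \<in> V"
proof -
  let ?D = "\<lambda>n. discrete_topology (carrier (integer_mod_group (p ^ n)))"
  obtain W where W: "openin (product_topology ?D UNIV) W" "V = W \<inter> carrier (Zp p)"
    using V by (auto simp: Zp_topology_def openin_subtopology)
  obtain B where B: "(\<lambda>n. 0) \<in> (\<Pi>\<^sub>E i\<in>UNIV. B i)" "finite {i. B i \<noteq> topspace (?D i)}"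
    "(\<Pi>\<^sub>E i\<in>UNIV. B i) \<subseteq> W"
    using product_topology_open_contains_basis[OF W(1), of "\<lambda>n. 0"] 0 W(2) by auto
  obtain m where m: "\<And>i. B i \<noteq> topspace (?D i) \<Longrightarrow> i \<le> m"
    using B(2) by (auto simp: finite_nat_set_iff_bounded_le)
  have "y \<in> V" if y: "y \<in> carrier (Zp p)" "y m = 0" for y
  proof -
    have "y i \<in> B i" for i
    proof (cases "i \<le> m")
      case True
      then have "y i = 0" using Zp_mod[OF y(1) True] y(2) by simp
      then show ?thesis using B(1) by auto
    next
      case False
      then have "B i = carrier (integer_mod_group (p ^ i))" using m[of i] by auto
      then show ?thesis using y(1) by (auto simp: Zp_def)
    qed
    then have "y \<in> W" using B(3) by auto
    then show ?thesis using W(2) y(1) by simp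
  qed
  then show ?thesis by blast
qed

text \<open>
  A basic neighbourhood of the identity restricts finitely many residues of each of the \<open>d\<close>
  coordinates, and all of them vanish with the residue modulo a single large power of \<open>p\<close>.
\<close>

lemma open_contains_congruence_subgroup:
  assumes S: "openin (Zp_power_topology p d) S" and one: "\<one>\<^bsub>vectors\<^esub> \<in> S"
  shows "\<exists>m. congruence_subgroup m \<subseteq> S"
proof -
  obtain B where B: "\<one>\<^bsub>vectors\<^esub> \<in> (\<Pi>\<^sub>E i\<in>{..<d}. B i)" "\<And>i. openin (Zp_topology p) (B i)"
    "(\<Pi>\<^sub>E i\<in>{..<d}. B i) \<subseteq> S"
    using product_topology_open_contains_basis[OF S[unfolded Zp_power_topology_def] one] by auto
  have "\<exists>m. \<forall>y\<in>carrier (Zp p). y m = 0 \<longrightarrow> y \<in> B i" if "i < d" for i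
    using B(1) that by (intro Zp_zero_neighbourhood B(2)) (auto simp: vectors_one PiE_iff)
  then obtain m where m: "\<And>i y. i < d \<Longrightarrow> y \<in> carrier (Zp p) \<Longrightarrow> y (m i) = 0 \<Longrightarrow> y \<in> B i"
    by metis
  define M where "M = (\<Sum>i<d. m i)"
  have "congruence_subgroup M \<subseteq> (\<Pi>\<^sub>E i\<in>{..<d}. B i)"
  proof
    fix x assume "x \<in> congruence_subgroup M"
    then have x: "x \<in> carrier vectors" "\<And>i. i < d \<Longrightarrow> x i M = 0"
      by (auto simp: congruence_subgroup_def)
    have "x i \<in> B i" if i: "i < d" for i
    proof (rule m[OF i])
      show "x i \<in> carrier (Zp p)" using x(1) i by (auto simp: vectors_carrier)
      have "m i \<le> M" unfolding M_def using i by (intro member_le_sum) auto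
      from vectors_mod[OF x(1) i this] show "x i (m i) = 0" using x(2)[OF i] by simp
    qed
    then show "x \<in> (\<Pi>\<^sub>E i\<in>{..<d}. B i)" using x(1) by (auto simp: vectors_carrier)
  qed
  then show ?thesis using B(3) by blast
qed

lemma open_if_contains_congruence_subgroup:
  assumes H: "subgroup H vectors" and m: "congruence_subgroup m \<subseteq> H"
  shows "openin (Zp_power_topology p d) H"
proof (subst openin_subopen, intro ballI)
  fix x assume x: "x \<in> H"
  then have xc: "x \<in> carrier vectors" using subgroup.mem_carrier[OF H] by simp
  let ?U = "\<Pi>\<^sub>E i\<in>{..<d}. {z \<in> carrier (Zp p). z m = x i m}"
  have "openin (Zp_power_topology p d) ?U"
    unfolding Zp_power_topology_def by (subst openin_PiE) (auto simp: Zp_ball_open)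
  moreover have "x \<in> ?U" using xc by (auto simp: vectors_carrier)
  moreover have "?U \<subseteq> H"
  proof
    fix y assume y: "y \<in> ?U"
    then have yc: "y \<in> carrier vectors" and ym: "\<And>i. i < d \<Longrightarrow> y i m = x i m"
      by (auto simp: vectors_carrier)
    define z where "z = y \<otimes>\<^bsub>vectors\<^esub> inv\<^bsub>vectors\<^esub> x"
    have zc: "z \<in> carrier vectors" using xc yc by (simp add: z_def)
    have yz: "y = z \<otimes>\<^bsub>vectors\<^esub> x" using xc yc by (simp add: z_def L.m_assoc)
    have "z i m = 0" if i: "i < d" for i
    proof -
      have "(z i m + x i m) mod int p ^ m = (0 + x i m) mod int p ^ m"
        using vectors_mult_apply[OF i, of z x m] ym[OF i] vectors_range[OF xc i, of m] yz by simp
      then have "z i m mod int p ^ m = 0 mod int p ^ m"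
        by (metis add_diff_cancel_right' mod_diff_left_eq)
      then show ?thesis using vectors_range[OF zc i, of m] by simp
    qed
    then have "z \<in> H" using zc m by (auto simp: congruence_subgroup_def)
    then show "y \<in> H" using yz x subgroup.m_closed[OF H] by simp
  qed
  ultimately show "\<exists>T. openin (Zp_power_topology p d) T \<and> x \<in> T \<and> T \<subseteq> H" by blast
qed

lemma open_subgroups_iff:
  "H \<in> open_subgroups vectors (Zp_power_topology p d) \<longleftrightarrow>
    subgroup H vectors \<and> (\<exists>m. congruence_subgroup m \<subseteq> H)"
  using open_contains_congruence_subgroup[of H] open_if_contains_congruence_subgroup[of H]
    subgroup.one_closed[of H vectors]
  by (auto simp: open_subgroups_def)

lemma congruence_subgroup_mono: "m \<le> n \<Longrightarrow> congruence_subgroup n \<subseteq> congruence_subgroup m"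
proof
  fix x assume mn: "m \<le> n" and x: "x \<in> congruence_subgroup n"
  then show "x \<in> congruence_subgroup m"
    using vectors_mod[of x _ m n] by (auto simp: congruence_subgroup_def)
qed

sublocale abelian_pro_p vectors "Zp_power_topology p d" p
proof unfold_locales
  let ?O = "open_subgroups vectors (Zp_power_topology p d)"
  show "Factorial_Ring.prime p" by (rule prime)
  show "carrier vectors \<in> ?O"
    using L.subgroup_self by (auto simp: open_subgroups_iff congruence_subgroup_def)
  fix H assume H: "H \<in> ?O"
  then obtain m where m: "congruence_subgroup m \<subseteq> H" and Hs: "subgroup H vectors"
    by (auto simp: open_subgroups_iff)
  show "\<exists>n. card (rcosets\<^bsub>vectors\<^esub> H) = p ^ n"
  proof -
    have "card (rcosets\<^bsub>vectors\<^esub> H) dvd p ^ (m * d)"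
      using L.card_rcosets_tower[OF congruence_subgroup_subgroup Hs m]
      by (simp add: card_rcosets_congruence_subgroup)
    then show ?thesis using divides_primepow_nat[OF prime] by blast
  qed
  fix K
  show "K \<in> ?O" if "subgroup K vectors" "H \<subseteq> K"
    using that m by (auto simp: open_subgroups_iff)
  assume K: "K \<in> ?O"
  then obtain n where n: "congruence_subgroup n \<subseteq> K" and Ks: "subgroup K vectors"
    by (auto simp: open_subgroups_iff)
  have "congruence_subgroup (max m n) \<subseteq> H \<inter> K"
    using congruence_subgroup_mono[of m "max m n"] congruence_subgroup_mono[of n "max m n"] m n
    by auto
  moreover have "subgroup (H \<inter> K) vectors"
    using Hs Ks by (rule L.subgroups_Inter_pair)
  ultimately show "H \<inter> K \<in> ?O" by (auto simp: open_subgroups_iff)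
qed

section \<open>Infinitely many lines through the origin\<close>

text \<open>
  The linear forms \<open>x\<^sub>0 - p\<^sup>n x\<^sub>1\<close> give infinitely many quotients of \<open>\<int>\<^sub>p\<^sup>d\<close> isomorphic to
  \<open>\<int>\<^sub>p\<close>. For \<open>n \<noteq> m\<close> the kernels of two of them modulo \<open>p\<^sup>s\<close> coincide only if
  \<open>s \<le> min n m\<close>, as the vector \<open>(p\<^sup>n, 1)\<close> shows.
\<close>

definition line_form :: "nat \<Rightarrow> nat \<Rightarrow> (nat \<Rightarrow> nat \<Rightarrow> int) \<Rightarrow> int"
  where "line_form n s x = (x 0 s - int p ^ n * x 1 s) mod int p ^ s"

definition line_subgroup :: "nat \<Rightarrow> nat \<Rightarrow> (nat \<Rightarrow> nat \<Rightarrow> int) set"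
  where "line_subgroup n s = {x \<in> carrier vectors. line_form n s x = 0}"

lemma coordinates: "0 < d" "1 < d"
  using two_le_d by auto

lemma mod_sub_mult: "(a mod q - c * (b mod q)) mod q = (a - c * b) mod q" for a b c q :: int
proof -
  have "(a mod q - c * (b mod q)) mod q = (a mod q - c * (b mod q) mod q) mod q"
    by (rule mod_diff_right_eq[symmetric])
  also have "\<dots> = (a mod q - c * b mod q) mod q" by (simp only: mod_mult_right_eq)
  also have "\<dots> = (a - c * b) mod q" by (rule mod_diff_eq)
  finally show ?thesis .
qed

lemma line_form_mult:
  "line_form n s (x \<otimes>\<^bsub>vectors\<^esub> y) = (line_form n s x + line_form n s y) mod int p ^ s"
proof -
  have "line_form n s (x \<otimes>\<^bsub>vectors\<^esub> y) =
      ((x 0 s + y 0 s) mod int p ^ s - int p ^ n * ((x 1 s + y 1 s) mod int p ^ s)) mod int p ^ s"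
    using coordinates by (simp add: line_form_def vectors_mult_apply)
  also have "\<dots> = ((x 0 s + y 0 s) - int p ^ n * (x 1 s + y 1 s)) mod int p ^ s"
    by (rule mod_sub_mult)
  also have "\<dots> = ((x 0 s - int p ^ n * x 1 s) + (y 0 s - int p ^ n * y 1 s)) mod int p ^ s"
    by (simp add: algebra_simps)
  finally show ?thesis by (simp add: line_form_def mod_add_eq)
qed

lemma line_form_int_vector: "line_form n s (int_vector k) = (k 0 - int p ^ n * k 1) mod int p ^ s"
proof -
  have "line_form n s (int_vector k) =
      (k 0 mod int p ^ s - int p ^ n * (k 1 mod int p ^ s)) mod int p ^ s"
    using coordinates by (simp add: line_form_def int_vector_apply)
  also have "\<dots> = (k 0 - int p ^ n * k 1) mod int p ^ s"
    by (rule mod_sub_mult)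
  finally show ?thesis .
qed

lemma line_form_range: "0 \<le> line_form n s x \<and> line_form n s x < int p ^ s"
  using pow_pos by (simp add: line_form_def)

lemma line_form_mod:
  assumes x: "x \<in> carrier vectors" and "t \<le> s"
  shows "line_form n s x mod int p ^ t = line_form n t x"
proof -
  have "line_form n s x mod int p ^ t = (x 0 s - int p ^ n * x 1 s) mod int p ^ t"
    unfolding line_form_def using assms(2) by (intro mod_mod_cancel le_imp_power_dvd)
  also have "\<dots> = (x 0 s mod int p ^ t - int p ^ n * (x 1 s mod int p ^ t)) mod int p ^ t"
    by (rule mod_sub_mult[symmetric])
  also have "\<dots> = line_form n t x"
    using vectors_mod[OF x coordinates(1) assms(2)] vectors_mod[OF x coordinates(2) assms(2)]
    by (simp add: line_form_def)
  finally show ?thesis .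
qed

lemma line_subgroup_eq_kernel:
  shows "group_hom vectors (integer_mod_group (p ^ s)) (line_form n s)"
    and "line_subgroup n s = kernel vectors (integer_mod_group (p ^ s)) (line_form n s)"
    and "line_form n s ` carrier vectors = carrier (integer_mod_group (p ^ s))"
proof -
  have car: "carrier (integer_mod_group (p ^ s)) = {0..<int p ^ s}"
    using p_pos by (simp add: carrier_integer_mod_group)
  show "group_hom vectors (integer_mod_group (p ^ s)) (line_form n s)"
    by (intro group_hom.intro group_hom_axioms.intro L.is_group homI)
      (auto simp: car line_form_range line_form_mult)
  show "line_subgroup n s = kernel vectors (integer_mod_group (p ^ s)) (line_form n s)"
    by (simp add: line_subgroup_def kernel_def)
  show "line_form n s ` carrier vectors = carrier (integer_mod_group (p ^ s))"
  proof (intro equalityI subsetI)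
    fix r assume "r \<in> line_form n s ` carrier vectors"
    then show "r \<in> carrier (integer_mod_group (p ^ s))" using line_form_range by (auto simp: car)
  next
    fix r assume "r \<in> carrier (integer_mod_group (p ^ s))"
    then have "r = line_form n s (int_vector (\<lambda>i. if i = 0 then r else 0))"
      by (simp add: line_form_int_vector car)
    then show "r \<in> line_form n s ` carrier vectors"
      using int_vector_carrier by (rule image_eqI)
  qed
qed

lemma line_subgroup_open: "line_subgroup n s \<in> opens"
proof -
  have "subgroup (line_subgroup n s) vectors"
    unfolding line_subgroup_eq_kernel(2)
    by (rule group_hom.subgroup_kernel[OF line_subgroup_eq_kernel(1)])
  moreover have "congruence_subgroup s \<subseteq> line_subgroup n s"
    using coordinates by (auto simp: congruence_subgroup_def line_subgroup_def line_form_def)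
  ultimately show ?thesis unfolding open_subgroups_iff by blast
qed

lemma index_exp_line_subgroup: "index_exp (line_subgroup n s) = s"
proof -
  have "card (rcosets\<^bsub>vectors\<^esub> line_subgroup n s) = p ^ s"
    unfolding line_subgroup_eq_kernel(2)
    using group_hom.card_rcosets_kernel[OF line_subgroup_eq_kernel(1,3)] p_pos
    by (simp add: carrier_integer_mod_group nat_power_eq)
  then have "p ^ index_exp (line_subgroup n s) = p ^ s"
    using card_rcosets[OF line_subgroup_open] by simp
  then show ?thesis by (simp only: power_inject_exp[OF p_gt_1])
qed

lemma line_subgroup_mono: "t \<le> s \<Longrightarrow> line_subgroup n s \<subseteq> line_subgroup n t"
  using line_form_mod[of _ t s n] by (auto simp: line_subgroup_def) (metis mod_0)

lemma pow_index_mem: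
  assumes K: "K \<in> opens" and x: "x \<in> carrier vectors"
  shows "x [^]\<^bsub>vectors\<^esub> (p ^ index_exp K) \<in> K"
proof -
  have Ks: "subgroup K vectors" using K opens_subgroup by simp
  interpret N: normal K vectors using L.subgroup_imp_normal[OF Ks] .
  interpret Q: group "vectors Mod K" by (rule N.factorgroup_is_group)
  have ord: "Coset.order (vectors Mod K) = p ^ index_exp K"
    using card_rcosets[OF K] by (simp add: Coset.order_def FactGroup_def)
  have "K #>\<^bsub>vectors\<^esub> x \<in> carrier (vectors Mod K)"
    using rcoset_in_rcosets[OF K x] by (simp add: FactGroup_def)
  from Q.pow_order_eq_1[OF this] have "K #>\<^bsub>vectors\<^esub> (x [^]\<^bsub>vectors\<^esub> (p ^ index_exp K)) = K"
    by (simp add: ord N.FactGroup_pow[OF x])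
  then show ?thesis
    using L.rcos_self[OF L.nat_pow_closed[OF x, of "p ^ index_exp K"] Ks] by simp
qed

text \<open>
  An overgroup \<open>K\<close> of index \<open>p\<^sup>j\<close> contains \<open>p\<^sup>j\<close> times every vector. A vector on which the form
  vanishes modulo \<open>p\<^sup>j\<close> differs from such a multiple by an element of \<open>line_subgroup n s\<close>.
\<close>

lemma line_subgroup_chain: "cyclic_chain (line_subgroup n)"
  unfolding cyclic_chain_def
proof (intro allI conjI line_subgroup_open index_exp_line_subgroup)
  fix s
  show "overgroups (line_subgroup n s) = line_subgroup n ` {..s}"
  proof (intro equalityI subsetI)
    fix K assume "K \<in> line_subgroup n ` {..s}"
    then show "K \<in> overgroups (line_subgroup n s)"
      using line_subgroup_open by (auto simp: overgroups_def intro: subsetD[OF line_subgroup_mono])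
  next
    fix K assume "K \<in> overgroups (line_subgroup n s)"
    then have K: "K \<in> opens" "line_subgroup n s \<subseteq> K" by (auto simp: overgroups_def)
    define j where "j = index_exp K"
    have js: "j \<le> s"
      using card_rcosets_tower_exp(1)[OF line_subgroup_open K] index_exp_line_subgroup
      by (simp add: j_def)
    have "line_subgroup n j \<subseteq> K"
    proof
      fix x assume "x \<in> line_subgroup n j"
      then have x: "x \<in> carrier vectors" "line_form n j x = 0" by (auto simp: line_subgroup_def)
      then have "int p ^ j dvd line_form n s x"
        using line_form_mod[OF x(1) js, of n] by (simp add: dvd_eq_mod_eq_0)
      then obtain c where c: "line_form n s x = int p ^ j * c" by (rule dvdE)
      define y where "y = int_vector (\<lambda>i. if i = 0 then int p ^ j * c else 0)"
      have "y = int_vector (\<lambda>i. if i = 0 then c else 0) [^]\<^bsub>vectors\<^esub> (p ^ j)"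
        unfolding y_def int_vector_pow by (rule arg_cong[of _ _ int_vector]) auto
      then have yK: "y \<in> K"
        using pow_index_mem[OF K(1) int_vector_carrier] by (simp add: j_def)
      have yc: "y \<in> carrier vectors" unfolding y_def by (rule int_vector_carrier)
      define z where "z = x \<otimes>\<^bsub>vectors\<^esub> inv\<^bsub>vectors\<^esub> y"
      have zc: "z \<in> carrier vectors" using x yc by (simp add: z_def)
      have xz: "x = z \<otimes>\<^bsub>vectors\<^esub> y" using x yc by (simp add: z_def L.m_assoc)
      have "line_form n s y = line_form n s x"
        using line_form_range[of n s x] by (simp add: y_def line_form_int_vector flip: c)
      then have "(line_form n s z + line_form n s x) mod int p ^ s = (0 + line_form n s x) mod int p ^ s"
        using line_form_mult[of n s z y] xz line_form_range[of n s x] by simp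
      then have "line_form n s z mod int p ^ s = 0 mod int p ^ s"
        by (metis add_diff_cancel_right' mod_diff_left_eq)
      then have "line_form n s z = 0" using line_form_range[of n s z] by simp
      then have "z \<in> K" using zc K(2) by (auto simp: line_subgroup_def)
      then show "x \<in> K" using xz yK subgroup.m_closed[OF opens_subgroup[OF K(1)]] by simp
    qed
    then have "line_subgroup n j = K"
      using index_exp_inj[OF line_subgroup_open K(1)] index_exp_line_subgroup by (simp add: j_def)
    then show "K \<in> line_subgroup n ` {..s}" using js by auto
  qed
qed

lemma prime_power_dvd_diff:
  assumes "int p ^ s dvd int p ^ m * (int p ^ Suc k - 1)"
  shows "s \<le> m"
proof (rule ccontr)
  assume "\<not> s \<le> m"
  then have "int p ^ m * int p dvd int p ^ s"
    using le_imp_power_dvd[of "Suc m" s "int p"] by (simp add: mult.commute)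
  then have "int p ^ m * int p dvd int p ^ m * (int p ^ Suc k - 1)"
    using assms by (rule dvd_trans)
  then have "int p dvd int p ^ Suc k - 1" using p_pos by simp
  moreover have "int p dvd int p ^ Suc k" by simp
  ultimately have "int p dvd int p ^ Suc k - (int p ^ Suc k - 1)" by (rule dvd_diff[rotated])
  then show False using p_gt_1 by simp
qed

lemma line_subgroup_separated:
  assumes eq: "line_subgroup n s = line_subgroup m s"
  shows "n = m \<or> s \<le> m"
proof -
  let ?v = "int_vector (\<lambda>i. if i = 0 then int p ^ n else 1)"
  have "?v \<in> line_subgroup n s"
    by (simp add: line_subgroup_def int_vector_carrier line_form_int_vector)
  then have "?v \<in> line_subgroup m s" using eq by simp
  then have "line_form m s ?v = 0" by (simp add: line_subgroup_def)
  then have dvd: "int p ^ s dvd int p ^ n - int p ^ m"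
    by (simp add: line_form_int_vector dvd_eq_mod_eq_0)
  consider "n = m" | "m < n" | "n < m" by linarith
  then show ?thesis
  proof cases
    case 2
    then obtain k where "n = m + Suc k" by (metis add_Suc_right less_imp_Suc_add)
    then have "int p ^ n - int p ^ m = int p ^ m * (int p ^ Suc k - 1)"
      by (simp only: power_add right_diff_distrib mult_1_right)
    with dvd show ?thesis using prime_power_dvd_diff[of s m k] by simp
  next
    case 3
    then obtain k where "m = n + Suc k" by (metis add_Suc_right less_imp_Suc_add)
    then have "int p ^ m - int p ^ n = int p ^ n * (int p ^ Suc k - 1)"
      by (simp only: power_add right_diff_distrib mult_1_right)
    with dvd have "s \<le> n" using prime_power_dvd_diff[of s n k] by (simp add: dvd_diff_commute)
    with 3 show ?thesis by simp
  qed simp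
qed

end

theorem theorem6p5:
  fixes p d :: nat
  assumes "Factorial_Ring.prime p"
    and "CHAR('k::field) = p"
    and "d \<ge> 2"
  shows "krull_dim (witt_burnside_ring (Zp_power p d) (Zp_power_topology p d) :: (_ \<Rightarrow> 'k) ring) = \<infinity>"
proof -
  interpret padic_vectors p d using assms by unfold_locales
  have "of_nat p = (0 :: 'k)" using assms(2) of_nat_CHAR by metis
  then show ?thesis
    by (rule krull_dim_infinite[OF _ line_subgroup_chain line_subgroup_separated])
qed

end
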